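(* Let $T>0$ be fixed and let $\alpha:[0,T)\to\mathbb{R}$ be a continuously differentiable function with $\lim_{t\uparrow T}\alpha(t)=1$. For $C\in(0,\infty)$ define $q_C:[0,T)\to\mathbb{R}$ by $$q_C(t):=-\frac{\alpha(t)}{T-t}+\frac{1}{C\exp\left\{-2\int_0^t\frac{\alpha(s)}{T-s}\,\mathrm{d}s\right\}+\int_0^t\exp\left\{-2\int_s^t\frac{\alpha(u)}{T-u}\,\mathrm{d}u\right\}\mathrm{d}s},\qquad t\in[0,T).$$ (i) Consider the Ornstein-Uhlenbeck type process $(Z_t)_{t\ge0}$ given by the SDE $\mathrm{d}Z_t=q(t)Z_t\,\mathrm{d}t+\sigma(t)\,\mathrm{d}B_t$, $t\ge0$, with continuous functions $q:[0,\infty)\to\mathbb{R}$ and $\sigma:[0,\infty)\to\mathbb{R}$, and suppose that $q$ is continuously differentiable on $[0,T)$. If the law of the Ornstein-Uhlenbeck type bridge from $0$ to $0$ over the time-interval $[0,T]$ derived from $Z$ coincides with the law of the general $\alpha$-Wiener bridge, then there is some $C\in(0,\infty)$ such that $q(t)=q_C(t)$ for all $t\in[0,T)$, and either $\sigma(t)=1$ for all $t\in[0,T)$ or $\sigma(t)=-1$ for all $t\in[0,T)$. (ii) Let $C\in(0,\infty)$. If $\lim_{t\uparrow T}q_C(t)\in\mathbb{R}$ exists, then there exists a continuous function $q:[0,\infty)\to\mathbb{R}$ such that $q(t)=q_C(t)$ for all $t\in[0,T)$, and for all such extensions $q$, the law of the Ornstein-Uhlenbeck type bridge from $0$ to $0$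 over the time-interval $[0,T]$ derived from $Z$ given by the SDE $\mathrm{d}Z_t=q(t)Z_t\,\mathrm{d}t+\sigma(t)\,\mathrm{d}B_t$, $t\ge0$, with $\sigma(t)=1$ for all $t\in[0,T)$, or $\sigma(t)=-1$ for all $t\in[0,T)$, coincides with the law of the general $\alpha$-Wiener bridge.
   Context: Ornstein-Uhlenbeck type process: the strong solution $(Z_t)_{t\ge0}$ of $\mathrm{d}Z_t=q(t)Z_t\,\mathrm{d}t+\sigma(t)\,\mathrm{d}B_t$, $t\ge 0$, where $q:[0,\infty)\to\mathbb{R}$ and $\sigma:[0,\infty)\to\mathbb{R}$ are continuous functions with $\sigma(t)\neq0$ for all $t\ge0$, $(B_t)_{t\ge0}$ is a one-dimensional standard Wiener process, and the initial value $Z_0$ has a Gauss (Gaussian, possibly degenerate) distribution and is independent of $B$. Put $\bar q(t):=\int_0^t q(u)\,\mathrm{d}u$ and $\gamma(s,t):=\int_s^t e^{2(\bar q(t)-\bar q(u))}\sigma^2(u)\,\mathrm{d}u$ for $0\le s\le t$. The bridge of Ornstein-Uhlenbeck type from $0$ to $0$ over $[0,T]$ derived from $Z$ is the process $$U_t=\int_0^t\frac{\gamma(t,T)}{\gamma(s,T)}e^{\bar q(t)-\bar q(s)}\sigma(s)\,\mathrm{d}B_s,\quad t\in[0,T),\qquad U_T=0,$$ which is an almost surely continuous Gauss process on $[0,T]$, or more generally any almost surely continuous process on $[0,T]$ having the same finite-dimensional distributions. For a continuous function $\alpha:[0,T)\to\mathbb{R}$, the general $\alpha$-Wiener bridge is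 the unique strong solution $(X_t)_{t\in[0,T)}$ of $\mathrm{d}X_t=-\frac{\alpha(t)}{T-t}X_t\,\mathrm{d}t+\mathrm{d}B_t$, $t\in[0,T)$, $X_0=0$, namely $X_t=\int_0^t\exp\{-\int_s^t\frac{\alpha(u)}{T-u}\mathrm{d}u\}\,\mathrm{d}B_s$, $t\in[0,T)$, or more generally any almost surely continuous process on $[0,T)$ with the same finite-dimensional distributions. The laws of the bridge and of the general $\alpha$-Wiener bridge coincide if the two processes have the same finite-dimensional distributions on $[0,T)$. *)

theory Defs
  imports "HOL-Probability.Probability"
begin

definition continuously_differentiable_on :: "(real \<Rightarrow> real) \<Rightarrow> real set \<Rightarrow> bool" where
  "continuously_differentiable_on f S \<longleftrightarrow>
     (\<exists>f'. (\<forall>t\<in>S. (f has_real_derivative f' t) (at t within S)) \<and> continuous_on S f')"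

text \<open>
  Standard one-dimensional Wiener process. Processes are functions of a real time parameter;
  only their values on the relevant time set are constrained.
\<close>

locale wiener_process = prob_space M for M :: "'a measure" +
  fixes B :: "real \<Rightarrow> 'a \<Rightarrow> real"
  assumes wiener_measurable: "\<And>t. 0 \<le> t \<Longrightarrow> B t \<in> borel_measurable M"
    and wiener_0: "AE \<omega> in M. B 0 \<omega> = 0"
    and wiener_continuous: "AE \<omega> in M. continuous_on {0..} (\<lambda>t. B t \<omega>)"
    and wiener_increment: "\<And>s t. 0 \<le> s \<Longrightarrow> s < t \<Longrightarrow>
          distributed M lborel (\<lambda>\<omega>. B t \<omega> - B s \<omega>) (normal_density 0 (sqrt (t - s)))"
    and wiener_indep: "\<And>n (t :: nat \<Rightarrow> real). 0 \<le> t 0 \<Longrightarrow> (\<And>i. i < n \<Longrightarrow> t i < t (Suc i)) \<Longrightarrow>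
          indep_vars (\<lambda>_. borel) (\<lambda>i \<omega>. B (t (Suc i)) \<omega> - B (t i) \<omega>) {..<n}"

text \<open>
  \<open>is_wiener_integral M B a b f I\<close>: the random variable \<open>I\<close> is a version of the stochastic
  integral of the deterministic function \<open>f\<close> over \<open>[a,b]\<close> with respect to \<open>B\<close>, i.e. the limit
  in \<open>L\<^sup>2(M)\<close> of the elementary integrals of step functions
  (value \<open>c k i\<close> on \<open>(p k i, p k (i + 1)]\<close>, for \<open>i < n k\<close>) converging to \<open>f\<close> in \<open>L\<^sup>2[a,b]\<close>.
  The limit is determined up to null sets and does not depend on the chosen step functions.
\<close>

definition step_function :: "nat \<Rightarrow> (nat \<Rightarrow> real) \<Rightarrow> (nat \<Rightarrow> real) \<Rightarrow> real \<Rightarrow> real" where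
  "step_function n p c u = (\<Sum>i<n. c i * indicator {p i<..p (Suc i)} u)"

definition step_integral ::
    "(real \<Rightarrow> 'a \<Rightarrow> real) \<Rightarrow> nat \<Rightarrow> (nat \<Rightarrow> real) \<Rightarrow> (nat \<Rightarrow> real) \<Rightarrow> 'a \<Rightarrow> real" where
  "step_integral B n p c \<omega> = (\<Sum>i<n. c i * (B (p (Suc i)) \<omega> - B (p i) \<omega>))"

definition is_wiener_integral ::
    "'a measure \<Rightarrow> (real \<Rightarrow> 'a \<Rightarrow> real) \<Rightarrow> real \<Rightarrow> real \<Rightarrow> (real \<Rightarrow> real) \<Rightarrow> ('a \<Rightarrow> real) \<Rightarrow> bool" where
  "is_wiener_integral M B a b f I \<longleftrightarrow>
     set_borel_measurable lborel {a..b} f \<and> I \<in> borel_measurable M \<and>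
     (\<exists>n p c.
        (\<forall>k. p k 0 = a \<and> p k (n k) = b \<and> (\<forall>i<n k. p k i \<le> p k (Suc i))) \<and>
        (\<lambda>k. \<integral>\<^sup>+u\<in>{a..b}. ennreal ((f u - step_function (n k) (p k) (c k) u)\<^sup>2) \<partial>lborel)
           \<longlonglongrightarrow> 0 \<and>
        (\<lambda>k. \<integral>\<^sup>+\<omega>. ennreal ((I \<omega> - step_integral B (n k) (p k) (c k) \<omega>)\<^sup>2) \<partial>M) \<longlonglongrightarrow> 0)"

definition gauss_distributed :: "'a measure \<Rightarrow> ('a \<Rightarrow> real) \<Rightarrow> bool" where
  "gauss_distributed M X \<longleftrightarrow> X \<in> borel_measurable M \<and>
     ((\<exists>m. AE \<omega> in M. X \<omega> = m) \<or> (\<exists>m s. 0 < s \<and> distributed M lborel X (normal_density m s)))"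

text \<open>
  The filtration generated by an initial value and the driving process, augmented by the
  null sets.
\<close>

definition augmented_filtration ::
    "'a measure \<Rightarrow> (real \<Rightarrow> 'a \<Rightarrow> real) \<Rightarrow> ('a \<Rightarrow> real) \<Rightarrow> real \<Rightarrow> 'a measure" where
  "augmented_filtration M B Z0 t = sigma (space M)
     ({Z0 -` A \<inter> space M | A. A \<in> sets borel} \<union>
      {B s -` A \<inter> space M | s A. 0 \<le> s \<and> s \<le> t \<and> A \<in> sets borel} \<union> null_sets M)"

text \<open>
  Strong solutions on a time interval \<open>I\<close> starting at 0 of the equation
  \<open>dZ\<^sub>t = q(t) Z\<^sub>t dt + \<sigma>(t) dB\<^sub>t\<close>. As \<open>\<sigma>\<close> is deterministic, the stochastic integral is a Wiener
  integral.
\<close>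

definition strong_solution ::
    "'a measure \<Rightarrow> (real \<Rightarrow> 'a \<Rightarrow> real) \<Rightarrow> real set \<Rightarrow> (real \<Rightarrow> real) \<Rightarrow> (real \<Rightarrow> real)
       \<Rightarrow> (real \<Rightarrow> 'a \<Rightarrow> real) \<Rightarrow> bool" where
  "strong_solution M B I q \<sigma> Z \<longleftrightarrow>
     Z 0 \<in> borel_measurable M \<and>
     (\<forall>t\<in>I. Z t \<in> borel_measurable (augmented_filtration M B (Z 0) t)) \<and>
     (AE \<omega> in M. continuous_on I (\<lambda>t. Z t \<omega>)) \<and>
     (\<forall>t\<in>I. \<exists>J. is_wiener_integral M B 0 t \<sigma> J \<and>
        (AE \<omega> in M. Z t \<omega> = Z 0 \<omega> + integral {0..t} (\<lambda>u. q u * Z u \<omega>) + J \<omega>))"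

definition ou_process ::
    "'a measure \<Rightarrow> (real \<Rightarrow> 'a \<Rightarrow> real) \<Rightarrow> (real \<Rightarrow> real) \<Rightarrow> (real \<Rightarrow> real)
       \<Rightarrow> (real \<Rightarrow> 'a \<Rightarrow> real) \<Rightarrow> bool" where
  "ou_process M B q \<sigma> Z \<longleftrightarrow>
     wiener_process M B \<and>
     continuous_on {0..} q \<and> continuous_on {0..} \<sigma> \<and> (\<forall>t\<ge>0. \<sigma> t \<noteq> 0) \<and>
     gauss_distributed M (Z 0) \<and>
     prob_space.indep_set M
       {Z 0 -` A \<inter> space M | A. A \<in> sets borel}
       (sigma_sets (space M) {B s -` A \<inter> space M | s A. 0 \<le> s \<and> A \<in> sets borel}) \<and>
     strong_solution M B {0..} q \<sigma> Z"

text \<open>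
  Equality of the finite-dimensional distributions on the time set \<open>I\<close>, for processes possibly
  living on different probability spaces.
\<close>

definition same_fdd ::
    "real set \<Rightarrow> 'a measure \<Rightarrow> (real \<Rightarrow> 'a \<Rightarrow> real) \<Rightarrow> 'b measure \<Rightarrow> (real \<Rightarrow> 'b \<Rightarrow> real) \<Rightarrow> bool" where
  "same_fdd I M X N Y \<longleftrightarrow>
     (\<forall>J. finite J \<and> J \<subseteq> I \<longrightarrow>
        distr M (\<Pi>\<^sub>M t\<in>J. borel) (\<lambda>\<omega>. \<lambda>t\<in>J. X t \<omega>) =
        distr N (\<Pi>\<^sub>M t\<in>J. borel) (\<lambda>\<omega>. \<lambda>t\<in>J. Y t \<omega>))"

definition continuous_process :: "real set \<Rightarrow> 'a measure \<Rightarrow> (real \<Rightarrow> 'a \<Rightarrow> real) \<Rightarrow> bool" where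
  "continuous_process I M X \<longleftrightarrow>
     prob_space M \<and> (\<forall>t\<in>I. X t \<in> borel_measurable M) \<and>
     (AE \<omega> in M. continuous_on I (\<lambda>t. X t \<omega>))"

definition q_bar :: "(real \<Rightarrow> real) \<Rightarrow> real \<Rightarrow> real" where
  "q_bar q t = integral {0..t} q"

definition ou_gamma :: "(real \<Rightarrow> real) \<Rightarrow> (real \<Rightarrow> real) \<Rightarrow> real \<Rightarrow> real \<Rightarrow> real" where
  "ou_gamma q \<sigma> s t = integral {s..t} (\<lambda>u. exp (2 * (q_bar q t - q_bar q u)) * (\<sigma> u)\<^sup>2)"

text \<open>
  \<open>ou_bridge M B q \<sigma> Z T N U\<close>: the process \<open>U\<close> on \<open>N\<close> is a bridge from 0 to 0 over \<open>[0,T]\<close> derived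
  from the Ornstein-Uhlenbeck type process \<open>Z\<close> on \<open>M\<close>. The process \<open>V\<close> is the one given by the
  stochastic integral; \<open>U\<close> is any almost surely continuous process with the
  finite-dimensional distributions of \<open>V\<close>.
\<close>

definition ou_bridge ::
    "'a measure \<Rightarrow> (real \<Rightarrow> 'a \<Rightarrow> real) \<Rightarrow> (real \<Rightarrow> real) \<Rightarrow> (real \<Rightarrow> real) \<Rightarrow> (real \<Rightarrow> 'a \<Rightarrow> real)
       \<Rightarrow> real \<Rightarrow> 'b measure \<Rightarrow> (real \<Rightarrow> 'b \<Rightarrow> real) \<Rightarrow> bool" where
  "ou_bridge M B q \<sigma> Z T N U \<longleftrightarrow>
     ou_process M B q \<sigma> Z \<and> continuous_process {0..T} N U \<and>
     (\<exists>V. (\<forall>t\<in>{0..<T}. is_wiener_integral M B 0 t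
              (\<lambda>s. ou_gamma q \<sigma> t T / ou_gamma q \<sigma> s T * exp (q_bar q t - q_bar q s) * \<sigma> s) (V t)) \<and>
          (\<forall>\<omega>\<in>space M. V T \<omega> = 0) \<and>
          same_fdd {0..T} N U M V)"

text \<open>
  \<open>alpha_wiener_bridge M B \<alpha> T N X\<close>: the process \<open>X\<close> on \<open>N\<close> is a general \<open>\<alpha>\<close>-Wiener bridge, i.e.
  almost surely continuous on \<open>[0,T)\<close> with the finite-dimensional distributions of a strong
  solution \<open>Y\<close>, driven by \<open>B\<close> on \<open>M\<close>, of the defining equation.
\<close>

definition alpha_wiener_bridge ::
    "'a measure \<Rightarrow> (real \<Rightarrow> 'a \<Rightarrow> real) \<Rightarrow> (real \<Rightarrow> real) \<Rightarrow> real
       \<Rightarrow> 'b measure \<Rightarrow> (real \<Rightarrow> 'b \<Rightarrow> real) \<Rightarrow> bool" where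
  "alpha_wiener_bridge M B \<alpha> T N X \<longleftrightarrow>
     wiener_process M B \<and> continuous_process {0..<T} N X \<and>
     (\<exists>Y. strong_solution M B {0..<T} (\<lambda>t. - (\<alpha> t / (T - t))) (\<lambda>_. 1) Y \<and>
          (AE \<omega> in M. Y 0 \<omega> = 0) \<and>
          same_fdd {0..<T} N X M Y)"

definition q_C :: "real \<Rightarrow> (real \<Rightarrow> real) \<Rightarrow> real \<Rightarrow> real \<Rightarrow> real" where
  "q_C T \<alpha> C t =
     - (\<alpha> t / (T - t)) +
     1 / (C * exp (- 2 * integral {0..t} (\<lambda>s. \<alpha> s / (T - s)))
          + integral {0..t} (\<lambda>s. exp (- 2 * integral {s..t} (\<lambda>u. \<alpha> u / (T - u)))))"

end

theory Submission
  imports Defs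
begin

text \<open>
  Both processes are Wiener integrals of product kernels, so their covariance at \<open>s \<le> t\<close> has the form
  \<open>G(s) G(t) \<integral>\<^sub>0\<^sup>s h\<^sup>2\<close>. With \<open>a(t) = exp (- \<integral>\<^sub>0\<^sup>t \<alpha>(u)/(T-u) du)\<close> the \<open>\<alpha>\<close>-Wiener bridge has \<open>G = a\<close>, \<open>h = 1/a\<close>;
  the Ornstein-Uhlenbeck bridge has \<open>G = \<phi> e\<^bsup>Q\<^esup>\<close>, \<open>h = \<sigma> e\<^bsup>-Q\<^esup>/\<phi>\<close>, where \<open>\<phi>(t) = \<gamma>(t,T)\<close> and \<open>Q\<close> is the
  primitive of \<open>q\<close>. Equality of the covariances forces \<open>\<phi> e\<^bsup>Q\<^esup> = c a\<close> and \<open>\<sigma>\<^sup>2 = 1\<close>, after which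
  \<open>(1/\<phi>)'\<close> is a constant multiple of \<open>1/a\<^sup>2\<close> and \<open>q = a'/a - \<phi>'/\<phi>\<close> is read off. Conversely, for \<open>q = q\<^sub>C\<close> one finds
  \<open>e\<^bsup>Q\<^esup> = a (C + \<integral>\<^sub>0\<^sup>t 1/a\<^sup>2) / C\<close>, and since \<open>\<alpha> \<rightarrow> 1\<close> makes \<open>\<integral>\<^sub>0\<^sup>t 1/a\<^sup>2\<close> diverge as \<open>t \<rightarrow> T\<close>, the two kernels
  agree up to the sign of \<open>\<sigma>\<close>. Equality of kernels gives equality of laws by approximating both
  integrals with the same step functions.
\<close>

section \<open>Limits in \<open>L\<^sup>2\<close>\<close>

text \<open>The two directions use laws differently. From the law of the bridge to the coefficients,
  equality of laws enters through second moments alone, so no Gaussian law has to be identified.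
  Conversely whole laws must be matched; neither is computed, since step integrals against two
  Wiener processes are the same function of finitely many values, whose joint law does not depend on
  the driving process. The obstacle is that the \<alpha>-Wiener bridge is given by an equation: its
  integral form is recovered path by path from Euler sums, without stochastic calculus, and then
  turned into an L2 statement. The parameter C enters as the constant of integration when
  (1/\<phi>)' is integrated from 0; explicitly C = \<phi>(0) e^(-2Q(T)), the integral of e^(-2Q)
  \<sigma>^2 over [0, T], which is why C > 0. Conversely the drift determines \<phi> only up to an
  additive constant; as \<phi>(T) = 0, divergence of the integral of 1/a^2 makes that constant
  vanish.\<close>

lemma integrable_square_if_nn_integral_finite:
  fixes f :: "'a \<Rightarrow> real"
  assumes "f \<in> borel_measurable M" "(\<integral>\<^sup>+x. ennreal ((f x)\<^sup>2) \<partial>M) < \<infinity>"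
  shows "integrable M (\<lambda>x. (f x)\<^sup>2)"
  using assms by (intro integrableI_nonneg) auto

lemma integrable_mult_square_integrable:
  fixes f g :: "'a \<Rightarrow> real"
  assumes [measurable]: "f \<in> borel_measurable M" "g \<in> borel_measurable M"
    and f: "integrable M (\<lambda>x. (f x)\<^sup>2)" and g: "integrable M (\<lambda>x. (g x)\<^sup>2)"
  shows "integrable M (\<lambda>x. f x * g x)"
proof (rule Bochner_Integration.integrable_bound)
  show "integrable M (\<lambda>x. (f x)\<^sup>2 + (g x)\<^sup>2)"
    using f g by simp
  have "\<bar>f x * g x\<bar> \<le> (f x)\<^sup>2 + (g x)\<^sup>2" for x
  proof -
    have "0 \<le> (\<bar>f x\<bar> - \<bar>g x\<bar>)\<^sup>2" "0 \<le> \<bar>f x\<bar> * \<bar>g x\<bar>" by simp_all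
    then show ?thesis unfolding power2_diff abs_mult power2_abs by linarith
  qed
  then show "AE x in M. norm (f x * g x) \<le> norm ((f x)\<^sup>2 + (g x)\<^sup>2)"
    by auto
qed measurable

lemma integrable_square_add:
  fixes f g :: "'a \<Rightarrow> real"
  assumes [measurable]: "f \<in> borel_measurable M" "g \<in> borel_measurable M"
    and f: "integrable M (\<lambda>x. (f x)\<^sup>2)" and g: "integrable M (\<lambda>x. (g x)\<^sup>2)"
  shows "integrable M (\<lambda>x. (f x + g x)\<^sup>2)" "integrable M (\<lambda>x. (f x - g x)\<^sup>2)"
  using f g integrable_mult_square_integrable[OF assms]
  by (auto simp: power2_sum power2_diff mult.assoc)

lemma integral_mult_le_sqrt:
  fixes f g :: "'a \<Rightarrow> real"
  assumes [measurable]: "f \<in> borel_measurable M" "g \<in> borel_measurable M"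
    and f: "integrable M (\<lambda>x. (f x)\<^sup>2)" and g: "integrable M (\<lambda>x. (g x)\<^sup>2)"
  shows "(\<integral>x. \<bar>f x * g x\<bar> \<partial>M) \<le> sqrt (\<integral>x. (f x)\<^sup>2 \<partial>M) * sqrt (\<integral>x. (g x)\<^sup>2 \<partial>M)"
proof -
  have "(\<integral>\<^sup>+x. ennreal \<bar>f x\<bar> * ennreal \<bar>g x\<bar> \<partial>M)\<^sup>2
      \<le> (\<integral>\<^sup>+x. (ennreal \<bar>f x\<bar>)\<^sup>2 \<partial>M) * (\<integral>\<^sup>+x. (ennreal \<bar>g x\<bar>)\<^sup>2 \<partial>M)"
    by (rule Cauchy_Schwarz_nn_integral) auto
  moreover have "(\<integral>\<^sup>+x. ennreal \<bar>f x\<bar> * ennreal \<bar>g x\<bar> \<partial>M) = ennreal (\<integral>x. \<bar>f x * g x\<bar> \<partial>M)"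
    using integrable_abs[OF integrable_mult_square_integrable[OF assms]]
    by (subst nn_integral_eq_integral[symmetric]) (auto simp: ennreal_mult abs_mult)
  moreover have "(\<integral>\<^sup>+x. (ennreal \<bar>f x\<bar>)\<^sup>2 \<partial>M) = ennreal (\<integral>x. (f x)\<^sup>2 \<partial>M)"
    using f by (subst nn_integral_eq_integral[symmetric]) (auto simp: ennreal_power)
  moreover have "(\<integral>\<^sup>+x. (ennreal \<bar>g x\<bar>)\<^sup>2 \<partial>M) = ennreal (\<integral>x. (g x)\<^sup>2 \<partial>M)"
    using g by (subst nn_integral_eq_integral[symmetric]) (auto simp: ennreal_power)
  ultimately have "(\<integral>x. \<bar>f x * g x\<bar> \<partial>M)\<^sup>2 \<le> (\<integral>x. (f x)\<^sup>2 \<partial>M) * (\<integral>x. (g x)\<^sup>2 \<partial>M)"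
    by (simp add: ennreal_power flip: ennreal_mult)
  then show ?thesis
    by (metis real_le_rsqrt real_sqrt_mult)
qed

text \<open>Once the distance to some \<open>F k\<close> is finite, f = (f - F k) + F k is a sum of
  two square integrable functions. Stating the convergence in \<open>ennreal\<close> makes square
  integrability of f a conclusion; it is not among the clauses of
  \<open>is_wiener_integral\<close>.\<close>

lemma integrable_square_L2_limit:
  fixes f :: "'a \<Rightarrow> real"
  assumes [measurable]: "f \<in> borel_measurable M" "\<And>k. F k \<in> borel_measurable M"
    and F: "\<And>k. integrable M (\<lambda>x. (F k x)\<^sup>2)"
    and lim: "(\<lambda>k. \<integral>\<^sup>+x. ennreal ((f x - F k x)\<^sup>2) \<partial>M) \<longlonglongrightarrow> 0"
  shows "integrable M (\<lambda>x. (f x)\<^sup>2)"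
    and "(\<lambda>k. \<integral>x. (f x - F k x)\<^sup>2 \<partial>M) \<longlonglongrightarrow> 0"
proof -
  have "\<forall>\<^sub>F k in sequentially. (\<integral>\<^sup>+x. ennreal ((f x - F k x)\<^sup>2) \<partial>M) < \<infinity>"
    using lim by (rule order_tendstoD) simp
  then obtain k where "(\<integral>\<^sup>+x. ennreal ((f x - F k x)\<^sup>2) \<partial>M) < \<infinity>"
    using eventually_happens' sequentially_bot by blast
  then have "integrable M (\<lambda>x. (f x - F k x)\<^sup>2)"
    by (intro integrable_square_if_nn_integral_finite) auto
  from integrable_square_add(1)[OF _ _ this F[of k]] show f: "integrable M (\<lambda>x. (f x)\<^sup>2)"
    by simp
  have "(\<integral>\<^sup>+x. ennreal ((f x - F k x)\<^sup>2) \<partial>M) = ennreal (\<integral>x. (f x - F k x)\<^sup>2 \<partial>M)" for k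
    using integrable_square_add(2)[OF _ _ f F] by (intro nn_integral_eq_integral) auto
  with lim have "(\<lambda>k. ennreal (\<integral>x. (f x - F k x)\<^sup>2 \<partial>M)) \<longlonglongrightarrow> ennreal 0"
    by simp
  then show "(\<lambda>k. \<integral>x. (f x - F k x)\<^sup>2 \<partial>M) \<longlonglongrightarrow> 0"
    by (subst (asm) tendsto_ennreal_iff) auto
qed

text \<open>Continuity of the inner product: with d = f - F and e = g - G one has F G - f g = d e -
  f e - d g, and Cauchy-Schwarz bounds each of the three integrals.\<close>

lemma L2_inner_tendsto:
  fixes f g :: "'a \<Rightarrow> real"
  assumes [measurable]: "f \<in> borel_measurable M" "\<And>k. F k \<in> borel_measurable M"
    and F: "\<And>k. integrable M (\<lambda>x. (F k x)\<^sup>2)"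
    and limF: "(\<lambda>k. \<integral>\<^sup>+x. ennreal ((f x - F k x)\<^sup>2) \<partial>M) \<longlonglongrightarrow> 0"
  assumes [measurable]: "g \<in> borel_measurable M" "\<And>k. G k \<in> borel_measurable M"
    and G: "\<And>k. integrable M (\<lambda>x. (G k x)\<^sup>2)"
    and limG: "(\<lambda>k. \<integral>\<^sup>+x. ennreal ((g x - G k x)\<^sup>2) \<partial>M) \<longlonglongrightarrow> 0"
  shows "(\<lambda>k. \<integral>x. F k x * G k x \<partial>M) \<longlonglongrightarrow> (\<integral>x. f x * g x \<partial>M)"
proof -
  note f = integrable_square_L2_limit[OF assms(1-4)] and g = integrable_square_L2_limit[OF assms(5-8)]
  let ?N = "\<lambda>h. sqrt (\<integral>x. (h x)\<^sup>2 \<partial>M)"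
  let ?d = "\<lambda>k x. f x - F k x" and ?e = "\<lambda>k x. g x - G k x"
  note sq = integrable_square_add(2)[OF _ _ f(1) F] integrable_square_add(2)[OF _ _ g(1) G]
  note int = integrable_mult_square_integrable
  have "norm ((\<integral>x. F k x * G k x \<partial>M) - (\<integral>x. f x * g x \<partial>M))
      \<le> ?N (?d k) * ?N (?e k) + ?N f * ?N (?e k) + ?N (?d k) * ?N g" for k
  proof -
    have "(\<integral>x. F k x * G k x \<partial>M) - (\<integral>x. f x * g x \<partial>M)
        = (\<integral>x. ?d k x * ?e k x - f x * ?e k x - ?d k x * g x \<partial>M)"
      by (subst Bochner_Integration.integral_diff[symmetric])
        (auto intro!: int F G f g Bochner_Integration.integral_cong simp: algebra_simps)
    also have "\<dots> = (\<integral>x. ?d k x * ?e k x \<partial>M) - (\<integral>x. f x * ?e k x \<partial>M) - (\<integral>x. ?d k x * g x \<partial>M)"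
      using int[OF _ _ sq(1) sq(2)] int[OF _ _ f(1) sq(2)] int[OF _ _ sq(1) g(1)] by simp
    finally have eq: "(\<integral>x. F k x * G k x \<partial>M) - (\<integral>x. f x * g x \<partial>M) = \<dots>" .
    have CS: "\<bar>\<integral>x. u x * v x \<partial>M\<bar> \<le> ?N u * ?N v"
      if "u \<in> borel_measurable M" "v \<in> borel_measurable M"
        "integrable M (\<lambda>x. (u x)\<^sup>2)" "integrable M (\<lambda>x. (v x)\<^sup>2)" for u v
      using integral_abs_bound integral_mult_le_sqrt[OF that] by (rule order_trans)
    show ?thesis
      unfolding eq
      using CS[OF _ _ sq(1) sq(2), of k k] CS[OF _ _ f(1) sq(2), of k] CS[OF _ _ sq(1) g(1), of k]
      by simp
  qed
  then have "\<forall>\<^sub>F k in sequentially. norm ((\<integral>x. F k x * G k x \<partial>M) - (\<integral>x. f x * g x \<partial>M))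
      \<le> ?N (?d k) * ?N (?e k) + ?N f * ?N (?e k) + ?N (?d k) * ?N g"
    by (intro always_eventually allI)
  moreover have "(\<lambda>k. ?N (?d k) * ?N (?e k) + ?N f * ?N (?e k) + ?N (?d k) * ?N g)
      \<longlonglongrightarrow> sqrt 0 * sqrt 0 + ?N f * sqrt 0 + sqrt 0 * ?N g"
    by (intro tendsto_intros f g)
  then have "(\<lambda>k. ?N (?d k) * ?N (?e k) + ?N f * ?N (?e k) + ?N (?d k) * ?N g) \<longlonglongrightarrow> 0"
    by simp
  ultimately have "(\<lambda>k. (\<integral>x. F k x * G k x \<partial>M) - (\<integral>x. f x * g x \<partial>M)) \<longlonglongrightarrow> 0"
    by (rule Lim_null_comparison)
  then show ?thesis
    by (rule LIM_zero_cancel)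
qed

section \<open>Step functions and their integrals against a Wiener process\<close>

lemma partition_mono:
  fixes p :: "nat \<Rightarrow> real"
  assumes "\<And>i. i < n \<Longrightarrow> p i \<le> p (Suc i)" "i \<le> j" "j \<le> n"
  shows "p i \<le> p j"
  using assms(2,3)
proof (induction rule: dec_induct)
  case (step k)
  then show ?case using assms(1)[of k] by simp
qed simp

lemma borel_measurable_step_function [measurable]: "step_function n p c \<in> borel_measurable borel"
  unfolding step_function_def by measurable

lemma step_function_eq_0:
  assumes "\<And>i. i < n \<Longrightarrow> p i \<le> p (Suc i)" "u \<notin> {p 0<..p n}"
  shows "step_function n p c u = 0"
  unfolding step_function_def
proof (intro sum.neutral ballI)
  fix i assume "i \<in> {..<n}"
  then have "p 0 \<le> p i" "p (Suc i) \<le> p n"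
    by (intro partition_mono[where n = n and p = p, OF assms(1)]; simp)+
  with assms(2) show "c i * indicator {p i<..p (Suc i)} u = 0"
    by (auto simp: indicator_def)
qed

text \<open>Weakly increasing partition points make the left-open cells pairwise disjoint, so a
  single summand survives. Repeated points give empty cells, which contribute nothing.\<close>

lemma step_function_eq_coeff:
  assumes "\<And>i. i < n \<Longrightarrow> p i \<le> p (Suc i)" "i < n" "u \<in> {p i<..p (Suc i)}"
  shows "step_function n p c u = c i"
proof -
  have "c j * indicator {p j<..p (Suc j)} u = (if j = i then c i else 0)" if "j < n" for j
  proof (cases j i rule: linorder_cases)
    case less
    then have "p (Suc j) \<le> p i" using assms(2) by (intro partition_mono[where n = n and p = p, OF assms(1)]) auto
    with less assms(3) show ?thesis by simp
  next
    case greater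
    then have "p (Suc i) \<le> p j" using that by (intro partition_mono[where n = n and p = p, OF assms(1)]) auto
    with greater assms(3) show ?thesis by simp
  qed (use assms(3) in simp)
  then show ?thesis
    unfolding step_function_def using \<open>i < n\<close> by simp
qed

text \<open>The length of the overlap is written with four minima because the covariance
  \<open>min s t\<close> of a Wiener process expands into exactly these for two increments. The
  isometry for step functions then holds term by term, without cases on the order of the
  points.\<close>

lemma integral_indicator_Ioc_mult:
  fixes a b c d :: real
  assumes "a \<le> b" "c \<le> d"
  shows "integrable lborel (\<lambda>u. indicator {a<..b} u * indicator {c<..d} u :: real)"
    and "(\<integral>u. indicator {a<..b} u * indicator {c<..d} u \<partial>lborel)
      = min b d - min a d - min b c + min a c"
proof -
  have eq: "(\<lambda>u. indicator {a<..b} u * indicator {c<..d} u :: real) = indicator {max a c<..min b d}"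
    by (auto simp: indicator_def fun_eq_iff)
  show "integrable lborel (\<lambda>u. indicator {a<..b} u * indicator {c<..d} u :: real)"
    unfolding eq by (cases "max a c \<le> min b d") auto
  show "(\<integral>u. indicator {a<..b} u * indicator {c<..d} u \<partial>lborel)
      = min b d - min a d - min b c + min a c"
    unfolding eq using assms by (cases "max a c \<le> min b d") (auto simp: min_def max_def split: if_splits)
qed

lemma integral_double_sum:
  fixes F :: "'i \<Rightarrow> 'j \<Rightarrow> 'a \<Rightarrow> real"
  assumes "\<And>i j. i \<in> I \<Longrightarrow> j \<in> J \<Longrightarrow> integrable M (F i j)"
  shows "integrable M (\<lambda>x. \<Sum>i\<in>I. \<Sum>j\<in>J. c i j * F i j x)"
    and "(\<integral>x. (\<Sum>i\<in>I. \<Sum>j\<in>J. c i j * F i j x) \<partial>M) = (\<Sum>i\<in>I. \<Sum>j\<in>J. c i j * (\<integral>x. F i j x \<partial>M))"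
proof -
  have inner: "integrable M (\<lambda>x. \<Sum>j\<in>J. c i j * F i j x)" if "i \<in> I" for i
    using assms that by (intro Bochner_Integration.integrable_sum integrable_mult_right)
  then show "integrable M (\<lambda>x. \<Sum>i\<in>I. \<Sum>j\<in>J. c i j * F i j x)"
    by (rule Bochner_Integration.integrable_sum)
  have "(\<integral>x. (\<Sum>i\<in>I. \<Sum>j\<in>J. c i j * F i j x) \<partial>M) = (\<Sum>i\<in>I. \<integral>x. (\<Sum>j\<in>J. c i j * F i j x) \<partial>M)"
    using inner by (rule Bochner_Integration.integral_sum)
  also have "\<dots> = (\<Sum>i\<in>I. \<Sum>j\<in>J. \<integral>x. c i j * F i j x \<partial>M)"
    using assms by (intro sum.cong Bochner_Integration.integral_sum integrable_mult_right) auto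
  finally show "(\<integral>x. (\<Sum>i\<in>I. \<Sum>j\<in>J. c i j * F i j x) \<partial>M) = (\<Sum>i\<in>I. \<Sum>j\<in>J. c i j * (\<integral>x. F i j x \<partial>M))"
    by simp
qed

lemma step_function_mult_integral:
  assumes "\<And>i. i < n \<Longrightarrow> p i \<le> p (Suc i)" "\<And>i. i < m \<Longrightarrow> q i \<le> q (Suc i)"
  shows "integrable lborel (\<lambda>u. step_function n p c u * step_function m q d u)"
    and "(\<integral>u. step_function n p c u * step_function m q d u \<partial>lborel) =
      (\<Sum>i<n. \<Sum>j<m. c i * d j * (min (p (Suc i)) (q (Suc j)) - min (p i) (q (Suc j))
        - min (p (Suc i)) (q j) + min (p i) (q j)))"
proof -
  have eq: "step_function n p c u * step_function m q d u = (\<Sum>i<n. \<Sum>j<m.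
      c i * d j * (indicator {p i<..p (Suc i)} u * indicator {q j<..q (Suc j)} u))" for u
    unfolding step_function_def sum_product by (intro sum.cong refl) (simp add: algebra_simps)
  show "integrable lborel (\<lambda>u. step_function n p c u * step_function m q d u)"
    unfolding eq using assms by (intro integral_double_sum integral_indicator_Ioc_mult) auto
  show "(\<integral>u. step_function n p c u * step_function m q d u \<partial>lborel) =
      (\<Sum>i<n. \<Sum>j<m. c i * d j * (min (p (Suc i)) (q (Suc j)) - min (p i) (q (Suc j))
        - min (p (Suc i)) (q j) + min (p i) (q j)))"
    unfolding eq using integral_indicator_Ioc_mult[OF assms]
    by (subst integral_double_sum(2)) auto
qed

context wiener_process
begin

lemma expectation_square_increment:
  assumes "0 \<le> s" "s \<le> t"
  shows "integrable M (\<lambda>\<omega>. (B t \<omega> - B s \<omega>)\<^sup>2)" and "expectation (\<lambda>\<omega>. (B t \<omega> - B s \<omega>)\<^sup>2) = t - s"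
proof -
  have "integrable M (\<lambda>\<omega>. (B t \<omega> - B s \<omega>)\<^sup>2) \<and> expectation (\<lambda>\<omega>. (B t \<omega> - B s \<omega>)\<^sup>2) = t - s"
  proof (cases "s = t")
    case False
    then have pos: "0 < sqrt (t - s)" using assms by simp
    have D: "distributed M lborel (\<lambda>\<omega>. B t \<omega> - B s \<omega>) (normal_density 0 (sqrt (t - s)))"
      using assms False by (intro wiener_increment) auto
    have "integrable M (\<lambda>\<omega>. (B t \<omega> - B s \<omega>)\<^sup>2)"
      using integrable_normal_moment[OF pos, of 0 2]
      by (subst distributed_integrable[OF D, symmetric]) auto
    moreover have "expectation (\<lambda>\<omega>. (B t \<omega> - B s \<omega>)\<^sup>2) = t - s"
      using normal_distributed_variance[OF pos D] normal_distributed_expectation[OF pos D] assms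
      by simp
    ultimately show ?thesis by simp
  qed simp
  then show "integrable M (\<lambda>\<omega>. (B t \<omega> - B s \<omega>)\<^sup>2)" "expectation (\<lambda>\<omega>. (B t \<omega> - B s \<omega>)\<^sup>2) = t - s"
    by auto
qed

lemma expectation_square:
  assumes "0 \<le> t"
  shows "integrable M (\<lambda>\<omega>. (B t \<omega>)\<^sup>2)" and "expectation (\<lambda>\<omega>. (B t \<omega>)\<^sup>2) = t"
proof -
  note [measurable] = wiener_measurable[OF assms] wiener_measurable[OF order_refl]
  have eq: "AE \<omega> in M. (B t \<omega> - B 0 \<omega>)\<^sup>2 = (B t \<omega>)\<^sup>2"
    using wiener_0 by eventually_elim simp
  show "integrable M (\<lambda>\<omega>. (B t \<omega>)\<^sup>2)"
    using expectation_square_increment(1)[OF order_refl assms]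
    by (subst integrable_cong_AE[OF _ _ eq, symmetric]) auto
  show "expectation (\<lambda>\<omega>. (B t \<omega>)\<^sup>2) = t"
    using expectation_square_increment(2)[OF order_refl assms]
    by (subst integral_cong_AE[OF _ _ eq, symmetric]) auto
qed

text \<open>The covariance follows by polarization from the variances of the increments.\<close>

lemma expectation_mult:
  assumes "0 \<le> s" "0 \<le> t"
  shows "integrable M (\<lambda>\<omega>. B s \<omega> * B t \<omega>)" and "expectation (\<lambda>\<omega>. B s \<omega> * B t \<omega>) = min s t"
proof -
  note [measurable] = wiener_measurable[OF assms(1)] wiener_measurable[OF assms(2)]
  note sq = expectation_square[OF assms(1)] expectation_square[OF assms(2)]
  show int: "integrable M (\<lambda>\<omega>. B s \<omega> * B t \<omega>)"
    by (intro integrable_mult_square_integrable sq) measurable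
  have "expectation (\<lambda>\<omega>. (B t \<omega> - B s \<omega>)\<^sup>2) = \<bar>t - s\<bar>"
    using expectation_square_increment(2)[of s t] expectation_square_increment(2)[of t s] assms
    by (cases "s \<le> t") (auto simp: power2_commute)
  also have "(\<lambda>\<omega>. (B t \<omega> - B s \<omega>)\<^sup>2) = (\<lambda>\<omega>. (B t \<omega>)\<^sup>2 + (B s \<omega>)\<^sup>2 - 2 * (B s \<omega> * B t \<omega>))"
    by (auto simp: power2_diff)
  finally show "expectation (\<lambda>\<omega>. B s \<omega> * B t \<omega>) = min s t"
    using sq int by (auto simp: min_def split: if_splits)
qed

lemma expectation_increment_mult:
  assumes "0 \<le> a" "a \<le> b" "0 \<le> c" "c \<le> d"
  shows "integrable M (\<lambda>\<omega>. (B b \<omega> - B a \<omega>) * (B d \<omega> - B c \<omega>))"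
    and "expectation (\<lambda>\<omega>. (B b \<omega> - B a \<omega>) * (B d \<omega> - B c \<omega>))
      = min b d - min a d - min b c + min a c"
proof -
  have eq: "(\<lambda>\<omega>. (B b \<omega> - B a \<omega>) * (B d \<omega> - B c \<omega>))
      = (\<lambda>\<omega>. B b \<omega> * B d \<omega> - B a \<omega> * B d \<omega> - B b \<omega> * B c \<omega> + B a \<omega> * B c \<omega>)"
    by (auto simp: algebra_simps)
  have [simp]: "0 \<le> b" "0 \<le> d" using assms by auto
  show "integrable M (\<lambda>\<omega>. (B b \<omega> - B a \<omega>) * (B d \<omega> - B c \<omega>))"
    "expectation (\<lambda>\<omega>. (B b \<omega> - B a \<omega>) * (B d \<omega> - B c \<omega>)) = min b d - min a d - min b c + min a c"
    unfolding eq using assms by (simp_all add: expectation_mult)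
qed

lemma borel_measurable_step_integral:
  assumes "0 \<le> p 0" "\<And>i. i < n \<Longrightarrow> p i \<le> p (Suc i)"
  shows "step_integral B n p c \<in> borel_measurable M"
proof -
  have "0 \<le> p i" if "i \<le> n" for i
    using partition_mono[where n = n and p = p, OF assms(2) le0 that] assms(1) by simp
  then have "(\<lambda>\<omega>. \<Sum>i<n. c i * (B (p (Suc i)) \<omega> - B (p i) \<omega>)) \<in> borel_measurable M"
    by (intro borel_measurable_sum borel_measurable_times borel_measurable_diff wiener_measurable) auto
  then show ?thesis
    by (simp add: step_integral_def[abs_def])
qed

text \<open>The isometry in bilinear form: both sides expand into double sums over pairs of cells
  and agree on each pair, so two different partitions can be treated without passing to a common
  refinement.\<close>

lemma expectation_step_integral_mult:
  assumes p: "0 \<le> p 0" "\<And>i. i < n \<Longrightarrow> p i \<le> p (Suc i)"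
    and q: "0 \<le> q 0" "\<And>i. i < m \<Longrightarrow> q i \<le> q (Suc i)"
  shows "integrable M (\<lambda>\<omega>. step_integral B n p c \<omega> * step_integral B m q d \<omega>)"
    and "expectation (\<lambda>\<omega>. step_integral B n p c \<omega> * step_integral B m q d \<omega>)
      = (\<integral>u. step_function n p c u * step_function m q d u \<partial>lborel)"
proof -
  have p0: "0 \<le> p i" if "i < n" for i
    using partition_mono[where n = n and p = p and i = 0 and j = i, OF p(2)] p(1) that by simp
  have q0: "0 \<le> q i" if "i < m" for i
    using partition_mono[where n = m and p = q and i = 0 and j = i, OF q(2)] q(1) that by simp
  note inc = expectation_increment_mult[OF p0 p(2) q0 q(2)]
  have eq: "step_integral B n p c \<omega> * step_integral B m q d \<omega> = (\<Sum>i<n. \<Sum>j<m.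
      c i * d j * ((B (p (Suc i)) \<omega> - B (p i) \<omega>) * (B (q (Suc j)) \<omega> - B (q j) \<omega>)))" for \<omega>
    unfolding step_integral_def sum_product by (intro sum.cong refl) (simp add: algebra_simps)
  show "integrable M (\<lambda>\<omega>. step_integral B n p c \<omega> * step_integral B m q d \<omega>)"
    unfolding eq by (intro integral_double_sum inc) auto
  show "expectation (\<lambda>\<omega>. step_integral B n p c \<omega> * step_integral B m q d \<omega>)
      = (\<integral>u. step_function n p c u * step_function m q d u \<partial>lborel)"
    unfolding eq using step_function_mult_integral(2)[where n = n and p = p and m = m and q = q, OF p(2) q(2)] inc
    by (subst integral_double_sum(2)) auto
qed

end

section \<open>Wiener integrals\<close>

lemma set_borel_measurable_lborelD:
  fixes f :: "real \<Rightarrow> real"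
  assumes "set_borel_measurable lborel A f"
  shows "(\<lambda>u. indicator A u * f u) \<in> borel_measurable borel"
  using assms by (simp add: set_borel_measurable_def)

lemma integral_square_diff:
  fixes f g :: "'a \<Rightarrow> real"
  assumes "integrable M (\<lambda>x. f x * f x)" "integrable M (\<lambda>x. g x * g x)" "integrable M (\<lambda>x. f x * g x)"
  shows "(\<integral>\<^sup>+x. ennreal ((f x - g x)\<^sup>2) \<partial>M)
    = ennreal ((\<integral>x. f x * f x \<partial>M) + (\<integral>x. g x * g x \<partial>M) - 2 * (\<integral>x. f x * g x \<partial>M))"
proof -
  have eq: "(f x - g x)\<^sup>2 = f x * f x + g x * g x - 2 * (f x * g x)" for x
    by (simp add: power2_eq_square algebra_simps)
  have "integrable M (\<lambda>x. (f x - g x)\<^sup>2)"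
    unfolding eq using assms by simp
  then have "(\<integral>\<^sup>+x. ennreal ((f x - g x)\<^sup>2) \<partial>M) = ennreal (\<integral>x. (f x - g x)\<^sup>2 \<partial>M)"
    by (rule nn_integral_eq_integral) simp
  then show ?thesis
    unfolding eq using assms by simp
qed

text \<open>The step function vanishes off (a, b], so integrating over the interval amounts to
  cutting off f and integrating over the line. This places integrands with different endpoints in
  one L2 space, where they can be compared.\<close>

lemma set_nn_integral_diff_step_function:
  fixes f :: "real \<Rightarrow> real"
  assumes "p 0 = a" "p n = b" "\<And>i. i < n \<Longrightarrow> p i \<le> p (Suc i)"
  shows "(\<integral>\<^sup>+u\<in>{a..b}. ennreal ((f u - step_function n p c u)\<^sup>2) \<partial>lborel)
    = (\<integral>\<^sup>+u. ennreal ((indicator {a..b} u * f u - step_function n p c u)\<^sup>2) \<partial>lborel)"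
proof (intro nn_integral_cong)
  fix u
  have "step_function n p c u = 0" if "u \<notin> {a..b}"
  proof (rule step_function_eq_0[where n = n and p = p, OF assms(3)])
    show "u \<notin> {p 0<..p n}"
      unfolding assms(1,2) using that by auto
  qed
  then show "ennreal ((f u - step_function n p c u)\<^sup>2) * indicator {a..b} u
      = ennreal ((indicator {a..b} u * f u - step_function n p c u)\<^sup>2)"
    by (cases "u \<in> {a..b}") auto
qed

lemma is_wiener_integral_cong:
  assumes "\<And>u. u \<in> {a..b} \<Longrightarrow> f u = g u"
  shows "is_wiener_integral M B a b f I \<longleftrightarrow> is_wiener_integral M B a b g I"
proof -
  have "set_borel_measurable lborel {a..b} f \<longleftrightarrow> set_borel_measurable lborel {a..b} g"
    unfolding set_borel_measurable_def using assms
    by (intro measurable_cong) (auto simp: indicator_def)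
  moreover have "(\<integral>\<^sup>+u\<in>{a..b}. ennreal ((f u - h u)\<^sup>2) \<partial>lborel)
      = (\<integral>\<^sup>+u\<in>{a..b}. ennreal ((g u - h u)\<^sup>2) \<partial>lborel)" for h
    using assms by (intro nn_integral_cong) (auto simp: indicator_def)
  ultimately show ?thesis
    unfolding is_wiener_integral_def by simp
qed

text \<open>Negating the coefficients turns an approximation of -f for B into one of f for -B with
  the very same random sums. It reduces the case \<sigma> = -1 to the case \<sigma> = 1.\<close>

lemma is_wiener_integral_uminus:
  assumes "is_wiener_integral M B a b (\<lambda>u. - f u) I"
  shows "is_wiener_integral M (\<lambda>t \<omega>. - B t \<omega>) a b f I"
proof -
  from assms obtain n p c where
    meas: "set_borel_measurable lborel {a..b} (\<lambda>u. - f u)" "I \<in> borel_measurable M" and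
    p: "\<forall>k. p k 0 = a \<and> p k (n k) = b \<and> (\<forall>i<n k. p k i \<le> p k (Suc i))" and
    f: "(\<lambda>k. \<integral>\<^sup>+u\<in>{a..b}. ennreal ((- f u - step_function (n k) (p k) (c k) u)\<^sup>2) \<partial>lborel) \<longlonglongrightarrow> 0" and
    I: "(\<lambda>k. \<integral>\<^sup>+\<omega>. ennreal ((I \<omega> - step_integral B (n k) (p k) (c k) \<omega>)\<^sup>2) \<partial>M) \<longlonglongrightarrow> 0"
    unfolding is_wiener_integral_def by blast
  have "step_function n p (\<lambda>i. - c i) u = - step_function n p c u" for n p c u
    by (simp add: step_function_def sum_negf)
  then have sq: "(f u - step_function n p (\<lambda>i. - c i) u)\<^sup>2 = (- f u - step_function n p c u)\<^sup>2" for n p c u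
    by (simp add: power2_eq_square algebra_simps)
  have int: "step_integral (\<lambda>t \<omega>. - B t \<omega>) n p (\<lambda>i. - c i) = step_integral B n p c" for n p c
    by (auto simp: step_integral_def fun_eq_iff algebra_simps)
  have "set_borel_measurable lborel {a..b} f"
    using borel_measurable_uminus[OF meas(1)[unfolded set_borel_measurable_def]]
    by (simp add: set_borel_measurable_def)
  then show ?thesis
    unfolding is_wiener_integral_def using meas(2) p f I
    by (intro conjI exI[of _ n] exI[of _ p] exI[of _ "\<lambda>k i. - c k i"]) (simp_all add: sq int)
qed

context wiener_process
begin

lemma wiener_integralE:
  assumes "is_wiener_integral M B 0 t f I"
  obtains n p c where "\<And>k. p k 0 = 0" "\<And>k. p k (n k) = t" "\<And>k i. i < n k \<Longrightarrow> p k i \<le> p k (Suc i)"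
    "(\<lambda>k. \<integral>\<^sup>+u. ennreal ((indicator {0..t} u * f u - step_function (n k) (p k) (c k) u)\<^sup>2) \<partial>lborel)
      \<longlonglongrightarrow> 0"
    "(\<lambda>k. \<integral>\<^sup>+\<omega>. ennreal ((I \<omega> - step_integral B (n k) (p k) (c k) \<omega>)\<^sup>2) \<partial>M) \<longlonglongrightarrow> 0"
proof -
  from assms obtain n p c where
    p: "\<And>k. p k 0 = 0" "\<And>k. p k (n k) = t" "\<And>k i. i < n k \<Longrightarrow> p k i \<le> p k (Suc i)" and
    f: "(\<lambda>k. \<integral>\<^sup>+u\<in>{0..t}. ennreal ((f u - step_function (n k) (p k) (c k) u)\<^sup>2) \<partial>lborel) \<longlonglongrightarrow> 0" and
    I: "(\<lambda>k. \<integral>\<^sup>+\<omega>. ennreal ((I \<omega> - step_integral B (n k) (p k) (c k) \<omega>)\<^sup>2) \<partial>M) \<longlonglongrightarrow> 0"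
    unfolding is_wiener_integral_def by blast
  have "(\<integral>\<^sup>+u\<in>{0..t}. ennreal ((f u - step_function (n k) (p k) (c k) u)\<^sup>2) \<partial>lborel)
      = (\<integral>\<^sup>+u. ennreal ((indicator {0..t} u * f u - step_function (n k) (p k) (c k) u)\<^sup>2) \<partial>lborel)" for k
    by (rule set_nn_integral_diff_step_function[where p = "p k" and n = "n k", OF p])
  with f have "(\<lambda>k. \<integral>\<^sup>+u. ennreal ((indicator {0..t} u * f u - step_function (n k) (p k) (c k) u)\<^sup>2) \<partial>lborel)
      \<longlonglongrightarrow> 0"
    by simp
  with I p show ?thesis
    by (intro that[of p n c])
qed

text \<open>The isometry passes to the limit: the inner products of the step approximations agree on
  both sides, and continuity of the inner product applies in \<open>lborel\<close> and in
  \<open>M\<close>. The upper limits s and t may differ, since each integrand carries its own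
  cut-off; this is what yields covariances at two times.\<close>

lemma wiener_integral_mult:
  assumes I: "is_wiener_integral M B 0 s f I" and J: "is_wiener_integral M B 0 t g J"
  shows "integrable lborel (\<lambda>u. (indicator {0..s} u * f u) * (indicator {0..t} u * g u))"
    and "integrable M (\<lambda>\<omega>. I \<omega> * J \<omega>)"
    and "expectation (\<lambda>\<omega>. I \<omega> * J \<omega>) = (\<integral>u. (indicator {0..s} u * f u) * (indicator {0..t} u * g u) \<partial>lborel)"
proof -
  obtain n p c where
    p: "\<And>k. p k 0 = 0" "\<And>k. p k (n k) = s" "\<And>k i. i < n k \<Longrightarrow> p k i \<le> p k (Suc i)" and
    pf: "(\<lambda>k. \<integral>\<^sup>+u. ennreal ((indicator {0..s} u * f u - step_function (n k) (p k) (c k) u)\<^sup>2) \<partial>lborel)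
      \<longlonglongrightarrow> 0" and
    pI: "(\<lambda>k. \<integral>\<^sup>+\<omega>. ennreal ((I \<omega> - step_integral B (n k) (p k) (c k) \<omega>)\<^sup>2) \<partial>M) \<longlonglongrightarrow> 0"
    by (rule wiener_integralE[OF I]) (rule that)
  obtain m q d where
    q: "\<And>k. q k 0 = 0" "\<And>k. q k (m k) = t" "\<And>k i. i < m k \<Longrightarrow> q k i \<le> q k (Suc i)" and
    qg: "(\<lambda>k. \<integral>\<^sup>+u. ennreal ((indicator {0..t} u * g u - step_function (m k) (q k) (d k) u)\<^sup>2) \<partial>lborel)
      \<longlonglongrightarrow> 0" and
    qJ: "(\<lambda>k. \<integral>\<^sup>+\<omega>. ennreal ((J \<omega> - step_integral B (m k) (q k) (d k) \<omega>)\<^sup>2) \<partial>M) \<longlonglongrightarrow> 0"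
    by (rule wiener_integralE[OF J]) (rule that)
  have fm: "(\<lambda>u. indicator {0..s} u * f u) \<in> borel_measurable lborel"
    and gm: "(\<lambda>u. indicator {0..t} u * g u) \<in> borel_measurable lborel"
    and Im: "I \<in> borel_measurable M" and Jm: "J \<in> borel_measurable M"
    using I J set_borel_measurable_lborelD by (auto simp: is_wiener_integral_def)
  have sp: "step_function (n k) (p k) (c k) \<in> borel_measurable lborel"
    and sq: "step_function (m k) (q k) (d k) \<in> borel_measurable lborel" for k
    by simp_all
  have spm: "step_integral B (n k) (p k) (c k) \<in> borel_measurable M"
    and sqm: "step_integral B (m k) (q k) (d k) \<in> borel_measurable M" for k
    using p q by (simp_all add: borel_measurable_step_integral)
  have pp: "integrable lborel (\<lambda>u. (step_function (n k) (p k) (c k) u)\<^sup>2)" for k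
    unfolding power2_eq_square by (intro step_function_mult_integral(1) p)
  have qq: "integrable lborel (\<lambda>u. (step_function (m k) (q k) (d k) u)\<^sup>2)" for k
    unfolding power2_eq_square by (intro step_function_mult_integral(1) q)
  have PP: "integrable M (\<lambda>\<omega>. (step_integral B (n k) (p k) (c k) \<omega>)\<^sup>2)" for k
    unfolding power2_eq_square using p by (intro expectation_step_integral_mult(1)) auto
  have QQ: "integrable M (\<lambda>\<omega>. (step_integral B (m k) (q k) (d k) \<omega>)\<^sup>2)" for k
    unfolding power2_eq_square using q by (intro expectation_step_integral_mult(1)) auto
  show "integrable lborel (\<lambda>u. (indicator {0..s} u * f u) * (indicator {0..t} u * g u))"
    by (intro integrable_mult_square_integrable integrable_square_L2_limit(1)[OF _ _ pp pf]
        integrable_square_L2_limit(1)[OF _ _ qq qg] fm gm sp sq)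
  show "integrable M (\<lambda>\<omega>. I \<omega> * J \<omega>)"
    by (intro integrable_mult_square_integrable integrable_square_L2_limit(1)[OF _ _ PP pI]
        integrable_square_L2_limit(1)[OF _ _ QQ qJ] Im Jm spm sqm)
  have "expectation (\<lambda>\<omega>. step_integral B (n k) (p k) (c k) \<omega> * step_integral B (m k) (q k) (d k) \<omega>)
      = (\<integral>u. step_function (n k) (p k) (c k) u * step_function (m k) (q k) (d k) u \<partial>lborel)" for k
    using p q by (intro expectation_step_integral_mult(2)) auto
  then show "expectation (\<lambda>\<omega>. I \<omega> * J \<omega>)
      = (\<integral>u. (indicator {0..s} u * f u) * (indicator {0..t} u * g u) \<partial>lborel)"
    using L2_inner_tendsto[OF fm sp pp pf gm sq qq qg] L2_inner_tendsto[OF Im spm PP pI Jm sqm QQ qJ]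
    by (simp add: LIMSEQ_unique)
qed

lemma wiener_isometry:
  assumes I: "is_wiener_integral M B 0 s f I" and J: "is_wiener_integral M B 0 t g J"
  shows "(\<integral>\<^sup>+\<omega>. ennreal ((I \<omega> - J \<omega>)\<^sup>2) \<partial>M)
    = (\<integral>\<^sup>+u. ennreal ((indicator {0..s} u * f u - indicator {0..t} u * g u)\<^sup>2) \<partial>lborel)"
proof -
  note II = wiener_integral_mult[OF I I] and IJ = wiener_integral_mult[OF I J]
    and JJ = wiener_integral_mult[OF J J]
  show ?thesis
    unfolding integral_square_diff[OF II(2) JJ(2) IJ(2)] integral_square_diff[OF II(1) JJ(1) IJ(1)]
      II(3) JJ(3) IJ(3) ..
qed

lemma is_wiener_integral_step:
  assumes "p 0 = 0" "\<And>i. i < n \<Longrightarrow> p i \<le> p (Suc i)"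
  shows "is_wiener_integral M B 0 (p n) (step_function n p c) (step_integral B n p c)"
  unfolding is_wiener_integral_def
proof (intro conjI)
  show "set_borel_measurable lborel {0..p n} (step_function n p c)"
    by (simp add: set_borel_measurable_def)
  show "step_integral B n p c \<in> borel_measurable M"
    using assms by (intro borel_measurable_step_integral) auto
  show "\<exists>n' p' c'. (\<forall>k. p' k 0 = 0 \<and> p' k (n' k) = p n \<and> (\<forall>i<n' k. p' k i \<le> p' k (Suc i))) \<and>
     (\<lambda>k. \<integral>\<^sup>+u\<in>{0..p n}. ennreal ((step_function n p c u - step_function (n' k) (p' k) (c' k) u)\<^sup>2) \<partial>lborel)
       \<longlonglongrightarrow> 0 \<and>
     (\<lambda>k. \<integral>\<^sup>+\<omega>. ennreal ((step_integral B n p c \<omega> - step_integral B (n' k) (p' k) (c' k) \<omega>)\<^sup>2) \<partial>M) \<longlonglongrightarrow> 0"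
    using assms by (intro exI[of _ "\<lambda>_. n"] exI[of _ "\<lambda>_. p"] exI[of _ "\<lambda>_. c"]) simp
qed

text \<open>The step function is arbitrary and unrelated to the sequence that witnesses
  \<open>I\<close>. Hence step functions chosen for one driving process can be reused for another,
  with the same L2 error.\<close>

lemma wiener_integral_step_dist:
  assumes I: "is_wiener_integral M B 0 t f I"
    and p: "p 0 = 0" "p n = t" "\<And>i. i < n \<Longrightarrow> p i \<le> p (Suc i)"
  shows "(\<integral>\<^sup>+\<omega>. ennreal ((I \<omega> - step_integral B n p c \<omega>)\<^sup>2) \<partial>M)
    = (\<integral>\<^sup>+u. ennreal ((indicator {0..t} u * f u - step_function n p c u)\<^sup>2) \<partial>lborel)"
proof -
  have "step_function n p c u = 0" if "u \<notin> {0..t}" for u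
  proof (rule step_function_eq_0[where n = n and p = p, OF p(3)])
    show "u \<notin> {p 0<..p n}"
      unfolding p(1,2) using that by auto
  qed
  then have "indicator {0..t} u * step_function n p c u = step_function n p c u" for u
    by (cases "u \<in> {0..t}") auto
  with wiener_isometry[OF I is_wiener_integral_step[where n = n and p = p and c = c, OF p(1,3)]] p(2) show ?thesis
    by simp
qed

lemma is_wiener_integral_one_AE:
  assumes J: "is_wiener_integral M B 0 t (\<lambda>_. 1) J" and "0 \<le> t"
  shows "AE \<omega> in M. J \<omega> = B t \<omega>"
proof -
  \<comment> \<open>One cell (0, t] with value 1: its step integral is B t - B 0, and the step
    function differs from the integrand on [0, t] at the single point 0. For t = 0 the cell is
    empty.\<close>
  define p where "p i = (if i = 0 then 0 else t)" for i :: nat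
  have [measurable]: "J \<in> borel_measurable M" "B t \<in> borel_measurable M" "B 0 \<in> borel_measurable M"
    using J assms(2) by (auto simp: is_wiener_integral_def intro: wiener_measurable)
  have "(\<integral>\<^sup>+\<omega>. ennreal ((J \<omega> - step_integral B 1 p (\<lambda>_. 1) \<omega>)\<^sup>2) \<partial>M)
      = (\<integral>\<^sup>+u. ennreal ((indicator {0..t} u * 1 - step_function 1 p (\<lambda>_. 1) u)\<^sup>2) \<partial>lborel)"
    by (rule wiener_integral_step_dist[OF J]) (use assms in \<open>auto simp: p_def\<close>)
  also have "\<dots> = (\<integral>\<^sup>+(u::real). 0 \<partial>lborel)"
    by (rule nn_integral_cong_AE, rule AE_mp[OF AE_lborel_singleton[of 0]])
      (auto simp: step_function_def p_def indicator_def)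
  finally have "(\<integral>\<^sup>+\<omega>. ennreal ((J \<omega> - (B t \<omega> - B 0 \<omega>))\<^sup>2) \<partial>M) = 0"
    by (simp add: step_integral_def p_def)
  then have "AE \<omega> in M. ennreal ((J \<omega> - (B t \<omega> - B 0 \<omega>))\<^sup>2) = 0"
    by (subst (asm) nn_integral_0_iff_AE) auto
  with wiener_0 show ?thesis
    by eventually_elim simp
qed

lemma wiener_process_uminus: "wiener_process M (\<lambda>t \<omega>. - B t \<omega>)"
proof (unfold_locales)
  show "(\<lambda>\<omega>. - B t \<omega>) \<in> borel_measurable M" if "0 \<le> t" for t
    using wiener_measurable[OF that] by simp
  show "AE \<omega> in M. - B 0 \<omega> = 0"
    using wiener_0 by simp
  show "AE \<omega> in M. continuous_on {0..} (\<lambda>t. - B t \<omega>)"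
    using wiener_continuous by eventually_elim (rule continuous_on_minus)
  show "distributed M lborel (\<lambda>\<omega>. - B t \<omega> - - B s \<omega>) (normal_density 0 (sqrt (t - s)))"
    if "0 \<le> s" "s < t" for s t
    using normal_density_affine[OF wiener_increment[OF that], of "-1" 0] that by (simp add: algebra_simps)
  show "indep_vars (\<lambda>_. borel) (\<lambda>i \<omega>. - B (t (Suc i)) \<omega> - - B (t i) \<omega>) {..<n}"
    if "0 \<le> t 0" "\<And>i. i < n \<Longrightarrow> t i < t (Suc i)" for n and t :: "nat \<Rightarrow> real"
    using indep_vars_compose2[OF wiener_indep[OF that], where Y = "\<lambda>_ x. - x" and N = "\<lambda>_. borel"]
    by (simp add: algebra_simps)
qed

end

section \<open>Finite-dimensional distributions of Wiener integrals\<close>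

lemma finite_set_increasing_enumeration:
  fixes F :: "real set"
  assumes "finite F" "F \<noteq> {}"
  obtains t :: "nat \<Rightarrow> real" and n where "F = t ` {..n}" "\<And>i. i < n \<Longrightarrow> t i < t (Suc i)"
    "t 0 = Min F" "n = card F - 1"
proof -
  let ?xs = "sorted_list_of_set F"
  have "?xs \<noteq> []"
    using assms by simp
  then have len: "length ?xs = Suc (card F - 1)"
    using assms by (simp add: card_gt_0_iff)
  have "F = set ?xs"
    using assms by simp
  also have "\<dots> = (!) ?xs ` {..card F - 1}"
    using len by (auto simp: set_conv_nth less_Suc_eq_le)
  finally have F: "F = (!) ?xs ` {..card F - 1}" .
  have "?xs ! i < ?xs ! Suc i" if "i < card F - 1" for i
    using strict_sorted_list_of_set[of F] that len by (intro sorted_wrt_nth_less[where P = "(<)"]) auto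
  moreover have "?xs ! 0 = Min F"
    using sorted_list_of_set_nonempty[OF assms] by simp
  ultimately show ?thesis
    using F by (intro that[of "(!) ?xs" "card F - 1"]) auto
qed

lemma (in wiener_process) distr_increments:
  assumes "0 \<le> t 0" "\<And>i. i < n \<Longrightarrow> t i < t (Suc i)" "0 < n"
  shows "distr M (\<Pi>\<^sub>M i\<in>{..<n}. borel) (\<lambda>\<omega>. \<lambda>i\<in>{..<n}. B (t (Suc i)) \<omega> - B (t i) \<omega>)
    = (\<Pi>\<^sub>M i\<in>{..<n}. density lborel (normal_density 0 (sqrt (t (Suc i) - t i))))"
proof -
  have nonneg: "0 \<le> t i" if "i \<le> n" for i
    using partition_mono[where n = n and p = t and i = 0 and j = i] assms that by (force intro: less_imp_le)
  have rv: "random_variable borel (\<lambda>\<omega>. B (t (Suc i)) \<omega> - B (t i) \<omega>)" if "i \<in> {..<n}" for i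
    using nonneg that by (intro borel_measurable_diff wiener_measurable) auto
  have "distr M (\<Pi>\<^sub>M i\<in>{..<n}. borel) (\<lambda>\<omega>. \<lambda>i\<in>{..<n}. B (t (Suc i)) \<omega> - B (t i) \<omega>)
      = (\<Pi>\<^sub>M i\<in>{..<n}. distr M borel (\<lambda>\<omega>. B (t (Suc i)) \<omega> - B (t i) \<omega>))"
    using assms by (intro indep_vars_iff_distr_eq_PiM'[THEN iffD1] wiener_indep rv) auto
  also have "\<dots> = (\<Pi>\<^sub>M i\<in>{..<n}. density lborel (normal_density 0 (sqrt (t (Suc i) - t i))))"
  proof (intro PiM_cong refl)
    fix i assume i: "i \<in> {..<n}"
    have "distr M borel (\<lambda>\<omega>. B (t (Suc i)) \<omega> - B (t i) \<omega>) = distr M lborel (\<lambda>\<omega>. B (t (Suc i)) \<omega> - B (t i) \<omega>)"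
      by (intro distr_cong) auto
    also have "\<dots> = density lborel (normal_density 0 (sqrt (t (Suc i) - t i)))"
      using i assms nonneg by (intro distributed_distr_eq_density wiener_increment) auto
    finally show "distr M borel (\<lambda>\<omega>. B (t (Suc i)) \<omega> - B (t i) \<omega>)
      = density lborel (normal_density 0 (sqrt (t (Suc i) - t i)))" .
  qed
  finally show ?thesis .
qed

text \<open>Values are partial sums of independent increments, whose product law depends on the time
  points alone. The right-hand side mentions neither \<open>B\<close> nor \<open>M\<close>, so it
  serves as a common form for any two Wiener processes.\<close>

lemma (in wiener_process) distr_fdd_from_increments:
  fixes t :: "nat \<Rightarrow> real" and idx :: "real \<Rightarrow> nat"
  assumes t: "t 0 = 0" "\<And>i. i < n \<Longrightarrow> t i < t (Suc i)" "0 < n"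
    and F: "\<And>s. s \<in> F \<Longrightarrow> 0 \<le> s" "\<And>s. s \<in> F \<Longrightarrow> idx s \<le> n \<and> t (idx s) = s" "finite F"
  shows "distr M (\<Pi>\<^sub>M s\<in>F. borel) (\<lambda>\<omega>. \<lambda>s\<in>F. B s \<omega>)
    = distr (\<Pi>\<^sub>M i\<in>{..<n}. density lborel (normal_density 0 (sqrt (t (Suc i) - t i)))) (\<Pi>\<^sub>M s\<in>F. borel)
        (\<lambda>x. \<lambda>s\<in>F. \<Sum>i<idx s. x i)"
proof -
  let ?\<Delta> = "\<lambda>\<omega>. \<lambda>i\<in>{..<n}. B (t (Suc i)) \<omega> - B (t i) \<omega>"
  have nonneg: "0 \<le> t i" if "i \<le> n" for i
    using partition_mono[where n = n and p = t and i = 0 and j = i] t that by (force intro: less_imp_le)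
  have \<Delta>: "?\<Delta> \<in> measurable M (\<Pi>\<^sub>M i\<in>{..<n}. borel)"
    using nonneg by (intro measurable_restrict borel_measurable_diff wiener_measurable) auto
  have \<Phi>: "(\<lambda>x. \<lambda>s\<in>F. \<Sum>i<idx s. x i) \<in> measurable (\<Pi>\<^sub>M i\<in>{..<n}. borel) (\<Pi>\<^sub>M s\<in>F. (borel :: real measure))"
    using less_le_trans[OF _ conjunct1[OF F(2)]]
    by (intro measurable_restrict borel_measurable_sum measurable_component_singleton) auto
  have "AE \<omega> in M. (\<lambda>s\<in>F. B s \<omega>) = (\<lambda>s\<in>F. \<Sum>i<idx s. ?\<Delta> \<omega> i)"
    using wiener_0
  proof eventually_elim
    fix \<omega> assume 0: "B 0 \<omega> = 0"
    have "(\<Sum>i<idx s. ?\<Delta> \<omega> i) = B s \<omega>" if "s \<in> F" for s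
    proof -
      have "(\<Sum>i<idx s. ?\<Delta> \<omega> i) = (\<Sum>i<idx s. B (t (Suc i)) \<omega> - B (t i) \<omega>)"
        using F(2)[OF that] by (intro sum.cong) auto
      also have "\<dots> = B (t (idx s)) \<omega> - B (t 0) \<omega>"
        by (rule sum_lessThan_telescope)
      finally show ?thesis
        using F(2)[OF that] 0 t(1) by simp
    qed
    then show "(\<lambda>s\<in>F. B s \<omega>) = (\<lambda>s\<in>F. \<Sum>i<idx s. ?\<Delta> \<omega> i)"
      by (intro restrict_ext) simp
  qed
  then have "distr M (\<Pi>\<^sub>M s\<in>F. borel) (\<lambda>\<omega>. \<lambda>s\<in>F. B s \<omega>)
      = distr M (\<Pi>\<^sub>M s\<in>F. borel) (\<lambda>\<omega>. \<lambda>s\<in>F. \<Sum>i<idx s. ?\<Delta> \<omega> i)"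
    using measurable_compose[OF \<Delta> \<Phi>] measurable_restrict[of F B M "\<lambda>_. borel"] wiener_measurable F(1)
    by (intro distr_cong_AE refl) auto
  also have "\<dots> = distr (distr M (\<Pi>\<^sub>M i\<in>{..<n}. borel) ?\<Delta>) (\<Pi>\<^sub>M s\<in>F. borel) (\<lambda>x. \<lambda>s\<in>F. \<Sum>i<idx s. x i)"
    using distr_distr[OF \<Phi> \<Delta>] by (simp add: comp_def)
  also have "distr M (\<Pi>\<^sub>M i\<in>{..<n}. borel) ?\<Delta>
      = (\<Pi>\<^sub>M i\<in>{..<n}. density lborel (normal_density 0 (sqrt (t (Suc i) - t i))))"
    using t by (intro distr_increments) auto
  finally show ?thesis .
qed

lemma same_fdd_wiener_process:
  assumes "wiener_process M B" "wiener_process M' W"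
  shows "same_fdd {0..} M B M' W"
  unfolding same_fdd_def
proof (intro allI impI, elim conjE)
  fix F :: "real set" assume F: "finite F" "F \<subseteq> {0..}"
  \<comment> \<open>Inserting 0 makes the enumeration start at time 0; inserting 1 guarantees at
    least one increment, also when \<open>F\<close> is empty or contains only 0.\<close>
  let ?F = "insert 0 (insert 1 F)"
  obtain t :: "nat \<Rightarrow> real" and n where t: "?F = t ` {..n}" "\<And>i. i < n \<Longrightarrow> t i < t (Suc i)"
    "t 0 = Min ?F" "n = card ?F - 1"
    using finite_set_increasing_enumeration[of ?F] F by blast
  have "Min ?F = 0"
    using F by (intro Min_eqI) auto
  moreover have "card {0, 1::real} \<le> card ?F"
    using F by (intro card_mono) auto
  ultimately have t0: "t 0 = 0" "0 < n"
    using t(3,4) by auto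
  have "\<exists>i. i \<le> n \<and> t i = s" if "s \<in> F" for s
  proof -
    have "s \<in> t ` {..n}"
      using that by (subst t(1)[symmetric]) simp
    then show ?thesis by auto
  qed
  then obtain idx where idx: "\<And>s. s \<in> F \<Longrightarrow> idx s \<le> n \<and> t (idx s) = s"
    by metis
  have "0 \<le> s" if "s \<in> F" for s
    using that F by auto
  note wiener_process.distr_fdd_from_increments[where t = t and n = n and F = F and idx = idx, OF _ t0(1) t(2) t0(2) this idx F(1)]
  from this[OF assms(1)] this[OF assms(2)]
  show "distr M (\<Pi>\<^sub>M s\<in>F. borel) (\<lambda>\<omega>. \<lambda>s\<in>F. B s \<omega>) = distr M' (\<Pi>\<^sub>M s\<in>F. borel) (\<lambda>\<omega>. \<lambda>s\<in>F. W s \<omega>)"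
    by simp
qed

text \<open>For m > 0 a continuous descent from 1 to 0 across [x, x + 1/m], approximating the
  indicator of the half-line up to x from above. Its Lipschitz bound makes expectations stable under
  L2 limits; letting m grow afterwards gives distribution functions.\<close>

definition ramp :: "nat \<Rightarrow> real \<Rightarrow> real \<Rightarrow> real" where
  "ramp m x y = max 0 (min 1 (1 - real m * (y - x)))"

lemma borel_measurable_ramp [measurable]: "ramp m x \<in> borel_measurable borel"
  unfolding ramp_def by measurable

lemma ramp_bounds: "0 \<le> ramp m x y" "ramp m x y \<le> 1"
  by (auto simp: ramp_def)

lemma prod_ramp_norm_le: "norm (\<Prod>t\<in>J. ramp m (x t) (y t)) \<le> 1"
proof -
  have "0 \<le> (\<Prod>t\<in>J. ramp m (x t) (y t))" "(\<Prod>t\<in>J. ramp m (x t) (y t)) \<le> 1"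
    by (auto intro!: prod_nonneg prod_le_1 ramp_bounds)
  then show ?thesis by simp
qed

lemma ramp_Lipschitz: "\<bar>ramp m x y - ramp m x z\<bar> \<le> real m * \<bar>y - z\<bar>"
proof -
  have "\<bar>ramp m x y - ramp m x z\<bar> \<le> \<bar>real m * (y - x) - real m * (z - x)\<bar>"
    unfolding ramp_def by linarith
  also have "real m * (y - x) - real m * (z - x) = real m * (y - z)"
    by (simp add: algebra_simps)
  finally show ?thesis
    by (simp add: abs_mult)
qed

lemma ramp_tendsto: "(\<lambda>m. ramp m x y) \<longlonglongrightarrow> indicator {..x} y"
proof (cases "y \<le> x")
  case True
  then have "0 \<le> - (real m * (y - x))" for m
    by (simp add: mult_nonneg_nonpos)
  then have "ramp m x y = 1" for m
    by (simp add: ramp_def min_def)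
  with True show ?thesis by simp
next
  case False
  obtain N where N: "1 / (y - x) < real N"
    using reals_Archimedean2 by blast
  have "ramp m x y = 0" if "N \<le> m" for m
  proof -
    have "1 / (y - x) \<le> real m"
      using N that by linarith
    with False show ?thesis
      by (simp add: ramp_def field_simps)
  qed
  then have "\<forall>\<^sub>F m in sequentially. ramp m x y = 0"
    by (auto simp: eventually_sequentially)
  with False show ?thesis
    by (simp add: tendsto_eventually)
qed

text \<open>A product of factors in [0, 1] changes by at most the sum of the changes of its factors.
  The Lipschitz bound and Cauchy-Schwarz against the constant 1 turn this into m times the sum of
  the L2 distances.\<close>

lemma (in prob_space) integral_prod_ramp_tendsto_L2:
  assumes J: "finite J"
    and X [measurable]: "\<And>t k. t \<in> J \<Longrightarrow> X k t \<in> borel_measurable M" "\<And>t. t \<in> J \<Longrightarrow> Y t \<in> borel_measurable M"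
    and lim: "\<And>t. t \<in> J \<Longrightarrow> (\<lambda>k. \<integral>\<^sup>+\<omega>. ennreal ((Y t \<omega> - X k t \<omega>)\<^sup>2) \<partial>M) \<longlonglongrightarrow> 0"
  shows "(\<lambda>k. expectation (\<lambda>\<omega>. \<Prod>t\<in>J. ramp m (x t) (X k t \<omega>))) \<longlonglongrightarrow> expectation (\<lambda>\<omega>. \<Prod>t\<in>J. ramp m (x t) (Y t \<omega>))"
proof -
  have norm1: "norm (ramp m x y) \<le> 1" for x y
    using ramp_bounds[of m x y] by simp
  have R: "integrable M (\<lambda>\<omega>. \<Prod>t\<in>J. ramp m (x t) (Z t \<omega>))"
    if "\<And>t. t \<in> J \<Longrightarrow> Z t \<in> borel_measurable M" for Z
    using that by (intro integrable_const_bound[where B = 1] AE_I2 prod_ramp_norm_le) measurable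
  define e where "e k t = (\<integral>\<^sup>+\<omega>. ennreal ((Y t \<omega> - X k t \<omega>)\<^sup>2) \<partial>M)" for k t
  \<comment> \<open>The \<open>ennreal\<close> distances may be infinite for small k, so the
    real-valued bound below can be claimed only for large k.\<close>
  have fin: "\<forall>\<^sub>F k in sequentially. \<forall>t\<in>J. e k t < \<infinity>"
    using J lim by (intro eventually_ball_finite ballI order_tendstoD(2)) (auto simp: e_def)
  have bound: "norm (expectation (\<lambda>\<omega>. \<Prod>t\<in>J. ramp m (x t) (X k t \<omega>))
      - expectation (\<lambda>\<omega>. \<Prod>t\<in>J. ramp m (x t) (Y t \<omega>))) \<le> (\<Sum>t\<in>J. real m * sqrt (enn2real (e k t)))"
    if fin: "\<forall>t\<in>J. e k t < \<infinity>" for k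
  proof -
    have sq: "integrable M (\<lambda>\<omega>. (X k t \<omega> - Y t \<omega>)\<^sup>2)" "expectation (\<lambda>\<omega>. (X k t \<omega> - Y t \<omega>)\<^sup>2) = enn2real (e k t)"
      if "t \<in> J" for t
    proof -
      note [measurable] = X(1)[OF that] X(2)[OF that]
      show i: "integrable M (\<lambda>\<omega>. (X k t \<omega> - Y t \<omega>)\<^sup>2)"
        using fin that by (intro integrable_square_if_nn_integral_finite) (auto simp: e_def power2_commute)
      then have "e k t = ennreal (expectation (\<lambda>\<omega>. (X k t \<omega> - Y t \<omega>)\<^sup>2))"
        unfolding e_def by (subst nn_integral_eq_integral[symmetric]) (auto simp: power2_commute)
      then show "expectation (\<lambda>\<omega>. (X k t \<omega> - Y t \<omega>)\<^sup>2) = enn2real (e k t)"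
        by simp
    qed
    have ab: "integrable M (\<lambda>\<omega>. \<bar>X k t \<omega> - Y t \<omega>\<bar>)" if "t \<in> J" for t
      using square_integrable_imp_integrable[OF _ sq(1)[OF that]] X that by auto
    have "norm (expectation (\<lambda>\<omega>. \<Prod>t\<in>J. ramp m (x t) (X k t \<omega>)) - expectation (\<lambda>\<omega>. \<Prod>t\<in>J. ramp m (x t) (Y t \<omega>)))
        = norm (expectation (\<lambda>\<omega>. (\<Prod>t\<in>J. ramp m (x t) (X k t \<omega>)) - (\<Prod>t\<in>J. ramp m (x t) (Y t \<omega>))))"
      using R X by (subst Bochner_Integration.integral_diff) auto
    also have "\<dots> \<le> expectation (\<lambda>\<omega>. norm ((\<Prod>t\<in>J. ramp m (x t) (X k t \<omega>)) - (\<Prod>t\<in>J. ramp m (x t) (Y t \<omega>))))"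
      by (rule integral_norm_bound)
    also have "\<dots> \<le> expectation (\<lambda>\<omega>. \<Sum>t\<in>J. real m * \<bar>X k t \<omega> - Y t \<omega>\<bar>)"
    proof (intro integral_mono)
      show "integrable M (\<lambda>\<omega>. norm ((\<Prod>t\<in>J. ramp m (x t) (X k t \<omega>)) - (\<Prod>t\<in>J. ramp m (x t) (Y t \<omega>))))"
        using R X by (intro integrable_norm Bochner_Integration.integrable_diff) auto
      show "integrable M (\<lambda>\<omega>. \<Sum>t\<in>J. real m * \<bar>X k t \<omega> - Y t \<omega>\<bar>)"
        using ab by (intro Bochner_Integration.integrable_sum integrable_mult_right) auto
      fix \<omega>
      have "norm ((\<Prod>t\<in>J. ramp m (x t) (X k t \<omega>)) - (\<Prod>t\<in>J. ramp m (x t) (Y t \<omega>)))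
          \<le> (\<Sum>t\<in>J. norm (ramp m (x t) (X k t \<omega>) - ramp m (x t) (Y t \<omega>)))"
        by (intro norm_prod_diff norm1)
      also have "\<dots> \<le> (\<Sum>t\<in>J. real m * \<bar>X k t \<omega> - Y t \<omega>\<bar>)"
        by (intro sum_mono) (simp add: ramp_Lipschitz)
      finally show "norm ((\<Prod>t\<in>J. ramp m (x t) (X k t \<omega>)) - (\<Prod>t\<in>J. ramp m (x t) (Y t \<omega>)))
          \<le> (\<Sum>t\<in>J. real m * \<bar>X k t \<omega> - Y t \<omega>\<bar>)" .
    qed
    also have "\<dots> = (\<Sum>t\<in>J. real m * expectation (\<lambda>\<omega>. \<bar>X k t \<omega> - Y t \<omega>\<bar>))"
      using ab by (subst Bochner_Integration.integral_sum) auto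
    also have "\<dots> \<le> (\<Sum>t\<in>J. real m * sqrt (enn2real (e k t)))"
    proof (intro sum_mono mult_left_mono)
      fix t assume t: "t \<in> J"
      have "expectation (\<lambda>\<omega>. \<bar>(X k t \<omega> - Y t \<omega>) * 1\<bar>)
          \<le> sqrt (expectation (\<lambda>\<omega>. (X k t \<omega> - Y t \<omega>)\<^sup>2)) * sqrt (expectation (\<lambda>\<omega>. 1\<^sup>2))"
        using X t sq(1)[OF t] by (intro integral_mult_le_sqrt) auto
      then show "expectation (\<lambda>\<omega>. \<bar>X k t \<omega> - Y t \<omega>\<bar>) \<le> sqrt (enn2real (e k t))"
        using sq(2)[OF t] by (simp add: prob_space)
    qed simp
    finally show ?thesis .
  qed
  have "(\<lambda>k. \<Sum>t\<in>J. real m * sqrt (enn2real (e k t))) \<longlonglongrightarrow> (\<Sum>t\<in>J. real m * sqrt 0)"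
  proof (intro tendsto_sum tendsto_mult tendsto_const tendsto_real_sqrt)
    fix t assume t: "t \<in> J"
    have "\<forall>\<^sub>F k in sequentially. ennreal (enn2real (e k t)) = e k t"
      using fin by eventually_elim (use t in auto)
    with lim[OF t] have "(\<lambda>k. ennreal (enn2real (e k t))) \<longlonglongrightarrow> ennreal 0"
      by (simp add: e_def tendsto_cong)
    then show "(\<lambda>k. enn2real (e k t)) \<longlonglongrightarrow> 0"
      by (subst (asm) tendsto_ennreal_iff) auto
  qed
  then have lim0: "(\<lambda>k. \<Sum>t\<in>J. real m * sqrt (enn2real (e k t))) \<longlonglongrightarrow> 0"
    by simp
  have "\<forall>\<^sub>F k in sequentially. norm (expectation (\<lambda>\<omega>. \<Prod>t\<in>J. ramp m (x t) (X k t \<omega>))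
      - expectation (\<lambda>\<omega>. \<Prod>t\<in>J. ramp m (x t) (Y t \<omega>))) \<le> (\<Sum>t\<in>J. real m * sqrt (enn2real (e k t)))"
    using fin by eventually_elim (rule bound)
  then have "(\<lambda>k. expectation (\<lambda>\<omega>. \<Prod>t\<in>J. ramp m (x t) (X k t \<omega>))
      - expectation (\<lambda>\<omega>. \<Prod>t\<in>J. ramp m (x t) (Y t \<omega>))) \<longlonglongrightarrow> 0"
    using lim0 by (rule Lim_null_comparison)
  then show ?thesis
    by (rule LIM_zero_cancel)
qed

text \<open>Dominated convergence with bound 1. The ramps converge at every point, including the
  endpoint of the closed half-line, so atoms of the law cause no exception.\<close>

lemma (in prob_space) integral_prod_ramp_tendsto_prob:
  assumes J: "finite J" and X: "\<And>t. t \<in> J \<Longrightarrow> X t \<in> borel_measurable M"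
  shows "(\<lambda>m. expectation (\<lambda>\<omega>. \<Prod>t\<in>J. ramp m (x t) (X t \<omega>)))
    \<longlonglongrightarrow> prob {\<omega>\<in>space M. \<forall>t\<in>J. X t \<omega> \<le> x t}"
proof -
  have A: "{\<omega>\<in>space M. \<forall>t\<in>J. X t \<omega> \<le> x t} \<in> events"
    using J X by measurable
  have "(\<lambda>m. expectation (\<lambda>\<omega>. \<Prod>t\<in>J. ramp m (x t) (X t \<omega>)))
      \<longlonglongrightarrow> expectation (\<lambda>\<omega>. \<Prod>t\<in>J. indicator {..x t} (X t \<omega>))"
  proof (rule integral_dominated_convergence[where w = "\<lambda>_. 1"])
    show "(\<lambda>\<omega>. \<Prod>t\<in>J. indicat_real {..x t} (X t \<omega>)) \<in> borel_measurable M"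
      using X by (intro borel_measurable_prod) auto
    show "(\<lambda>\<omega>. \<Prod>t\<in>J. ramp m (x t) (X t \<omega>)) \<in> borel_measurable M" for m
      using X by (intro borel_measurable_prod) auto
    show "AE \<omega> in M. (\<lambda>m. \<Prod>t\<in>J. ramp m (x t) (X t \<omega>)) \<longlonglongrightarrow> (\<Prod>t\<in>J. indicat_real {..x t} (X t \<omega>))"
      by (intro AE_I2 tendsto_prod ramp_tendsto)
    show "AE \<omega> in M. norm (\<Prod>t\<in>J. ramp m (x t) (X t \<omega>)) \<le> 1" for m
      by (intro AE_I2 prod_ramp_norm_le)
  qed simp
  also have "expectation (\<lambda>\<omega>. \<Prod>t\<in>J. indicat_real {..x t} (X t \<omega>))
      = expectation (indicator {\<omega>\<in>space M. \<forall>t\<in>J. X t \<omega> \<le> x t})"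
  proof (intro Bochner_Integration.integral_cong refl)
    fix \<omega> assume "\<omega> \<in> space M"
    then show "(\<Prod>t\<in>J. indicat_real {..x t} (X t \<omega>)) = indicator {\<omega>\<in>space M. \<forall>t\<in>J. X t \<omega> \<le> x t} \<omega>"
      using J by (auto simp: indicator_def prod_zero_iff)
  qed
  also have "\<dots> = prob {\<omega>\<in>space M. \<forall>t\<in>J. X t \<omega> \<le> x t}"
    using A by simp
  finally show ?thesis .
qed

text \<open>Boxes of closed half-lines are stable under intersection, generate the product
  sigma-algebra and exhaust the space along {..n}, so two probability laws agreeing on them
  coincide.\<close>

lemma distr_PiM_real_eqI:
  fixes X :: "'i \<Rightarrow> 'a \<Rightarrow> real" and Y :: "'i \<Rightarrow> 'b \<Rightarrow> real"
  assumes "prob_space M" "prob_space M'" and J: "finite J"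
    and X: "\<And>t. t \<in> J \<Longrightarrow> X t \<in> borel_measurable M" and Y: "\<And>t. t \<in> J \<Longrightarrow> Y t \<in> borel_measurable M'"
    and eq: "\<And>x. measure M {\<omega>\<in>space M. \<forall>t\<in>J. X t \<omega> \<le> x t} = measure M' {\<omega>\<in>space M'. \<forall>t\<in>J. Y t \<omega> \<le> x t}"
  shows "distr M (\<Pi>\<^sub>M t\<in>J. borel) (\<lambda>\<omega>. \<lambda>t\<in>J. X t \<omega>) = distr M' (\<Pi>\<^sub>M t\<in>J. borel) (\<lambda>\<omega>. \<lambda>t\<in>J. Y t \<omega>)"
proof -
  interpret M: prob_space M by fact
  interpret M': prob_space M' by fact
  let ?E = "{\<Pi>\<^sub>E t\<in>J. {..x t} | x :: 'i \<Rightarrow> real. True}"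
  let ?\<Omega> = "\<Pi>\<^sub>E t\<in>J. (UNIV :: real set)"
  have mX: "(\<lambda>\<omega>. \<lambda>t\<in>J. X t \<omega>) \<in> measurable M (\<Pi>\<^sub>M t\<in>J. borel)"
    and mY: "(\<lambda>\<omega>. \<lambda>t\<in>J. Y t \<omega>) \<in> measurable M' (\<Pi>\<^sub>M t\<in>J. borel)"
    using X Y by (auto intro!: measurable_restrict)
  have box: "(\<Pi>\<^sub>E t\<in>J. {..x t}) \<in> sets (\<Pi>\<^sub>M t\<in>J. (borel :: real measure))" for x
    using J by (intro sets_PiM_I_finite) auto
  have borel_eq: "(borel :: real measure) = sigma UNIV (range atMost)"
    unfolding borel_eq_atMost by (intro arg_cong2[where f = sigma]) auto
  have gen: "sets (\<Pi>\<^sub>M t\<in>J. (borel :: real measure)) = sigma_sets ?\<Omega> ?E"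
  proof -
    \<comment> \<open>With the single index block \<open>J\<close> every cylinder constrains all
      coordinates at once, so the generating cylinders are exactly the boxes.\<close>
    have "sets (\<Pi>\<^sub>M t\<in>J. sigma (UNIV :: real set) (range atMost))
      = sets (sigma ?\<Omega> {{f\<in>?\<Omega>. \<forall>i\<in>j. f i \<in> A i} | A j. j \<in> {J} \<and> A \<in> Pi j (\<lambda>_. range atMost)})"
    proof (rule sets_PiM_sigma)
      fix i
      have "(\<Union>n. {..real n}) = (UNIV :: real set)"
        using real_arch_simple by auto
      then show "\<exists>S\<subseteq>range atMost. countable S \<and> (UNIV :: real set) = \<Union>S"
        by (intro exI[of _ "range (\<lambda>n. {..real n})"]) auto
    qed (use J in auto)
    also have "{{f\<in>?\<Omega>. \<forall>i\<in>j. f i \<in> A i} | A j. j \<in> {J} \<and> A \<in> Pi j (\<lambda>_. range atMost)} = ?E"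
    proof (intro set_eqI iffI; clarsimp)
      fix A :: "'i \<Rightarrow> real set" assume "A \<in> J \<rightarrow> range atMost"
      then have "\<exists>x. \<forall>i\<in>J. A i = {..x i}"
        by (intro bchoice) auto
      then obtain x where "\<forall>i\<in>J. A i = {..x i}" ..
      then show "\<exists>x. {f \<in> ?\<Omega>. \<forall>i\<in>J. f i \<in> A i} = (\<Pi>\<^sub>E t\<in>J. {..x t})"
        by (intro exI[of _ x]) (auto simp: PiE_def Pi_def)
    next
      fix x :: "'i \<Rightarrow> real"
      show "\<exists>A. (\<Pi>\<^sub>E t\<in>J. {..x t}) = {f \<in> ?\<Omega>. \<forall>i\<in>J. f i \<in> A i} \<and> A \<in> J \<rightarrow> range atMost"
        by (intro exI[of _ "\<lambda>i. {..x i}"]) (auto simp: PiE_def Pi_def)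
    qed
    finally show ?thesis
      unfolding borel_eq[symmetric] by (subst (asm) sets_measure_of) auto
  qed
  show ?thesis
  proof (rule measure_eqI_generator_eq[where E = ?E and \<Omega> = ?\<Omega> and A = "\<lambda>n. \<Pi>\<^sub>E t\<in>J. {..real n}"])
    show "Int_stable ?E"
    proof (rule Int_stableI, clarsimp)
      fix x y :: "'i \<Rightarrow> real"
      show "\<exists>z. (\<Pi>\<^sub>E t\<in>J. {..x t}) \<inter> (\<Pi>\<^sub>E t\<in>J. {..y t}) = (\<Pi>\<^sub>E t\<in>J. {..z t})"
        by (intro exI[of _ "\<lambda>t. min (x t) (y t)"]) (auto simp: PiE_iff)
    qed
    show "(\<Union>n. \<Pi>\<^sub>E t\<in>J. {..real n}) = ?\<Omega>"
    proof (intro equalityI subsetI)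
      fix f assume f: "f \<in> ?\<Omega>"
      obtain n where "Max (insert 0 (f ` J)) \<le> real n"
        using real_arch_simple by blast
      then have "f \<in> (\<Pi>\<^sub>E t\<in>J. {..real n})"
        using J f by (auto simp: PiE_iff)
      then show "f \<in> (\<Union>n. \<Pi>\<^sub>E t\<in>J. {..real n})" by blast
    qed auto
    fix S assume "S \<in> ?E"
    then obtain x where S: "S = (\<Pi>\<^sub>E t\<in>J. {..x t})" by blast
    have "emeasure (distr M (\<Pi>\<^sub>M t\<in>J. borel) (\<lambda>\<omega>. \<lambda>t\<in>J. X t \<omega>)) S = emeasure M {\<omega>\<in>space M. \<forall>t\<in>J. X t \<omega> \<le> x t}"
      unfolding S by (subst emeasure_distr[OF mX box]) (auto intro!: arg_cong2[where f = emeasure])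
    also have "\<dots> = emeasure M' {\<omega>\<in>space M'. \<forall>t\<in>J. Y t \<omega> \<le> x t}"
      using eq[of x] by (simp add: M.emeasure_eq_measure M'.emeasure_eq_measure)
    also have "\<dots> = emeasure (distr M' (\<Pi>\<^sub>M t\<in>J. borel) (\<lambda>\<omega>. \<lambda>t\<in>J. Y t \<omega>)) S"
      unfolding S by (subst emeasure_distr[OF mY box]) (auto intro!: arg_cong2[where f = emeasure])
    finally show "emeasure (distr M (\<Pi>\<^sub>M t\<in>J. borel) (\<lambda>\<omega>. \<lambda>t\<in>J. X t \<omega>)) S
      = emeasure (distr M' (\<Pi>\<^sub>M t\<in>J. borel) (\<lambda>\<omega>. \<lambda>t\<in>J. Y t \<omega>)) S" .
  next
    interpret D: prob_space "distr M (\<Pi>\<^sub>M t\<in>J. borel) (\<lambda>\<omega>. \<lambda>t\<in>J. X t \<omega>)"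
      using mX by (rule M.prob_space_distr)
    show "emeasure (distr M (\<Pi>\<^sub>M t\<in>J. borel) (\<lambda>\<omega>. \<lambda>t\<in>J. X t \<omega>)) (\<Pi>\<^sub>E t\<in>J. {..real n}) \<noteq> \<infinity>" for n
      by simp
  qed (use gen in auto)
qed

text \<open>The witnesses come from the integrals against \<open>B\<close>; the isometry shows that
  they approximate the integrals against \<open>W\<close> equally well. At each stage the ramp
  expectations agree, because they are images of equal finite-dimensional laws. Hence one sequence
  of numbers converges to both ramp expectations of the integrals, and these determine the joint
  law.\<close>

lemma same_fdd_wiener_integrals:
  assumes "wiener_process M B" "wiener_process M' W"
    and V: "\<And>t. t \<in> S \<Longrightarrow> is_wiener_integral M B 0 t (f t) (V t)"
    and Y: "\<And>t. t \<in> S \<Longrightarrow> is_wiener_integral M' W 0 t (f t) (Y t)"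
  shows "same_fdd S M V M' Y"
  unfolding same_fdd_def
proof (intro allI impI, elim conjE)
  interpret M: wiener_process M B by fact
  interpret M': wiener_process M' W by fact
  fix J assume J: "finite J" "J \<subseteq> S"
  define P where "P t n p c \<longleftrightarrow>
      (\<forall>k. p k 0 = 0) \<and> (\<forall>k. p k (n k) = t) \<and> (\<forall>k. \<forall>i<n k. p k i \<le> p k (Suc i)) \<and>
      (\<lambda>k. \<integral>\<^sup>+u. ennreal ((indicator {0..t} u * f t u - step_function (n k) (p k) (c k) u)\<^sup>2) \<partial>lborel)
        \<longlonglongrightarrow> 0 \<and>
      (\<lambda>k. \<integral>\<^sup>+\<omega>. ennreal ((V t \<omega> - step_integral B (n k) (p k) (c k) \<omega>)\<^sup>2) \<partial>M) \<longlonglongrightarrow> 0"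
    for t n p c
  have "\<exists>n p c. P t n p c" if "t \<in> J" for t
  proof (rule M.wiener_integralE[OF V[of t]])
    show "t \<in> S" using that J by auto
    fix n p c assume "\<And>k. p k 0 = 0" "\<And>k. p k (n k) = t" "\<And>k i. i < n k \<Longrightarrow> p k i \<le> p k (Suc i)"
      "(\<lambda>k. \<integral>\<^sup>+u. ennreal ((indicator {0..t} u * f t u - step_function (n k) (p k) (c k) u)\<^sup>2) \<partial>lborel)
        \<longlonglongrightarrow> 0"
      "(\<lambda>k. \<integral>\<^sup>+\<omega>. ennreal ((V t \<omega> - step_integral B (n k) (p k) (c k) \<omega>)\<^sup>2) \<partial>M) \<longlonglongrightarrow> 0"
    then have "P t n p c" unfolding P_def by blast
    then show ?thesis by blast
  qed
  then obtain n p c where "\<And>t. t \<in> J \<Longrightarrow> P t (n t) (p t) (c t)"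
    by metis
  note * = this[unfolded P_def]
  have p: "p t k 0 = 0" "p t k (n t k) = t" "\<And>i. i < n t k \<Longrightarrow> p t k i \<le> p t k (Suc i)"
    if "t \<in> J" for t k
    using *[OF that] by auto
  have limV: "(\<lambda>k. \<integral>\<^sup>+\<omega>. ennreal ((V t \<omega> - step_integral B (n t k) (p t k) (c t k) \<omega>)\<^sup>2) \<partial>M) \<longlonglongrightarrow> 0"
    if "t \<in> J" for t
    using *[OF that] by blast
  have limY: "(\<lambda>k. \<integral>\<^sup>+\<omega>. ennreal ((Y t \<omega> - step_integral W (n t k) (p t k) (c t k) \<omega>)\<^sup>2) \<partial>M') \<longlonglongrightarrow> 0"
    if "t \<in> J" for t
  proof -
    have "is_wiener_integral M' W 0 t (f t) (Y t)"
      using Y J that by auto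
    then have "(\<integral>\<^sup>+\<omega>. ennreal ((Y t \<omega> - step_integral W (n t k) (p t k) (c t k) \<omega>)\<^sup>2) \<partial>M')
        = (\<integral>\<^sup>+u. ennreal ((indicator {0..t} u * f t u - step_function (n t k) (p t k) (c t k) u)\<^sup>2) \<partial>lborel)" for k
      by (rule M'.wiener_integral_step_dist[where p = "p t k" and n = "n t k", OF _ p[OF that]])
    then show ?thesis
      using *[OF that] by simp
  qed
  have nonneg: "0 \<le> p t k i" if "t \<in> J" "i \<le> n t k" for t k i
    using partition_mono[where n = "n t k" and p = "p t k" and i = 0 and j = i, OF p(3)] p(1) that by simp
  have mB: "step_integral B (n t k) (p t k) (c t k) \<in> borel_measurable M"
    and mW: "step_integral W (n t k) (p t k) (c t k) \<in> borel_measurable M'" if "t \<in> J" for t k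
    using M.borel_measurable_step_integral[where p = "p t k" and n = "n t k", OF _ p(3)[OF that]]
      M'.borel_measurable_step_integral[where p = "p t k" and n = "n t k", OF _ p(3)[OF that]] p(1)[OF that]
    by simp_all
  have step_eq: "M.expectation (\<lambda>\<omega>. \<Prod>t\<in>J. ramp m (x t) (step_integral B (n t k) (p t k) (c t k) \<omega>))
      = M'.expectation (\<lambda>\<omega>. \<Prod>t\<in>J. ramp m (x t) (step_integral W (n t k) (p t k) (c t k) \<omega>))" for m x k
  proof -
    \<comment> \<open>All partition points of stage k, over all t in \<open>J\<close>. The product
      of ramps is then one measurable function h of the path restricted to the finite set
      \<open>F\<close>, applied to \<open>B\<close> and to \<open>W\<close> alike.\<close>
    define F where "F = (\<Union>t\<in>J. p t k ` {..n t k})"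
    have F: "finite F" "F \<subseteq> {0..}"
      using J nonneg by (auto simp: F_def)
    have inF: "p t k i \<in> F" if "t \<in> J" "i \<le> n t k" for t i
      unfolding F_def using that by blast
    define h where "h y = (\<Prod>t\<in>J. ramp m (x t) (\<Sum>i<n t k. c t k i * (y (p t k (Suc i)) - y (p t k i))))"
      for y :: "real \<Rightarrow> real"
    have h: "h \<in> borel_measurable (\<Pi>\<^sub>M s\<in>F. borel)"
      unfolding h_def
      by (intro borel_measurable_prod measurable_compose[OF _ borel_measurable_ramp] borel_measurable_sum
          borel_measurable_times borel_measurable_diff borel_measurable_const measurable_component_singleton inF)
        auto
    have restr: "h (\<lambda>s\<in>F. b s \<omega>) = (\<Prod>t\<in>J. ramp m (x t) (step_integral b (n t k) (p t k) (c t k) \<omega>))"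
      for b :: "real \<Rightarrow> 'x \<Rightarrow> real" and \<omega>
      unfolding h_def step_integral_def
      by (intro prod.cong refl arg_cong[where f = "ramp m _"] sum.cong) (auto simp: inF)
    have "M.expectation (\<lambda>\<omega>. h (\<lambda>s\<in>F. B s \<omega>)) = integral\<^sup>L (distr M (\<Pi>\<^sub>M s\<in>F. borel) (\<lambda>\<omega>. \<lambda>s\<in>F. B s \<omega>)) h"
      using F h by (subst integral_distr) (auto intro!: measurable_restrict M.wiener_measurable)
    also have "distr M (\<Pi>\<^sub>M s\<in>F. borel) (\<lambda>\<omega>. \<lambda>s\<in>F. B s \<omega>) = distr M' (\<Pi>\<^sub>M s\<in>F. borel) (\<lambda>\<omega>. \<lambda>s\<in>F. W s \<omega>)"
      using same_fdd_wiener_process[OF assms(1,2)] F unfolding same_fdd_def by blast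
    also have "integral\<^sup>L \<dots> h = M'.expectation (\<lambda>\<omega>. h (\<lambda>s\<in>F. W s \<omega>))"
      using F h by (subst integral_distr) (auto intro!: measurable_restrict M'.wiener_measurable)
    finally show ?thesis
      unfolding restr .
  qed
  have VY: "V t \<in> borel_measurable M" "Y t \<in> borel_measurable M'" if "t \<in> J" for t
    using V[of t] Y[of t] that J by (auto simp: is_wiener_integral_def)
  show "distr M (\<Pi>\<^sub>M t\<in>J. borel) (\<lambda>\<omega>. \<lambda>t\<in>J. V t \<omega>) = distr M' (\<Pi>\<^sub>M t\<in>J. borel) (\<lambda>\<omega>. \<lambda>t\<in>J. Y t \<omega>)"
  proof (rule distr_PiM_real_eqI[OF M.prob_space_axioms M'.prob_space_axioms J(1) VY])
    fix x
    have "M.expectation (\<lambda>\<omega>. \<Prod>t\<in>J. ramp m (x t) (V t \<omega>)) = M'.expectation (\<lambda>\<omega>. \<Prod>t\<in>J. ramp m (x t) (Y t \<omega>))" for m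
    proof (rule LIMSEQ_unique)
      show "(\<lambda>k. M.expectation (\<lambda>\<omega>. \<Prod>t\<in>J. ramp m (x t) (step_integral B (n t k) (p t k) (c t k) \<omega>)))
          \<longlonglongrightarrow> M.expectation (\<lambda>\<omega>. \<Prod>t\<in>J. ramp m (x t) (V t \<omega>))"
        by (intro M.integral_prod_ramp_tendsto_L2 J(1) mB VY(1) limV)
      show "(\<lambda>k. M.expectation (\<lambda>\<omega>. \<Prod>t\<in>J. ramp m (x t) (step_integral B (n t k) (p t k) (c t k) \<omega>)))
          \<longlonglongrightarrow> M'.expectation (\<lambda>\<omega>. \<Prod>t\<in>J. ramp m (x t) (Y t \<omega>))"
        unfolding step_eq by (intro M'.integral_prod_ramp_tendsto_L2 J(1) mW VY(2) limY)
    qed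
    then show "M.prob {\<omega>\<in>space M. \<forall>t\<in>J. V t \<omega> \<le> x t} = M'.prob {\<omega>\<in>space M'. \<forall>t\<in>J. Y t \<omega> \<le> x t}"
      using M.integral_prod_ramp_tendsto_prob[where X = V and x = x, OF J(1) VY(1)]
        M'.integral_prod_ramp_tendsto_prob[where X = Y and x = x, OF J(1) VY(2)]
      by (simp add: LIMSEQ_unique)
  qed
qed

section \<open>The general \<open>\<alpha>\<close>-Wiener bridge as a Wiener integral\<close>

context wiener_process
begin

text \<open>By Fatou's lemma the isometry turns the pointwise limit into an \<open>L\<^sup>2\<close> limit.\<close>

lemma is_wiener_integral_AE_limit:
  assumes p: "\<And>k. p k 0 = 0" "\<And>k. p k (n k) = t" "\<And>k i. i < n k \<Longrightarrow> p k i \<le> p k (Suc i)"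
    and f: "set_borel_measurable lborel {0..t} f"
    and lim: "(\<lambda>k. \<integral>\<^sup>+u\<in>{0..t}. ennreal ((f u - step_function (n k) (p k) (c k) u)\<^sup>2) \<partial>lborel) \<longlonglongrightarrow> 0"
    and I [measurable]: "I \<in> borel_measurable M"
    and AE: "AE \<omega> in M. (\<lambda>k. step_integral B (n k) (p k) (c k) \<omega>) \<longlonglongrightarrow> I \<omega>"
  shows "is_wiener_integral M B 0 t f I"
proof -
  define s where "s k = step_function (n k) (p k) (c k)" for k
  define S where "S k = step_integral B (n k) (p k) (c k)" for k
  define d where "d k = (\<integral>\<^sup>+u. ennreal ((indicator {0..t} u * f u - s k u)\<^sup>2) \<partial>lborel)" for k
  have [measurable]: "S k \<in> borel_measurable M" for k
    unfolding S_def using p by (intro borel_measurable_step_integral) auto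
  have [measurable]: "s k \<in> borel_measurable borel" "(\<lambda>u. indicator {0..t} u * f u) \<in> borel_measurable borel" for k
    unfolding s_def using f by (auto intro: set_borel_measurable_lborelD)
  have d_eq: "(\<integral>\<^sup>+u\<in>{0..t}. ennreal ((f u - s k u)\<^sup>2) \<partial>lborel) = d k" for k
    unfolding d_def s_def
    by (rule set_nn_integral_diff_step_function[where p = "p k" and n = "n k", OF p])
  have d: "d \<longlonglongrightarrow> 0"
    using lim unfolding s_def[symmetric] d_eq by simp
  \<comment> \<open>The isometry moves the distance to the line, where (x - y)^2 \<le> 2 (g - x)^2 +
    2 (g - y)^2 with the target integrand g between the two step functions; the factors 2 appear as
    sums.\<close>
  have SS: "(\<integral>\<^sup>+\<omega>. ennreal ((S m \<omega> - S k \<omega>)\<^sup>2) \<partial>M) \<le> (d m + d m) + (d k + d k)" for m k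
  proof -
    have "is_wiener_integral M B 0 t (s m) (S m)"
      using is_wiener_integral_step[where p = "p m" and n = "n m" and c = "c m", OF p(1) p(3)] p(2)
      by (simp add: s_def S_def)
    then have "(\<integral>\<^sup>+\<omega>. ennreal ((S m \<omega> - S k \<omega>)\<^sup>2) \<partial>M)
        = (\<integral>\<^sup>+u. ennreal ((indicator {0..t} u * s m u - s k u)\<^sup>2) \<partial>lborel)"
      unfolding S_def[of k] s_def[of k]
      by (rule wiener_integral_step_dist[where p = "p k" and n = "n k", OF _ p])
    also have "\<dots> = (\<integral>\<^sup>+u\<in>{0..t}. ennreal ((s m u - s k u)\<^sup>2) \<partial>lborel)"
      unfolding s_def[of k]
      by (rule set_nn_integral_diff_step_function[where p = "p k" and n = "n k", OF p, symmetric])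
    also have "\<dots> \<le> (\<integral>\<^sup>+u. (ennreal ((indicator {0..t} u * f u - s m u)\<^sup>2) + ennreal ((indicator {0..t} u * f u - s m u)\<^sup>2))
       + (ennreal ((indicator {0..t} u * f u - s k u)\<^sup>2) + ennreal ((indicator {0..t} u * f u - s k u)\<^sup>2)) \<partial>lborel)"
    proof (intro nn_integral_mono)
      fix u
      let ?g = "indicator {0..t} u * f u"
      have "(s m u - s k u)\<^sup>2 \<le> ((?g - s m u)\<^sup>2 + (?g - s m u)\<^sup>2) + ((?g - s k u)\<^sup>2 + (?g - s k u)\<^sup>2)"
        using zero_le_power2[of "(?g - s m u) + (?g - s k u)"]
        by (simp add: power2_eq_square algebra_simps)
      then have "ennreal ((s m u - s k u)\<^sup>2) \<le> (ennreal ((?g - s m u)\<^sup>2) + ennreal ((?g - s m u)\<^sup>2))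
          + (ennreal ((?g - s k u)\<^sup>2) + ennreal ((?g - s k u)\<^sup>2))"
        by (simp del: ennreal_plus add: ennreal_leI flip: ennreal_plus)
      then show "ennreal ((s m u - s k u)\<^sup>2) * indicator {0..t} u \<le> (ennreal ((?g - s m u)\<^sup>2) + ennreal ((?g - s m u)\<^sup>2))
          + (ennreal ((?g - s k u)\<^sup>2) + ennreal ((?g - s k u)\<^sup>2))"
        by (cases "u \<in> {0..t}") auto
    qed
    also have "\<dots> = (d m + d m) + (d k + d k)"
      unfolding d_def by (simp add: nn_integral_add)
    finally show ?thesis .
  qed
  have IS: "(\<integral>\<^sup>+\<omega>. ennreal ((I \<omega> - S k \<omega>)\<^sup>2) \<partial>M) \<le> d k + d k" for k
  proof -
    have "(\<integral>\<^sup>+\<omega>. ennreal ((I \<omega> - S k \<omega>)\<^sup>2) \<partial>M) = (\<integral>\<^sup>+\<omega>. liminf (\<lambda>m. ennreal ((S m \<omega> - S k \<omega>)\<^sup>2)) \<partial>M)"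
    proof (rule nn_integral_cong_AE)
      show "AE \<omega> in M. ennreal ((I \<omega> - S k \<omega>)\<^sup>2) = liminf (\<lambda>m. ennreal ((S m \<omega> - S k \<omega>)\<^sup>2))"
        using AE
      proof eventually_elim
        case (elim \<omega>)
        then have "(\<lambda>m. ennreal ((S m \<omega> - S k \<omega>)\<^sup>2)) \<longlonglongrightarrow> ennreal ((I \<omega> - S k \<omega>)\<^sup>2)"
          unfolding S_def[symmetric] by (intro tendsto_ennrealI tendsto_power tendsto_diff tendsto_const)
        then show ?case
          by (rule lim_imp_Liminf[OF sequentially_bot, symmetric])
      qed
    qed
    also have "\<dots> \<le> liminf (\<lambda>m. \<integral>\<^sup>+\<omega>. ennreal ((S m \<omega> - S k \<omega>)\<^sup>2) \<partial>M)"
      by (intro nn_integral_liminf) measurable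
    also have "\<dots> \<le> liminf (\<lambda>m. (d m + d m) + (d k + d k))"
      by (intro Liminf_mono always_eventually allI SS)
    also have "(\<lambda>m. (d m + d m) + (d k + d k)) \<longlonglongrightarrow> (0 + 0) + (d k + d k)"
      by (intro tendsto_add d tendsto_const)
    then have "liminf (\<lambda>m. (d m + d m) + (d k + d k)) = d k + d k"
      by (simp add: lim_imp_Liminf)
    finally show ?thesis .
  qed
  have "(\<lambda>k. d k + d k) \<longlonglongrightarrow> 0"
    using tendsto_add[OF d d] by simp
  then have "(\<lambda>k. \<integral>\<^sup>+\<omega>. ennreal ((I \<omega> - S k \<omega>)\<^sup>2) \<partial>M) \<longlonglongrightarrow> 0"
    by (rule tendsto_sandwich[OF always_eventually always_eventually tendsto_const, rotated 2]) (simp_all add: IS)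
  then show ?thesis
    unfolding is_wiener_integral_def S_def using f I p lim by blast
qed

end

text \<open>Discrete form of \<open>d(\<psi> y) = \<psi> dw\<close>, for \<open>dy = b y dt + dw\<close> and \<open>d\<psi> = - b \<psi> dt\<close>.\<close>

lemma euler_step_error:
  fixes y \<psi> b w :: "real \<Rightarrow> real"
  assumes "u \<le> v" and cont: "continuous_on {u..v} y" "continuous_on {u..v} b" "continuous_on {u..v} \<psi>"
    and \<psi>: "\<psi> v - \<psi> u = - integral {u..v} (\<lambda>x. b x * \<psi> x)"
    and y: "y v - y u = integral {u..v} (\<lambda>x. b x * y x) + (w v - w u)"
    and K: "\<And>x. x \<in> {u..v} \<Longrightarrow> \<bar>b x * \<psi> x\<bar> \<le> K" "\<And>x. x \<in> {u..v} \<Longrightarrow> \<bar>b x * y x\<bar> \<le> K"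
    and \<epsilon>: "\<And>x. x \<in> {u..v} \<Longrightarrow> \<bar>y v - y x\<bar> \<le> \<epsilon>" "\<And>x. x \<in> {u..v} \<Longrightarrow> \<bar>\<psi> x - \<psi> u\<bar> \<le> \<epsilon>"
  shows "\<bar>\<psi> u * (w v - w u) - (\<psi> v * y v - \<psi> u * y u)\<bar> \<le> 2 * K * \<epsilon> * (v - u)"
proof -
  let ?h = "\<lambda>x. y v * (b x * \<psi> x) - \<psi> u * (b x * y x)"
  have int: "(\<lambda>x. b x * \<psi> x) integrable_on {u..v}" "(\<lambda>x. b x * y x) integrable_on {u..v}"
    by (intro integrable_continuous_interval continuous_intros cont)+
  have "\<psi> u * (w v - w u) - (\<psi> v * y v - \<psi> u * y u)
      = y v * integral {u..v} (\<lambda>x. b x * \<psi> x) - \<psi> u * integral {u..v} (\<lambda>x. b x * y x)"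
  proof -
    have w: "w v - w u = y v - y u - integral {u..v} (\<lambda>x. b x * y x)"
      and p: "integral {u..v} (\<lambda>x. b x * \<psi> x) = \<psi> u - \<psi> v"
      using y \<psi> by linarith+
    show ?thesis unfolding w p by (simp add: algebra_simps)
  qed
  also have "\<dots> = integral {u..v} ?h"
    using int by (simp add: integral_diff integrable_on_mult_right)
  finally have eq: "\<psi> u * (w v - w u) - (\<psi> v * y v - \<psi> u * y u) = integral {u..v} ?h" .
  have "norm (integral {u..v} ?h) \<le> 2 * K * \<epsilon> * (v - u)"
  proof (rule integral_bound[OF \<open>u \<le> v\<close>])
    show "continuous_on {u..v} ?h"
      by (intro continuous_intros cont)
    show "norm (?h x) \<le> 2 * K * \<epsilon>" if x: "x \<in> {u..v}" for x
    proof -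
      \<comment> \<open>Adding and subtracting b x * \<psi> x * y x leaves only increments of y and
        \<psi> over the cell. This is the source of the factor \<epsilon>, which makes the error
        small relative to the length of the cell.\<close>
      have "?h x = (b x * \<psi> x) * (y v - y x) + (b x * y x) * (\<psi> x - \<psi> u)"
        by (simp add: algebra_simps)
      also have "norm \<dots> \<le> \<bar>b x * \<psi> x\<bar> * \<bar>y v - y x\<bar> + \<bar>b x * y x\<bar> * \<bar>\<psi> x - \<psi> u\<bar>"
        by (metis abs_mult norm_triangle_ineq real_norm_def)
      also have "\<dots> \<le> K * \<epsilon> + K * \<epsilon>"
        using K[OF x] \<epsilon>[OF x] by (intro add_mono mult_mono) (auto intro: order_trans[OF abs_ge_zero])
      finally show ?thesis by simp
    qed
  qed
  then show ?thesis
    unfolding eq by simp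
qed

section \<open>Uniform grids and Euler sums along a single path\<close>

definition grid :: "real \<Rightarrow> nat \<Rightarrow> nat \<Rightarrow> real" where
  "grid t k i = t * real i / real (Suc k)"

lemma grid_simps: "grid t k 0 = 0" "grid t k (Suc k) = t"
  by (simp_all add: grid_def)

lemma grid_mono: "0 \<le> t \<Longrightarrow> i \<le> j \<Longrightarrow> grid t k i \<le> grid t k j"
  unfolding grid_def by (intro divide_right_mono mult_left_mono) auto

lemma grid_bounds: "0 \<le> t \<Longrightarrow> i \<le> Suc k \<Longrightarrow> grid t k i \<in> {0..t}"
  using grid_mono[of t 0 i k] grid_mono[of t i "Suc k" k] by (simp add: grid_simps)

lemma grid_diff: "grid t k (Suc i) - grid t k i = t / real (Suc k)"
  by (simp add: grid_def algebra_simps flip: diff_divide_distrib)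

lemma mesh_eventually_less:
  fixes t :: real
  assumes "0 < \<delta>"
  shows "\<forall>\<^sub>F k in sequentially. t / real (Suc k) < \<delta>"
  using order_tendstoD(2)[OF tendsto_mult[OF tendsto_const[of t] LIMSEQ_inverse_real_of_nat], of \<delta>] assms
  by (simp add: divide_inverse)

lemma grid_cell:
  assumes "0 \<le> t" "u \<in> {0<..t}"
  obtains i where "i < Suc k" "u \<in> {grid t k i<..grid t k (Suc i)}"
proof -
  have "\<exists>i. u \<le> grid t k (Suc i)"
    using assms by (intro exI[of _ k]) (simp add: grid_simps)
  define i where "i = (LEAST i. u \<le> grid t k (Suc i))"
  have "u \<le> grid t k (Suc i)"
    unfolding i_def by (rule LeastI_ex) fact
  moreover have "i \<le> k"
    unfolding i_def by (rule Least_le) (use assms in \<open>simp add: grid_simps\<close>)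
  moreover have "grid t k i < u"
  proof (cases i)
    case 0
    then show ?thesis using assms by (simp add: grid_simps)
  next
    case (Suc j)
    then have "\<not> u \<le> grid t k (Suc j)"
      using not_less_Least[of j "\<lambda>i. u \<le> grid t k (Suc i)"] by (simp add: i_def)
    then show ?thesis using Suc by simp
  qed
  ultimately show ?thesis
    by (intro that[of i]) auto
qed

lemma tendsto_0_if_eventually_le_ennreal:
  fixes f :: "'a \<Rightarrow> ennreal"
  assumes "\<And>e. 0 < e \<Longrightarrow> \<forall>\<^sub>F x in F. f x \<le> ennreal e"
  shows "(f \<longlongrightarrow> 0) F"
proof (rule order_tendstoI)
  fix a :: ennreal assume "0 < a"
  then obtain e where e: "0 < e" "ennreal e < a"
    by (cases a) (auto intro: that[of "enn2real a / 2"] that[of 1] simp: ennreal_less_iff)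
  show "\<forall>\<^sub>F x in F. f x < a"
    using assms[OF e(1)] by eventually_elim (rule le_less_trans[OF _ e(2)])
qed simp

lemma step_function_grid_L2_tendsto:
  assumes "0 \<le> t" and cont: "continuous_on {0..t} \<psi>"
  shows "(\<lambda>k. \<integral>\<^sup>+u\<in>{0..t}. ennreal ((\<psi> u - step_function (Suc k) (grid t k) (\<lambda>i. \<psi> (grid t k i)) u)\<^sup>2) \<partial>lborel)
    \<longlonglongrightarrow> 0"
proof (rule tendsto_0_if_eventually_le_ennreal)
  fix e :: real assume "0 < e"
  \<comment> \<open>Chosen so that \<epsilon>^2 t = e t / (t + 1) \<le> e; the summand 1 covers t =
    0.\<close>
  define \<epsilon> where "\<epsilon> = sqrt (e / (t + 1))"
  have "0 < \<epsilon>" using \<open>0 < e\<close> \<open>0 \<le> t\<close> by (simp add: \<epsilon>_def)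
  have "uniformly_continuous_on {0..t} \<psi>"
    using cont by (intro compact_uniformly_continuous) auto
  then obtain \<delta> where \<delta>: "0 < \<delta>" "\<And>x y. x \<in> {0..t} \<Longrightarrow> y \<in> {0..t} \<Longrightarrow> \<bar>y - x\<bar> < \<delta> \<Longrightarrow> \<bar>\<psi> y - \<psi> x\<bar> < \<epsilon>"
    unfolding uniformly_continuous_on_def dist_real_def using \<open>0 < \<epsilon>\<close> by meson
  show "\<forall>\<^sub>F k in sequentially. (\<integral>\<^sup>+u\<in>{0..t}. ennreal ((\<psi> u - step_function (Suc k) (grid t k) (\<lambda>i. \<psi> (grid t k i)) u)\<^sup>2) \<partial>lborel) \<le> ennreal e"
    using mesh_eventually_less[OF \<delta>(1), of t]
  proof eventually_elim
    case (elim k)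
    have "(\<integral>\<^sup>+u\<in>{0..t}. ennreal ((\<psi> u - step_function (Suc k) (grid t k) (\<lambda>i. \<psi> (grid t k i)) u)\<^sup>2) \<partial>lborel)
        \<le> (\<integral>\<^sup>+u. ennreal (\<epsilon>\<^sup>2) * indicator {0..t} u \<partial>lborel)"
    \<comment> \<open>The cells are left-open, so 0 lies in none of them and is discarded as a null
      set.\<close>
    proof (rule nn_integral_mono_AE, rule AE_mp[OF AE_lborel_singleton[of 0]], intro AE_I2 impI)
      fix u :: real assume "u \<noteq> 0"
      show "ennreal ((\<psi> u - step_function (Suc k) (grid t k) (\<lambda>i. \<psi> (grid t k i)) u)\<^sup>2) * indicator {0..t} u
          \<le> ennreal (\<epsilon>\<^sup>2) * indicator {0..t} u"
      proof (cases "u \<in> {0..t}")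
        case True
        with \<open>u \<noteq> 0\<close> obtain i where i: "i < Suc k" "u \<in> {grid t k i<..grid t k (Suc i)}"
          using grid_cell[OF \<open>0 \<le> t\<close>, of u k] by auto
        have "step_function (Suc k) (grid t k) (\<lambda>i. \<psi> (grid t k i)) u = \<psi> (grid t k i)"
          using \<open>0 \<le> t\<close> i by (intro step_function_eq_coeff grid_mono) auto
        moreover have "\<bar>\<psi> u - \<psi> (grid t k i)\<bar> < \<epsilon>"
          using True grid_bounds[OF \<open>0 \<le> t\<close>, of i k] i grid_diff[of t k i] elim by (intro \<delta>) auto
        then have "(\<psi> u - \<psi> (grid t k i))\<^sup>2 \<le> \<epsilon>\<^sup>2"
          by (intro abs_le_square_iff[THEN iffD1]) auto
        ultimately show ?thesis
          using True by (simp add: ennreal_leI)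
      qed simp
    qed
    also have "\<dots> = ennreal (\<epsilon>\<^sup>2 * t)"
      using \<open>0 \<le> t\<close> by (simp add: nn_integral_cmult ennreal_mult)
    also have "\<dots> \<le> ennreal e"
      using \<open>0 < e\<close> \<open>0 \<le> t\<close> by (intro ennreal_leI) (simp add: \<epsilon>_def field_simps)
    finally show ?case .
  qed
qed

text \<open>The increments of \<psi> y telescope to y t, because \<psi> t = 1 and y 0 = 0, and the
  one-step errors add up to at most 2 K \<epsilon> t. The equation for y is assumed at grid points
  only: for a random path it holds almost surely at each fixed time, and only countably many null
  sets can be discarded.\<close>

lemma grid_sum_tendsto:
  fixes y \<psi> b w :: "real \<Rightarrow> real"
  assumes "0 \<le> t" and cont: "continuous_on {0..t} y" "continuous_on {0..t} b" "continuous_on {0..t} \<psi>"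
    and \<psi>: "\<And>u v. 0 \<le> u \<Longrightarrow> u \<le> v \<Longrightarrow> v \<le> t \<Longrightarrow> \<psi> v - \<psi> u = - integral {u..v} (\<lambda>x. b x * \<psi> x)" "\<psi> t = 1"
    and y: "\<And>k i. i \<le> Suc k \<Longrightarrow> y (grid t k i) = integral {0..grid t k i} (\<lambda>x. b x * y x) + w (grid t k i)" "y 0 = 0"
  shows "(\<lambda>k. \<Sum>i<Suc k. \<psi> (grid t k i) * (w (grid t k (Suc i)) - w (grid t k i))) \<longlonglongrightarrow> y t"
proof -
  have "compact ((\<lambda>x. \<bar>b x * \<psi> x\<bar> + \<bar>b x * y x\<bar>) ` {0..t})"
    by (intro compact_continuous_image continuous_intros cont compact_Icc)
  then have "bounded ((\<lambda>x. \<bar>b x * \<psi> x\<bar> + \<bar>b x * y x\<bar>) ` {0..t})"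
    by (rule compact_imp_bounded)
  then obtain K where "0 < K" and K: "\<And>x. x \<in> {0..t} \<Longrightarrow> \<bar>b x * \<psi> x\<bar> + \<bar>b x * y x\<bar> \<le> K"
    unfolding bounded_pos by fastforce
  have uc: "uniformly_continuous_on {0..t} y" "uniformly_continuous_on {0..t} \<psi>"
    using cont by (auto intro: compact_uniformly_continuous)
  show ?thesis
  proof (rule LIMSEQ_I)
    fix e :: real assume "0 < e"
    \<comment> \<open>Makes the accumulated error 2 K \<epsilon> t equal to e t / (t + 1), which is
      below e.\<close>
    define \<epsilon> where "\<epsilon> = e / (2 * K * (t + 1))"
    have "0 < \<epsilon>" using \<open>0 < e\<close> \<open>0 < K\<close> \<open>0 \<le> t\<close> by (simp add: \<epsilon>_def)
    obtain \<delta>1 where \<delta>1: "0 < \<delta>1" "\<And>x z. x \<in> {0..t} \<Longrightarrow> z \<in> {0..t} \<Longrightarrow> \<bar>z - x\<bar> < \<delta>1 \<Longrightarrow> \<bar>y z - y x\<bar> < \<epsilon>"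
      using uc(1) unfolding uniformly_continuous_on_def dist_real_def using \<open>0 < \<epsilon>\<close> by meson
    obtain \<delta>2 where \<delta>2: "0 < \<delta>2" "\<And>x z. x \<in> {0..t} \<Longrightarrow> z \<in> {0..t} \<Longrightarrow> \<bar>z - x\<bar> < \<delta>2 \<Longrightarrow> \<bar>\<psi> z - \<psi> x\<bar> < \<epsilon>"
      using uc(2) unfolding uniformly_continuous_on_def dist_real_def using \<open>0 < \<epsilon>\<close> by meson
    obtain N where N: "\<And>k. N \<le> k \<Longrightarrow> t / real (Suc k) < min \<delta>1 \<delta>2"
      using mesh_eventually_less[of "min \<delta>1 \<delta>2" t] \<delta>1(1) \<delta>2(1) unfolding eventually_sequentially by auto
    show "\<exists>N. \<forall>k\<ge>N. norm ((\<Sum>i<Suc k. \<psi> (grid t k i) * (w (grid t k (Suc i)) - w (grid t k i))) - y t) < e"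
    proof (intro exI[of _ N] allI impI)
      fix k assume "N \<le> k"
      let ?p = "grid t k"
      have err: "\<bar>\<psi> (?p i) * (w (?p (Suc i)) - w (?p i)) - (\<psi> (?p (Suc i)) * y (?p (Suc i)) - \<psi> (?p i) * y (?p i))\<bar>
          \<le> 2 * K * \<epsilon> * (?p (Suc i) - ?p i)" if "i < Suc k" for i
      proof (rule euler_step_error)
        have b1: "?p i \<in> {0..t}" and b2: "?p (Suc i) \<in> {0..t}"
          using \<open>0 \<le> t\<close> that by (auto intro!: grid_bounds simp del: atLeastAtMost_iff)
        then have sub: "{?p i..?p (Suc i)} \<subseteq> {0..t}" by auto
        show le: "?p i \<le> ?p (Suc i)"
          using \<open>0 \<le> t\<close> by (rule grid_mono) simp
        show "continuous_on {?p i..?p (Suc i)} y" "continuous_on {?p i..?p (Suc i)} b" "continuous_on {?p i..?p (Suc i)} \<psi>"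
          using cont sub by (auto intro: continuous_on_subset)
        show "\<psi> (?p (Suc i)) - \<psi> (?p i) = - integral {?p i..?p (Suc i)} (\<lambda>x. b x * \<psi> x)"
          using b1 b2 le by (intro \<psi>) auto
        have "(\<lambda>x. b x * y x) integrable_on {0..?p (Suc i)}"
          using b2 by (intro integrable_continuous_interval continuous_intros continuous_on_subset[OF cont(1)]
              continuous_on_subset[OF cont(2)]) auto
        then have "integral {0..?p i} (\<lambda>x. b x * y x) + integral {?p i..?p (Suc i)} (\<lambda>x. b x * y x)
            = integral {0..?p (Suc i)} (\<lambda>x. b x * y x)"
          using b1 le by (intro Henstock_Kurzweil_Integration.integral_combine) auto
        then show "y (?p (Suc i)) - y (?p i) = integral {?p i..?p (Suc i)} (\<lambda>x. b x * y x) + (w (?p (Suc i)) - w (?p i))"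
          using y(1)[of i k] y(1)[of "Suc i" k] that by simp
        fix x assume x: "x \<in> {?p i..?p (Suc i)}"
        then have xt: "x \<in> {0..t}" using sub by auto
        show "\<bar>b x * \<psi> x\<bar> \<le> K" "\<bar>b x * y x\<bar> \<le> K"
          using K[OF xt] by auto
        show "\<bar>y (?p (Suc i)) - y x\<bar> \<le> \<epsilon>"
          using x N[OF \<open>N \<le> k\<close>] grid_diff[of t k i] by (intro less_imp_le \<delta>1 xt b2) auto
        show "\<bar>\<psi> x - \<psi> (?p i)\<bar> \<le> \<epsilon>"
          using x N[OF \<open>N \<le> k\<close>] grid_diff[of t k i] by (intro less_imp_le \<delta>2 xt b1) auto
      qed
      have tel: "(\<Sum>i<Suc k. \<psi> (?p (Suc i)) * y (?p (Suc i)) - \<psi> (?p i) * y (?p i)) = y t"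
        using sum_lessThan_telescope[of "\<lambda>i. \<psi> (?p i) * y (?p i)" "Suc k"] \<psi>(2) y(2)
        by (simp only: grid_simps mult_1 mult_zero_right diff_0_right)
      have "norm ((\<Sum>i<Suc k. \<psi> (?p i) * (w (?p (Suc i)) - w (?p i))) - y t)
          = \<bar>\<Sum>i<Suc k. \<psi> (?p i) * (w (?p (Suc i)) - w (?p i)) - (\<psi> (?p (Suc i)) * y (?p (Suc i)) - \<psi> (?p i) * y (?p i))\<bar>"
        unfolding tel[symmetric] real_norm_def by (simp only: sum_subtractf)
      also have "\<dots> \<le> (\<Sum>i<Suc k. 2 * K * \<epsilon> * (?p (Suc i) - ?p i))"
        by (intro order_trans[OF sum_abs] sum_mono err) auto
      also have "\<dots> = 2 * K * \<epsilon> * t"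
        using sum_lessThan_telescope[of ?p "Suc k"]
        by (simp only: sum_distrib_left[symmetric] grid_simps diff_0_right)
      also have "\<dots> = e / (t + 1) * t"
        using \<open>0 < K\<close> by (simp add: \<epsilon>_def)
      also have "\<dots> < e"
        using \<open>0 < e\<close> \<open>0 \<le> t\<close> by (simp add: field_simps)
      finally show "norm ((\<Sum>i<Suc k. \<psi> (?p i) * (w (?p (Suc i)) - w (?p i))) - y t) < e" .
    qed
  qed
qed

text \<open>For c = \<open>q_bar b t\<close> the function is \<psi>(s) = a(t)/a(s) with a =
  exp(\<open>q_bar b\<close>): the integrating factor, normalized to \<psi>(t) = 1, that the Euler
  sums use as weight.\<close>

lemma exp_q_bar_diff:
  assumes cont: "continuous_on {0..t} b" and uv: "0 \<le> u" "u \<le> v" "v \<le> t"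
  shows "exp (c - q_bar b v) - exp (c - q_bar b u) = - integral {u..v} (\<lambda>x. b x * exp (c - q_bar b x))"
proof -
  have "((\<lambda>x. exp (c - q_bar b x)) has_vector_derivative - (b x * exp (c - q_bar b x))) (at x within {u..v})"
    if "x \<in> {u..v}" for x
  proof -
    have "(q_bar b has_real_derivative b x) (at x within {0..t})"
      unfolding q_bar_def[abs_def] using cont uv that by (intro integral_has_real_derivative) auto
    then have "(q_bar b has_real_derivative b x) (at x within {u..v})"
      by (rule DERIV_subset) (use uv in auto)
    then show ?thesis
      unfolding has_real_derivative_iff_has_vector_derivative[symmetric]
      by (auto intro!: derivative_eq_intros)
  qed
  from fundamental_theorem_of_calculus[OF uv(2) this]
  have "((\<lambda>x. - (b x * exp (c - q_bar b x))) has_integral exp (c - q_bar b v) - exp (c - q_bar b u)) {u..v}"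
    by simp
  then show ?thesis
    by (auto dest: integral_unique)
qed

lemma continuous_on_q_bar:
  assumes "continuous_on {0..t} b"
  shows "continuous_on {0..t} (q_bar b)"
  unfolding q_bar_def[abs_def]
  by (intro indefinite_integral_continuous_1 integrable_continuous_interval assms)

text \<open>All generators, the null sets included, are events of \<open>M\<close>. This extracts
  from adaptedness of a strong solution the measurability that a Wiener integral demands.\<close>

lemma (in wiener_process) augmented_filtration_measurable_imp:
  assumes "Z0 \<in> borel_measurable M" "X \<in> borel_measurable (augmented_filtration M B Z0 t)"
  shows "X \<in> borel_measurable M"
proof -
  let ?E = "{Z0 -` A \<inter> space M | A. A \<in> sets borel} \<union>
      {B s -` A \<inter> space M | s A. 0 \<le> s \<and> s \<le> t \<and> A \<in> sets borel} \<union> null_sets M"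
  have E: "?E \<subseteq> sets M"
    using assms(1) wiener_measurable by (auto intro: measurable_sets)
  then have "?E \<subseteq> Pow (space M)"
    using sets.sets_into_space by blast
  then have "space (augmented_filtration M B Z0 t) = space M"
    "sets (augmented_filtration M B Z0 t) \<subseteq> sets M"
    unfolding augmented_filtration_def using E by (simp_all add: sets.sigma_sets_subset)
  then have "borel_measurable (augmented_filtration M B Z0 t) \<subseteq> borel_measurable M"
    by (intro measurable_mono) auto
  with assms(2) show ?thesis by auto
qed

text \<open>Variation of constants without stochastic calculus: along almost every path the sums of
  \<psi>(s) = exp(\<open>q_bar b t\<close> - \<open>q_bar b s\<close>) against increments of B
  converge to Y t. These sums are step integrals whose integrands converge to \<psi> in L2, so the
  pathwise limit is the Wiener integral of \<psi>.\<close>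

lemma (in wiener_process) strong_solution_is_wiener_integral:
  assumes b: "continuous_on {0..<T} b"
    and Y: "strong_solution M B {0..<T} b (\<lambda>_. 1) Y" "AE \<omega> in M. Y 0 \<omega> = 0"
    and t: "t \<in> {0..<T}"
  shows "is_wiener_integral M B 0 t (\<lambda>s. exp (q_bar b t - q_bar b s)) (Y t)"
proof -
  have t0: "0 \<le> t" and sub: "{0..t} \<subseteq> {0..<T}" using t by auto
  have bt: "continuous_on {0..t} b"
    using b sub by (rule continuous_on_subset)
  let ?\<psi> = "\<lambda>s. exp (q_bar b t - q_bar b s)"
  have \<psi>: "continuous_on {0..t} ?\<psi>"
    by (intro continuous_intros continuous_on_q_bar bt)
  have eq: "AE \<omega> in M. Y r \<omega> = integral {0..r} (\<lambda>u. b u * Y u \<omega>) + B r \<omega>" if "r \<in> {0..<T}" for r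
  proof -
    obtain J where J: "is_wiener_integral M B 0 r (\<lambda>_. 1) J"
      "AE \<omega> in M. Y r \<omega> = Y 0 \<omega> + integral {0..r} (\<lambda>u. b u * Y u \<omega>) + J \<omega>"
      using Y(1) \<open>r \<in> {0..<T}\<close> unfolding strong_solution_def by blast
    have "AE \<omega> in M. J \<omega> = B r \<omega>"
      using J(1) that by (intro is_wiener_integral_one_AE) auto
    with J(2) Y(2) show ?thesis
      by eventually_elim simp
  qed
  \<comment> \<open>The grids contain countably many times altogether, so one null set serves for
    all k and i.\<close>
  have grid: "AE \<omega> in M. \<forall>k i. i \<le> Suc k \<longrightarrow>
      Y (grid t k i) \<omega> = integral {0..grid t k i} (\<lambda>u. b u * Y u \<omega>) + B (grid t k i) \<omega>"
    unfolding AE_all_countable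
  proof (intro allI)
    fix k i
    show "AE \<omega> in M. i \<le> Suc k \<longrightarrow> Y (grid t k i) \<omega> = integral {0..grid t k i} (\<lambda>u. b u * Y u \<omega>) + B (grid t k i) \<omega>"
    proof (cases "i \<le> Suc k")
      case True
      then have "grid t k i \<in> {0..<T}"
        using grid_bounds[OF t0 True] sub by blast
      from eq[OF this] show ?thesis by simp
    qed simp
  qed
  have cont: "AE \<omega> in M. continuous_on {0..<T} (\<lambda>t. Y t \<omega>)"
    using Y(1) by (simp add: strong_solution_def)
  show ?thesis
  proof (rule is_wiener_integral_AE_limit[where n = Suc and p = "grid t" and c = "\<lambda>k i. ?\<psi> (grid t k i)"])
    show "set_borel_measurable lborel {0..t} ?\<psi>"
      using borel_measurable_continuous_on_indicator[OF _ \<psi>] by (simp add: set_borel_measurable_def)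
    show "(\<lambda>k. \<integral>\<^sup>+u\<in>{0..t}. ennreal ((?\<psi> u - step_function (Suc k) (grid t k) (\<lambda>i. ?\<psi> (grid t k i)) u)\<^sup>2) \<partial>lborel)
        \<longlonglongrightarrow> 0"
      using step_function_grid_L2_tendsto[OF t0 \<psi>] .
    show "Y t \<in> borel_measurable M"
      using Y(1) t unfolding strong_solution_def by (blast intro: augmented_filtration_measurable_imp)
    show "AE \<omega> in M. (\<lambda>k. step_integral B (Suc k) (grid t k) (\<lambda>i. ?\<psi> (grid t k i)) \<omega>) \<longlonglongrightarrow> Y t \<omega>"
      using grid cont Y(2)
    proof eventually_elim
      case (elim \<omega>)
      show ?case
        unfolding step_integral_def
      proof (rule grid_sum_tendsto[where y = "\<lambda>s. Y s \<omega>" and w = "\<lambda>s. B s \<omega>" and b = b])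
        show "continuous_on {0..t} (\<lambda>s. Y s \<omega>)"
          using elim(2) sub by (rule continuous_on_subset)
        show "?\<psi> v - ?\<psi> u = - integral {u..v} (\<lambda>x. b x * ?\<psi> x)" if "0 \<le> u" "u \<le> v" "v \<le> t" for u v
          using exp_q_bar_diff[OF bt that] .
      qed (use elim t0 bt \<psi> in auto)
    qed
  qed (use t0 in \<open>auto simp: grid_simps intro: grid_mono\<close>)
qed

section \<open>Drift, diffusion coefficient and covariance\<close>

lemma same_fdd_subset: "same_fdd I M X N Y \<Longrightarrow> I' \<subseteq> I \<Longrightarrow> same_fdd I' M X N Y"
  unfolding same_fdd_def by blast

lemma same_fdd_sym: "same_fdd I M X N Y \<Longrightarrow> same_fdd I N Y M X"
  unfolding same_fdd_def by simp

lemma same_fdd_trans: "same_fdd I M X N Y \<Longrightarrow> same_fdd I N Y L Z \<Longrightarrow> same_fdd I M X L Z"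
  unfolding same_fdd_def by simp

lemma same_fdd_integral_mult_eq:
  assumes "same_fdd I M X N Y" "s \<in> I" "t \<in> I"
    and "\<And>r. r \<in> I \<Longrightarrow> X r \<in> borel_measurable M" "\<And>r. r \<in> I \<Longrightarrow> Y r \<in> borel_measurable N"
  shows "(\<integral>\<omega>. X s \<omega> * X t \<omega> \<partial>M) = (\<integral>\<omega>. Y s \<omega> * Y t \<omega> \<partial>N)"
proof -
  let ?J = "{s, t}"
  let ?h = "\<lambda>f. f s * f t :: real"
  have h: "?h \<in> borel_measurable (\<Pi>\<^sub>M r\<in>?J. borel)"
    by (intro borel_measurable_times measurable_component_singleton) auto
  have "(\<integral>\<omega>. X s \<omega> * X t \<omega> \<partial>M) = integral\<^sup>L (distr M (\<Pi>\<^sub>M r\<in>?J. borel) (\<lambda>\<omega>. \<lambda>r\<in>?J. X r \<omega>)) ?h"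
    using assms by (subst integral_distr[OF measurable_restrict h]) auto
  also have "distr M (\<Pi>\<^sub>M r\<in>?J. borel) (\<lambda>\<omega>. \<lambda>r\<in>?J. X r \<omega>) = distr N (\<Pi>\<^sub>M r\<in>?J. borel) (\<lambda>\<omega>. \<lambda>r\<in>?J. Y r \<omega>)"
    using assms(1-3) unfolding same_fdd_def by (elim allE[of _ ?J]) auto
  also have "integral\<^sup>L \<dots> ?h = (\<integral>\<omega>. Y s \<omega> * Y t \<omega> \<partial>N)"
    using assms by (subst integral_distr[OF measurable_restrict h]) auto
  finally show ?thesis .
qed

lemma (in wiener_process) expectation_mult_product_kernel:
  assumes "0 \<le> s" "s \<le> t" and h: "continuous_on {0..s} h"
    and I: "is_wiener_integral M B 0 s (\<lambda>u. G s * h u) I" and J: "is_wiener_integral M B 0 t (\<lambda>u. G t * h u) J"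
  shows "expectation (\<lambda>\<omega>. I \<omega> * J \<omega>) = G s * G t * integral {0..s} (\<lambda>u. (h u)\<^sup>2)"
proof -
  have "set_integrable lborel {0..s} (\<lambda>u. (h u)\<^sup>2)"
    unfolding set_integrable_def
    by (intro borel_integrable_compact continuous_intros h compact_Icc)
  note set_eq = set_borel_integral_eq_integral(2)[OF this]
  have "expectation (\<lambda>\<omega>. I \<omega> * J \<omega>)
      = (\<integral>u. (indicator {0..s} u * (G s * h u)) * (indicator {0..t} u * (G t * h u)) \<partial>lborel)"
    by (rule wiener_integral_mult(3)[OF I J])
  also have "\<dots> = (\<integral>u. (G s * G t) * (indicator {0..s} u *\<^sub>R (h u)\<^sup>2) \<partial>lborel)"
    using assms(1,2) by (intro Bochner_Integration.integral_cong) (auto simp: indicator_def power2_eq_square)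
  also have "\<dots> = G s * G t * integral {0..s} (\<lambda>u. (h u)\<^sup>2)"
    using set_eq by (simp add: set_lebesgue_integral_def)
  finally show ?thesis .
qed

lemma integral_pos_continuous:
  fixes f :: "real \<Rightarrow> real"
  assumes "a < b" "continuous_on {a..b} f" "\<And>x. x \<in> {a..b} \<Longrightarrow> 0 < f x"
  shows "0 < integral {a..b} f"
proof -
  obtain x where x: "x \<in> {a..b}" "\<And>y. y \<in> {a..b} \<Longrightarrow> f x \<le> f y"
    using continuous_attains_inf[of "{a..b}" f] assms by auto
  have "0 < f x * (b - a)"
    using assms(1,3) x(1) by simp
  also have "\<dots> = integral {a..b} (\<lambda>_. f x)"
    using \<open>a < b\<close> by simp
  also have "\<dots> \<le> integral {a..b} f"
    using assms x by (intro integral_le integrable_continuous_interval continuous_on_const) auto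
  finally show ?thesis .
qed

lemma has_real_derivative_unique_within_Icc:
  fixes f :: "real \<Rightarrow> real"
  assumes "a < b" "x \<in> {a..b}" "(f has_real_derivative d) (at x within {a..b})"
    "(f has_real_derivative e) (at x within {a..b})"
  shows "d = e"
  using vector_derivative_unique_within_closed_interval[of a b x f d e] assms
  by (simp add: has_real_derivative_iff_has_vector_derivative)

lemma zero_derivative_imp_constant_on_Icc:
  fixes f :: "real \<Rightarrow> real"
  assumes "a \<le> b" "\<And>x. x \<in> {a..b} \<Longrightarrow> (f has_real_derivative 0) (at x within {a..b})"
  shows "f b = f a"
proof -
  have "((\<lambda>x. 0) has_integral f b - f a) {a..b}"
    using assms by (intro fundamental_theorem_of_calculus)
      (auto simp: has_real_derivative_iff_has_vector_derivative)
  then show ?thesis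
    by (simp add: has_integral_iff)
qed

text \<open>Near x the interval up to b looks like the one up to (x + b)/2. Primitives of the drift
  -\<alpha>(t)/(T - t), which may be singular at T, are controlled on compact subintervals
  only.\<close>

lemma continuous_on_Ico_if_Icc:
  fixes f :: "real \<Rightarrow> real"
  assumes "\<And>r. r < b \<Longrightarrow> continuous_on {a..r} f"
  shows "continuous_on {a..<b} f"
  unfolding continuous_on_eq_continuous_within
proof
  fix x assume x: "x \<in> {a..<b}"
  let ?r = "(x + b) / 2"
  have "at x within {a..<b} = at x within {a..?r}"
    using x by (intro at_within_nhd[of x "{..<?r}"]) auto
  moreover have "continuous (at x within {a..?r}) f"
    using assms[of ?r] x by (simp add: continuous_on_eq_continuous_within)
  ultimately show "continuous (at x within {a..<b}) f"
    by (simp add: continuous_within)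
qed

text \<open>Comparing the identity at (s, r) with the one at (s, s) cancels both integrals and
  leaves G(r)/G(s) = a(r)/a(s). At s = 0 the integrals vanish and nothing can be cancelled, so G/a
  is first constant for positive times and then extended to 0 by continuity. The diagonal identity
  then relates the two integrals by the factor c^2, and differentiation relates the
  integrands.\<close>

lemma covariance_factorization_unique:
  fixes G a h g :: "real \<Rightarrow> real"
  assumes cont: "continuous_on {0..<T} G" "continuous_on {0..<T} a" "continuous_on {0..<T} h" "continuous_on {0..<T} g"
    and pos: "\<And>t. t \<in> {0..<T} \<Longrightarrow> 0 < G t" "\<And>t. t \<in> {0..<T} \<Longrightarrow> 0 < a t" "\<And>t. t \<in> {0..<T} \<Longrightarrow> 0 < g t"
    and eq: "\<And>s t. 0 \<le> s \<Longrightarrow> s \<le> t \<Longrightarrow> t < T \<Longrightarrow>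
      G s * G t * integral {0..s} (\<lambda>u. (h u)\<^sup>2) = a s * a t * integral {0..s} (\<lambda>u. (g u)\<^sup>2)"
    and t: "t \<in> {0..<T}"
  shows "G t = G 0 / a 0 * a t" and "(G 0 / a 0)\<^sup>2 * (h t)\<^sup>2 = (g t)\<^sup>2"
proof -
  let ?H = "\<lambda>s. integral {0..s} (\<lambda>u. (h u)\<^sup>2)" and ?A = "\<lambda>s. integral {0..s} (\<lambda>u. (g u)\<^sup>2)"
  let ?c = "G 0 / a 0"
  have quot: "G s / a s = G r / a r" if "0 < s" "s \<le> r" "r < T" for s r
  proof -
    have "0 < ?A s"
      using that pos(3) by (intro integral_pos_continuous continuous_intros continuous_on_subset[OF cont(4)])
        (auto simp: less_imp_neq[THEN not_sym])
    moreover have p: "0 < G s" "0 < G r" "0 < a s" "0 < a r"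
      using that by (auto intro: pos)
    ultimately have A: "0 < a s * ?A s" by simp
    have 1: "G s * (G s * ?H s) = a s * (a s * ?A s)"
      using eq[of s s] that by (simp add: mult_ac)
    have 2: "G r * (G s * ?H s) = a r * (a s * ?A s)"
      using eq[of s r] that by (simp add: mult_ac)
    have "(G s * a r) * (a s * ?A s) = G s * (G r * (G s * ?H s))"
      unfolding 2 by simp
    also have "\<dots> = G r * (a s * (a s * ?A s))"
      unfolding 1[symmetric] by simp
    finally have "(G s * a r) * (a s * ?A s) = (G r * a s) * (a s * ?A s)"
      by simp
    then have "G s * a r = G r * a s"
      using A by (metis mult_right_cancel less_irrefl)
    then show ?thesis
      using p by (simp add: field_simps)
  qed
  have c_quot: "G r / a r = ?c" if "r \<in> {0..<T}" for r
  proof (cases "r = 0")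
    case False
    then have r: "0 < r" "r < T" using that by auto
    have "?c = G r / a r"
    proof (rule continuous_constant_on_closure[of "{0<..<r}" "\<lambda>s. G s / a s"])
      show "continuous_on (closure {0<..<r}) (\<lambda>s. G s / a s)"
        using r pos(2) by (auto intro!: continuous_intros continuous_on_subset[OF cont(1)]
            continuous_on_subset[OF cont(2)] simp: less_imp_neq[THEN not_sym])
    qed (use r quot in auto)
    then show ?thesis by simp
  qed simp
  show "G t = ?c * a t"
    using pos(2)[OF t] unfolding c_quot[OF t, symmetric] by simp
  have H: "?c\<^sup>2 * ?H s = ?A s" if "s \<in> {0..<T}" for s
  proof -
    have p: "0 < G s" "0 < a s" using that pos by auto
    have "G s = ?c * a s"
      using p unfolding c_quot[OF that, symmetric] by simp
    then have "(a s)\<^sup>2 * (?c\<^sup>2 * ?H s) = (a s)\<^sup>2 * ?A s"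
      using eq[of s s] that by (simp add: power2_eq_square mult_ac)
    then show ?thesis using p by simp
  qed
  \<comment> \<open>A nondegenerate closed interval inside [0, T) containing t: derivatives within
    it are unique, also at t = 0, where they are one-sided.\<close>
  let ?r = "(t + T) / 2"
  have r: "0 < ?r" "t \<in> {0..?r}" "?r < T" "{0..?r} \<subseteq> {0..<T}" using t by auto
  have "((\<lambda>s. ?c\<^sup>2 * ?H s) has_real_derivative ?c\<^sup>2 * (h t)\<^sup>2) (at t within {0..?r})"
    using r by (intro DERIV_cmult integral_has_real_derivative continuous_intros continuous_on_subset[OF cont(3)])
  then have "(?A has_real_derivative ?c\<^sup>2 * (h t)\<^sup>2) (at t within {0..?r})"
    by (rule has_field_derivative_transform_within[OF _ zero_less_one r(2)]) (use r H in auto)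
  moreover have "(?A has_real_derivative (g t)\<^sup>2) (at t within {0..?r})"
    using r by (intro integral_has_real_derivative continuous_intros continuous_on_subset[OF cont(4)])
  ultimately show "?c\<^sup>2 * (h t)\<^sup>2 = (g t)\<^sup>2"
    using r by (intro has_real_derivative_unique_within_Icc[of 0 ?r t])
qed

lemma q_bar_has_derivative:
  assumes "continuous_on {0..r} q" "t \<in> {0..r}"
  shows "(q_bar q has_real_derivative q t) (at t within {0..r})"
  unfolding q_bar_def[abs_def] using assms by (rule integral_has_real_derivative)

lemma q_bar_0 [simp]: "q_bar q 0 = 0"
  by (simp add: q_bar_def)

context
  fixes q \<sigma> :: "real \<Rightarrow> real" and T :: real
  assumes T: "0 < T" and q: "continuous_on {0..} q" and \<sigma>: "continuous_on {0..} \<sigma>"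
begin

lemma continuous_on_ou_integrand:
  "continuous_on {0..T} (\<lambda>u. exp (2 * (q_bar q T - q_bar q u)) * (\<sigma> u)\<^sup>2)"
  by (intro continuous_intros continuous_on_q_bar continuous_on_subset[OF q] continuous_on_subset[OF \<sigma>]) auto

lemma ou_gamma_has_derivative:
  assumes "t \<in> {0..T}"
  shows "((\<lambda>t. ou_gamma q \<sigma> t T) has_real_derivative - (exp (2 * (q_bar q T - q_bar q t)) * (\<sigma> t)\<^sup>2)) (at t within {0..T})"
  unfolding ou_gamma_def using continuous_on_ou_integrand assms by (rule integral_has_real_derivative')

lemma continuous_on_ou_gamma: "continuous_on {0..T} (\<lambda>t. ou_gamma q \<sigma> t T)"
  using ou_gamma_has_derivative by (rule DERIV_continuous_on)

text \<open>The coefficient \<sigma> is known to be nonzero on [0, T) only, so strict positivity is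
  drawn from the first half of [t, T], while the second half contributes a nonnegative
  amount.\<close>

lemma ou_gamma_pos:
  assumes "t \<in> {0..<T}" "\<And>u. u \<in> {0..<T} \<Longrightarrow> \<sigma> u \<noteq> 0"
  shows "0 < ou_gamma q \<sigma> t T"
proof -
  let ?f = "\<lambda>u. exp (2 * (q_bar q T - q_bar q u)) * (\<sigma> u)\<^sup>2"
  let ?r = "(t + T) / 2"
  have t: "t < ?r" "?r \<le> T" "0 \<le> t" using assms(1) by auto
  have int: "?f integrable_on {t..T}"
    using t by (intro integrable_continuous_interval continuous_on_subset[OF continuous_on_ou_integrand]) auto
  have "0 < integral {t..?r} ?f"
    using t assms by (intro integral_pos_continuous continuous_on_subset[OF continuous_on_ou_integrand]) auto
  also have "0 \<le> integral {?r..T} ?f"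
    by (rule integral_nonneg[OF integrable_on_subinterval[OF int]]) (use t in auto)
  then have "integral {t..?r} ?f \<le> integral {t..?r} ?f + integral {?r..T} ?f"
    by simp
  also have "\<dots> = ou_gamma q \<sigma> t T"
    unfolding ou_gamma_def using t int by (intro Henstock_Kurzweil_Integration.integral_combine) auto
  finally show ?thesis .
qed

end

text \<open>The integral of \<alpha>(u)/(T - u) from s to t is \<open>q_bar b s\<close> -
  \<open>q_bar b t\<close>. Hence, with a = exp(\<open>q_bar b\<close>), every exponential in
  \<open>q_C\<close> splits into powers of a at its endpoints, and a(t)^2 is a common factor of the
  denominator.\<close>

lemma q_C_altdef:
  fixes T :: real and \<alpha> :: "real \<Rightarrow> real"
  defines "b \<equiv> \<lambda>t. - (\<alpha> t / (T - t))"
  assumes \<alpha>: "continuous_on {0..<T} \<alpha>" and t: "t \<in> {0..<T}"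
  shows "q_C T \<alpha> C t
    = b t + 1 / ((exp (q_bar b t))\<^sup>2 * (C + integral {0..t} (\<lambda>s. (exp (- q_bar b s))\<^sup>2)))"
proof -
  let ?g = "\<lambda>u. \<alpha> u / (T - u)"
  have g: "continuous_on {0..t} ?g"
    using t by (intro continuous_intros continuous_on_subset[OF \<alpha>]) auto
  have int: "integral {0..s} ?g = - q_bar b s" for s
    unfolding q_bar_def b_def by simp
  have exp_sq: "exp (- 2 * (x - y)) = (exp y)\<^sup>2 * (exp (- x))\<^sup>2" for x y :: real
    by (simp add: power2_eq_square flip: exp_add)
  have diff: "integral {s..t} ?g = q_bar b s - q_bar b t" if "s \<in> {0..t}" for s
  proof -
    have "integral {0..s} ?g + integral {s..t} ?g = integral {0..t} ?g"
      using that g by (intro Henstock_Kurzweil_Integration.integral_combine integrable_continuous_interval) auto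
    then show ?thesis using int[of s] int[of t] by simp
  qed
  have "exp (- 2 * integral {s..t} ?g) = (exp (q_bar b t))\<^sup>2 * (exp (- q_bar b s))\<^sup>2" if "s \<in> {0..t}" for s
    unfolding diff[OF that] by (rule exp_sq)
  then have "integral {0..t} (\<lambda>s. exp (- 2 * integral {s..t} ?g))
      = integral {0..t} (\<lambda>s. (exp (q_bar b t))\<^sup>2 * (exp (- q_bar b s))\<^sup>2)"
    by (rule Henstock_Kurzweil_Integration.integral_cong)
  also have "\<dots> = (exp (q_bar b t))\<^sup>2 * integral {0..t} (\<lambda>s. (exp (- q_bar b s))\<^sup>2)"
    by simp
  finally have A: "integral {0..t} (\<lambda>s. exp (- 2 * integral {s..t} ?g)) = \<dots>" .
  have C: "C * exp (- 2 * integral {0..t} ?g) = (exp (q_bar b t))\<^sup>2 * C"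
    unfolding int by (simp add: exp_add[symmetric] power2_eq_square)
  show ?thesis
    unfolding q_C_def A C b_def by (simp add: distrib_left)
qed

section \<open>From the covariance to the drift, and from the drift to the kernel\<close>

context
  fixes T :: real and q \<sigma> b :: "real \<Rightarrow> real"
  assumes T: "0 < T" and q: "continuous_on {0..} q" and \<sigma>: "continuous_on {0..} \<sigma>"
    and b: "continuous_on {0..<T} b"
begin

lemma exp_q_bar_has_derivative:
  assumes "t \<in> {0..r}" "r < T"
  shows "((\<lambda>t. exp (q_bar b t)) has_real_derivative exp (q_bar b t) * b t) (at t within {0..r})"
    and "((\<lambda>t. exp (- q_bar q t)) has_real_derivative exp (- q_bar q t) * - q t) (at t within {0..r})"
    and "((\<lambda>t. integral {0..t} (\<lambda>s. (exp (- q_bar b s))\<^sup>2)) has_real_derivative (exp (- q_bar b t))\<^sup>2) (at t within {0..r})"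
proof -
  have br: "continuous_on {0..r} b" and qr: "continuous_on {0..r} q"
    using assms(2) by (auto intro: continuous_on_subset[OF b] continuous_on_subset[OF q])
  show "((\<lambda>t. exp (q_bar b t)) has_real_derivative exp (q_bar b t) * b t) (at t within {0..r})"
    "((\<lambda>t. exp (- q_bar q t)) has_real_derivative exp (- q_bar q t) * - q t) (at t within {0..r})"
    by (rule derivative_eq_intros q_bar_has_derivative[OF br assms(1)] q_bar_has_derivative[OF qr assms(1)] refl | simp)+
  show "((\<lambda>t. integral {0..t} (\<lambda>s. (exp (- q_bar b s))\<^sup>2)) has_real_derivative (exp (- q_bar b t))\<^sup>2) (at t within {0..r})"
    by (intro integral_has_real_derivative continuous_intros continuous_on_q_bar br assms)
qed

text \<open>Write \<phi>(t) = \<gamma>(t, T) and K = e^(Q(T)). Once \<sigma>^2 = 1, the definition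
  of \<gamma> gives \<phi>' = -(K e^(-Q))^2, while \<phi> = c a e^(-Q) gives \<phi>' = \<phi> (b -
  q); so q = b + (K e^(-Q))^2 / \<phi>. Since K e^(-Q) / \<phi> = K / (c a), the first formula also
  says (1/\<phi>)' = (K/c)^2 / a^2, which integrates to 1/\<phi> = (K/c)^2 (C + A) and eliminates
  \<phi> from q.\<close>

lemma ou_drift_from_covariance:
  assumes \<sigma>0: "\<And>t. t \<in> {0..<T} \<Longrightarrow> \<sigma> t \<noteq> 0"
    and cov: "\<And>s t. 0 \<le> s \<Longrightarrow> s \<le> t \<Longrightarrow> t < T \<Longrightarrow>
      (ou_gamma q \<sigma> s T * exp (q_bar q s)) * (ou_gamma q \<sigma> t T * exp (q_bar q t))
        * integral {0..s} (\<lambda>u. (\<sigma> u * exp (- q_bar q u) / ou_gamma q \<sigma> u T)\<^sup>2)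
      = exp (q_bar b s) * exp (q_bar b t) * integral {0..s} (\<lambda>u. (exp (- q_bar b u))\<^sup>2)"
  shows "\<And>t. t \<in> {0..<T} \<Longrightarrow> (\<sigma> t)\<^sup>2 = 1"
    and "\<exists>C>0. \<forall>t\<in>{0..<T}. q t = b t + 1 / ((exp (q_bar b t))\<^sup>2 * (C + integral {0..t} (\<lambda>s. (exp (- q_bar b s))\<^sup>2)))"
proof -
  let ?\<phi> = "\<lambda>t. ou_gamma q \<sigma> t T"
  let ?a = "\<lambda>t. exp (q_bar b t)"
  let ?A = "\<lambda>t. integral {0..t} (\<lambda>s. (exp (- q_bar b s))\<^sup>2)"
  define c where "c = ?\<phi> 0"
  define K where "K = exp (q_bar q T)"
  have \<phi>: "0 < ?\<phi> t" if "t \<in> {0..<T}" for t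
    using ou_gamma_pos[OF T q \<sigma> that \<sigma>0] by simp
  have c: "0 < c" and K: "0 < K"
    using \<phi>[of 0] T by (auto simp: c_def K_def)
  have qT: "continuous_on {0..<T} (q_bar q)"
  proof (rule continuous_on_subset)
    show "continuous_on {0..T} (q_bar q)"
      by (intro continuous_on_q_bar continuous_on_subset[OF q]) auto
  qed auto
  have bT: "continuous_on {0..<T} (q_bar b)"
  proof (rule continuous_on_Ico_if_Icc)
    show "continuous_on {0..r} (q_bar b)" if "r < T" for r
      using that by (intro continuous_on_q_bar continuous_on_subset[OF b]) auto
  qed
  have \<phi>T: "continuous_on {0..<T} ?\<phi>"
    using continuous_on_ou_gamma[OF T q \<sigma>] by (rule continuous_on_subset) auto
  have \<sigma>T: "continuous_on {0..<T} \<sigma>"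
    using \<sigma> by (rule continuous_on_subset) auto
  note cont = continuous_intros qT bT \<phi>T \<sigma>T
  note fact = covariance_factorization_unique[where T = T and a = ?a and g = "\<lambda>u. exp (- q_bar b u)"
      and G = "\<lambda>t. ?\<phi> t * exp (q_bar q t)" and h = "\<lambda>u. \<sigma> u * exp (- q_bar q u) / ?\<phi> u", OF _ _ _ _ _ _ _ cov]
  have G: "?\<phi> t * exp (q_bar q t) = c * ?a t"
    and h: "c\<^sup>2 * (\<sigma> t * exp (- q_bar q t) / ?\<phi> t)\<^sup>2 = (exp (- q_bar b t))\<^sup>2" if "t \<in> {0..<T}" for t
  proof -
    have cs: "continuous_on {0..<T} (\<lambda>t. ?\<phi> t * exp (q_bar q t))" "continuous_on {0..<T} ?a"
      "continuous_on {0..<T} (\<lambda>u. \<sigma> u * exp (- q_bar q u) / ?\<phi> u)" "continuous_on {0..<T} (\<lambda>u. exp (- q_bar b u))"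
      using \<phi> by (auto intro!: cont simp: less_imp_neq[THEN not_sym])
    show "?\<phi> t * exp (q_bar q t) = c * ?a t"
      using fact(1)[OF cs _ _ _ _ _ _ that] \<phi> by (simp add: c_def)
    show "c\<^sup>2 * (\<sigma> t * exp (- q_bar q t) / ?\<phi> t)\<^sup>2 = (exp (- q_bar b t))\<^sup>2"
      using fact(2)[OF cs _ _ _ _ _ _ that] \<phi> by (simp add: c_def)
  qed
  have \<phi>_eq: "?\<phi> t = c * ?a t * exp (- q_bar q t)" if "t \<in> {0..<T}" for t
    using G[OF that] by (simp add: exp_minus field_simps)
  show \<sigma>1: "(\<sigma> t)\<^sup>2 = 1" if "t \<in> {0..<T}" for t
  proof -
    \<comment> \<open>Inserting \<phi> = c a e^(-Q) cancels e^(-Q), so the square of h is \<sigma>^2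
      / (c a)^2; comparison with 1 / (c a)^2 leaves \<sigma>^2 = 1.\<close>
    have "\<sigma> t * exp (- q_bar q t) / ?\<phi> t = \<sigma> t / (c * ?a t)"
      unfolding \<phi>_eq[OF that] by simp
    with h[OF that] have "c\<^sup>2 * ((\<sigma> t)\<^sup>2 / (c\<^sup>2 * (?a t)\<^sup>2)) = (exp (- q_bar b t))\<^sup>2"
      by (simp add: power_mult_distrib power_divide)
    with c show ?thesis
      by (simp add: exp_minus field_simps)
  qed
  have \<phi>_deriv: "(?\<phi> has_real_derivative - (K * exp (- q_bar q t))\<^sup>2) (at t within {0..r})"
    if "t \<in> {0..r}" "r < T" for t r
  proof -
    have "(?\<phi> has_real_derivative - (exp (2 * (q_bar q T - q_bar q t)) * (\<sigma> t)\<^sup>2)) (at t within {0..r})"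
      using ou_gamma_has_derivative[OF T q \<sigma>, of t] that by (auto intro: DERIV_subset)
    moreover have "exp (2 * (q_bar q T - q_bar q t)) * (\<sigma> t)\<^sup>2 = (K * exp (- q_bar q t))\<^sup>2"
      using that \<sigma>1[of t] by (simp add: K_def power2_eq_square exp_add[symmetric] algebra_simps)
    ultimately show ?thesis by simp
  qed
  have q_eq: "q t = b t + (K * exp (- q_bar q t))\<^sup>2 / ?\<phi> t" if t: "t \<in> {0..<T}" for t
  proof -
    let ?r = "(t + T) / 2"
    have r: "0 < ?r" "t \<in> {0..?r}" "?r < T" using t by auto
    have "((\<lambda>t. c * ?a t * exp (- q_bar q t)) has_real_derivative ?\<phi> t * (b t - q t)) (at t within {0..?r})"
      unfolding \<phi>_eq[OF t]
      by (rule derivative_eq_intros exp_q_bar_has_derivative[OF r(2,3)] refl | simp add: algebra_simps)+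
    then have "(?\<phi> has_real_derivative ?\<phi> t * (b t - q t)) (at t within {0..?r})"
      by (rule has_field_derivative_transform_within[OF _ zero_less_one r(2)]) (use r \<phi>_eq in auto)
    from has_real_derivative_unique_within_Icc[OF r(1,2) this \<phi>_deriv[OF r(2,3)]]
    show ?thesis
      using \<phi>[OF t] by (simp add: field_simps)
  qed
  \<comment> \<open>Solves 1/\<phi>(0) = (K/c)^2 C, the integrated equation at time 0, where A
    vanishes.\<close>
  define C where "C = c\<^sup>2 / (K\<^sup>2 * ?\<phi> 0)"
  have "0 < C"
    using c K \<phi>[of 0] T by (simp add: C_def)
  moreover have "q t = b t + 1 / ((?a t)\<^sup>2 * (C + ?A t))" if t: "t \<in> {0..<T}" for t
  proof -
    have exp_eq: "K * exp (- q_bar q u) / ?\<phi> u = K / c * exp (- q_bar b u)" if "u \<in> {0..<T}" for u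
      unfolding \<phi>_eq[OF that] using c by (simp add: exp_minus field_simps)
    have "inverse (?\<phi> t) - (K / c)\<^sup>2 * ?A t = inverse (?\<phi> 0) - (K / c)\<^sup>2 * ?A 0"
    proof (rule zero_derivative_imp_constant_on_Icc[where f = "\<lambda>u. inverse (?\<phi> u) - (K / c)\<^sup>2 * ?A u"])
      fix u assume u: "u \<in> {0..t}"
      have tT: "t < T" and uT: "u \<in> {0..<T}" using t u by auto
      have "((\<lambda>u. inverse (?\<phi> u) - (K / c)\<^sup>2 * ?A u) has_real_derivative
          (K * exp (- q_bar q u) / ?\<phi> u)\<^sup>2 - (K / c)\<^sup>2 * (exp (- q_bar b u))\<^sup>2) (at u within {0..t})"
        using \<phi>[OF uT]
        by (intro DERIV_cong[OF DERIV_diff[OF DERIV_inverse'[OF \<phi>_deriv[OF u tT]]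
                DERIV_cmult[OF exp_q_bar_has_derivative(3)[OF u tT]]]])
          (simp_all add: power2_eq_square divide_inverse)
      then show "((\<lambda>u. inverse (?\<phi> u) - (K / c)\<^sup>2 * ?A u) has_real_derivative 0) (at u within {0..t})"
        unfolding exp_eq[OF uT] by (simp add: power_mult_distrib power_divide)
    qed (use t in simp)
    then have inv: "inverse (?\<phi> t) = (K / c)\<^sup>2 * (C + ?A t)"
      using c K by (simp add: C_def field_simps)
    have "(K * exp (- q_bar q t))\<^sup>2 / ?\<phi> t = (K * exp (- q_bar q t) / ?\<phi> t)\<^sup>2 * ?\<phi> t"
      using \<phi>[OF t] by (simp add: power2_eq_square)
    also have "\<dots> = (K / c)\<^sup>2 * (exp (- q_bar b t))\<^sup>2 * ?\<phi> t"
      unfolding exp_eq[OF t] by (simp add: power_mult_distrib power_divide)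
    also have "\<dots> = (K / c)\<^sup>2 * (exp (- q_bar b t))\<^sup>2 * inverse ((K / c)\<^sup>2 * (C + ?A t))"
      unfolding inv[symmetric] by simp
    also have "(K / c)\<^sup>2 * (exp (- q_bar b t))\<^sup>2 * inverse ((K / c)\<^sup>2 * (C + ?A t)) = 1 / ((?a t)\<^sup>2 * (C + ?A t))"
    proof -
      have "k * (exp (- x))\<^sup>2 * inverse (k * X) = 1 / ((exp x)\<^sup>2 * X)" if "k \<noteq> 0" for k x X :: real
        using that by (simp add: exp_minus divide_inverse power_inverse)
      then show ?thesis using c K by simp
    qed
    finally show ?thesis
      using q_eq[OF t] by simp
  qed
  ultimately show "\<exists>C>0. \<forall>t\<in>{0..<T}. q t = b t + 1 / ((?a t)\<^sup>2 * (C + ?A t))"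
    by blast
qed

text \<open>The logarithmic derivative of e^(-Q) a (C + A) is b - q + a^(-2) / (C + A) = 0, so this
  product keeps its initial value C. Thereby \<phi>' = -(K e^(-Q))^2 becomes the derivative of (K
  C)^2 / (C + A), and \<phi> equals the latter up to a constant \<kappa>. With \<kappa> = 0, \<phi>
  e^Q = K^2 C a, and the constant factor cancels in the quotient of the kernel.\<close>

lemma ou_kernel_eq:
  assumes C: "0 < C"
    and q_eq: "\<And>t. t \<in> {0..<T} \<Longrightarrow>
      q t = b t + 1 / ((exp (q_bar b t))\<^sup>2 * (C + integral {0..t} (\<lambda>s. (exp (- q_bar b s))\<^sup>2)))"
    and \<sigma>1: "\<And>t. t \<in> {0..<T} \<Longrightarrow> (\<sigma> t)\<^sup>2 = 1"
    and div: "filterlim (\<lambda>t. integral {0..t} (\<lambda>s. (exp (- q_bar b s))\<^sup>2)) at_top (at_left T)"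
    and st: "0 \<le> s" "s \<le> t" "t < T"
  shows "ou_gamma q \<sigma> t T / ou_gamma q \<sigma> s T * exp (q_bar q t - q_bar q s) = exp (q_bar b t - q_bar b s)"
proof -
  let ?\<phi> = "\<lambda>t. ou_gamma q \<sigma> t T"
  let ?a = "\<lambda>t. exp (q_bar b t)"
  let ?A = "\<lambda>t. integral {0..t} (\<lambda>s. (exp (- q_bar b s))\<^sup>2)"
  define K where "K = exp (q_bar q T)"
  have K: "0 < K" by (simp add: K_def)
  \<comment> \<open>Stated for every real t, also beyond T: where the integrand is not integrable,
    the integral is 0 by convention.\<close>
  have A0: "0 \<le> ?A t" for t
    by (cases "(\<lambda>s. (exp (- q_bar b s))\<^sup>2) integrable_on {0..t}")
      (auto intro: integral_nonneg simp: not_integrable_integral)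
  have D: "0 < C + ?A t" for t
    using C A0[of t] by linarith
  have exp_eq: "exp (- q_bar q t) * ?a t * (C + ?A t) = C" if t: "t \<in> {0..<T}" for t
  proof -
    have "exp (- q_bar q t) * ?a t * (C + ?A t) = exp (- q_bar q 0) * ?a 0 * (C + ?A 0)"
    proof (rule zero_derivative_imp_constant_on_Icc[where f = "\<lambda>u. exp (- q_bar q u) * ?a u * (C + ?A u)"])
      fix u assume u: "u \<in> {0..t}"
      have tT: "t < T" and uT: "u \<in> {0..<T}" using t u by auto
      have "((\<lambda>u. exp (- q_bar q u) * ?a u * (C + ?A u)) has_real_derivative
          exp (- q_bar q u) * ?a u * ((b u - q u) * (C + ?A u) + (exp (- q_bar b u))\<^sup>2)) (at u within {0..t})"
        by (rule derivative_eq_intros exp_q_bar_has_derivative[OF u tT] refl | simp add: algebra_simps)+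
      moreover have "(b u - q u) * (C + ?A u) + (exp (- q_bar b u))\<^sup>2 = 0"
      proof -
        have "b u - q u = - (1 / ((?a u)\<^sup>2 * (C + ?A u)))"
          using q_eq[OF uT] by simp
        then have "(b u - q u) * (C + ?A u) = - (1 / (?a u)\<^sup>2)"
          using D[of u] by simp
        then show ?thesis
          by (simp add: exp_minus inverse_eq_divide power_divide)
      qed
      ultimately show "((\<lambda>u. exp (- q_bar q u) * ?a u * (C + ?A u)) has_real_derivative 0) (at u within {0..t})"
        by simp
    qed (use t in simp)
    then show ?thesis by simp
  qed
  define \<kappa> where "\<kappa> = ?\<phi> 0 - (K * C)\<^sup>2 * inverse (C + ?A 0)"
  have \<kappa>: "?\<phi> t - (K * C)\<^sup>2 * inverse (C + ?A t) = \<kappa>" if t: "t \<in> {0..<T}" for t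
    unfolding \<kappa>_def
  proof (rule zero_derivative_imp_constant_on_Icc[where f = "\<lambda>u. ?\<phi> u - (K * C)\<^sup>2 * inverse (C + ?A u)"])
    fix u assume u: "u \<in> {0..t}"
    have tT: "t < T" and uT: "u \<in> {0..<T}" using t u by auto
    have "(?\<phi> has_real_derivative - (exp (2 * (q_bar q T - q_bar q u)) * (\<sigma> u)\<^sup>2)) (at u within {0..t})"
      using ou_gamma_has_derivative[OF T q \<sigma>, of u] uT tT by (auto intro: DERIV_subset)
    moreover have "exp (2 * (q_bar q T - q_bar q u)) * (\<sigma> u)\<^sup>2 = (K * exp (- q_bar q u))\<^sup>2"
      using \<sigma>1[OF uT] by (simp add: K_def power2_eq_square exp_add[symmetric] algebra_simps)
    ultimately have \<phi>': "(?\<phi> has_real_derivative - (K * exp (- q_bar q u))\<^sup>2) (at u within {0..t})"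
      by simp
    have "((\<lambda>u. ?\<phi> u - (K * C)\<^sup>2 * inverse (C + ?A u)) has_real_derivative
        - (K * exp (- q_bar q u))\<^sup>2 + (K * C)\<^sup>2 * (exp (- q_bar b u) / (C + ?A u))\<^sup>2) (at u within {0..t})"
      using D[of u]
      by (intro DERIV_cong[OF DERIV_diff[OF \<phi>' DERIV_cmult[OF DERIV_inverse'[OF
                  DERIV_add[OF DERIV_const exp_q_bar_has_derivative(3)[OF u tT]]]]]])
        (simp_all add: power2_eq_square divide_inverse)
    moreover have "(K * exp (- q_bar q u))\<^sup>2 = (K * C)\<^sup>2 * (exp (- q_bar b u) / (C + ?A u))\<^sup>2"
    proof -
      have "exp (- q_bar q u) = C * (exp (- q_bar b u) / (C + ?A u))"
        using exp_eq[OF uT] D[of u] C by (simp add: exp_minus field_simps)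
      then show ?thesis by (simp only: power_mult_distrib mult_ac)
    qed
    ultimately show "((\<lambda>u. ?\<phi> u - (K * C)\<^sup>2 * inverse (C + ?A u)) has_real_derivative 0) (at u within {0..t})"
      by simp
  qed (use t in simp)
  \<comment> \<open>As t tends to T, \<phi> tends to the integral over a single point, and 1/(C + A)
    tends to 0 by divergence of A. A surviving constant would add a multiple of e^Q to \<phi> e^Q
    and destroy its proportionality to a.\<close>
  have "\<kappa> = 0"
  proof -
    have "(?\<phi> \<longlongrightarrow> ?\<phi> T) (at T within {0..T})"
      using continuous_on_ou_gamma[OF T q \<sigma>] T by (simp add: continuous_on_def)
    then have "(?\<phi> \<longlongrightarrow> 0) (at_left T)"
      using T by (simp add: at_within_Icc_at_left ou_gamma_def)
    moreover have "((\<lambda>t. inverse (C + ?A t)) \<longlongrightarrow> 0) (at_left T)"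
      by (intro tendsto_inverse_0_at_top filterlim_tendsto_add_at_top[OF tendsto_const div])
    ultimately have "((\<lambda>t. ?\<phi> t - (K * C)\<^sup>2 * inverse (C + ?A t)) \<longlongrightarrow> 0 - (K * C)\<^sup>2 * 0) (at_left T)"
      by (intro tendsto_intros)
    moreover have "\<forall>\<^sub>F t in at_left T. ?\<phi> t - (K * C)\<^sup>2 * inverse (C + ?A t) = \<kappa>"
      using T \<kappa> by (auto simp: eventually_at_left intro!: exI[of _ 0])
    then have "((\<lambda>t. ?\<phi> t - (K * C)\<^sup>2 * inverse (C + ?A t)) \<longlongrightarrow> \<kappa>) (at_left T)"
      by (rule tendsto_eventually)
    ultimately show ?thesis
      using tendsto_unique[OF trivial_limit_at_left_real] by fastforce
  qed
  have prod: "?\<phi> t = K\<^sup>2 * C * ?a t * exp (- q_bar q t)" if t: "t \<in> {0..<T}" for t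
  proof -
    have "?\<phi> t = (K * C)\<^sup>2 * inverse (C + ?A t)"
      using \<kappa>[OF t] \<open>\<kappa> = 0\<close> by simp
    also have "inverse (C + ?A t) = exp (- q_bar q t) * ?a t / C"
      using exp_eq[OF t] D[of t] C by (simp add: field_simps)
    finally show ?thesis
      using C by (simp add: power2_eq_square)
  qed
  show ?thesis
    using prod[of t] prod[of s] st C K by (simp add: exp_minus exp_diff field_simps)
qed

end

text \<open>Once \<open>\<alpha> \<ge> 1/2\<close>, the function \<open>exp (- 2 q_bar b t) (T - t)\<close> is nondecreasing, so the integrand dominates a
  multiple of \<open>1 / (T - t)\<close>.\<close>

lemma integral_exp_q_bar_at_top:
  fixes T :: real and \<alpha> :: "real \<Rightarrow> real"
  defines "b \<equiv> \<lambda>t. - (\<alpha> t / (T - t))"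
  assumes T: "0 < T" and \<alpha>: "continuous_on {0..<T} \<alpha>" "(\<alpha> \<longlongrightarrow> 1) (at_left T)"
  shows "filterlim (\<lambda>t. integral {0..t} (\<lambda>s. (exp (- q_bar b s))\<^sup>2)) at_top (at_left T)"
proof -
  let ?A = "\<lambda>t. integral {0..t} (\<lambda>s. (exp (- q_bar b s))\<^sup>2)"
  let ?F = "\<lambda>t. (exp (- q_bar b t))\<^sup>2 * (T - t)"
  have "\<forall>\<^sub>F t in at_left T. 1 / 2 < \<alpha> t"
    using \<alpha>(2) by (rule order_tendstoD) simp
  then obtain r0 where r0: "r0 < T" "\<And>t. r0 < t \<Longrightarrow> t < T \<Longrightarrow> 1 / 2 < \<alpha> t"
    unfolding eventually_at_left[OF T] by auto
  \<comment> \<open>The midpoint with \<open>max 0 r0\<close> lies strictly inside (0, T), so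
    two-sided derivatives are available from r on.\<close>
  define r where "r = (max 0 r0 + T) / 2"
  have r: "0 < r" "r < T" "\<And>t. r \<le> t \<Longrightarrow> t < T \<Longrightarrow> 1 / 2 < \<alpha> t"
    using r0 T by (auto simp: r_def)
  have b: "continuous_on {0..<T} b"
    unfolding b_def by (intro continuous_intros \<alpha>) auto
  have at: "at t within {0..(t + T) / 2} = at t" if "r \<le> t" "t < T" for t
    using r that by (intro at_within_interior) auto
  have q': "(q_bar b has_real_derivative b t) (at t)" if "r \<le> t" "t < T" for t
  proof -
    have "continuous_on {0..(t + T) / 2} b"
      using that by (intro continuous_on_subset[OF b]) auto
    then have "(q_bar b has_real_derivative b t) (at t within {0..(t + T) / 2})"
      by (rule q_bar_has_derivative) (use r that in auto)
    then show ?thesis using at[OF that] by simp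
  qed
  have A': "(?A has_real_derivative (exp (- q_bar b t))\<^sup>2) (at t)" if "r \<le> t" "t < T" for t
  proof -
    have "(?A has_real_derivative (exp (- q_bar b t))\<^sup>2) (at t within {0..(t + T) / 2})"
      using r that by (intro integral_has_real_derivative continuous_intros continuous_on_q_bar
          continuous_on_subset[OF b]) auto
    then show ?thesis using at[OF that] by simp
  qed
  have F_mono: "?F r \<le> ?F t" if t: "r \<le> t" "t < T" for t
  proof (rule DERIV_nonneg_imp_nondecreasing[OF t(1)])
    fix x assume x: "r \<le> x" "x \<le> t"
    then have xT: "x < T" using t by simp
    \<comment> \<open>In terms of \<alpha> the last factor is 2 \<alpha> - 1, whence the threshold
      1/2.\<close>
    have "(?F has_real_derivative (exp (- q_bar b x))\<^sup>2 * (2 * - (b x * (T - x)) - 1)) (at x)"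
      by (auto intro!: derivative_eq_intros q'[OF x(1) xT] simp: power2_eq_square algebra_simps)
    moreover have "b x * (T - x) = - \<alpha> x"
      using xT by (simp add: b_def)
    ultimately have "(?F has_real_derivative (exp (- q_bar b x))\<^sup>2 * (2 * \<alpha> x - 1)) (at x)"
      by simp
    moreover have "0 \<le> (exp (- q_bar b x))\<^sup>2 * (2 * \<alpha> x - 1)"
      using r(3)[OF x(1) xT] by simp
    ultimately show "\<exists>y. (?F has_real_derivative y) (at x) \<and> 0 \<le> y" by blast
  qed
  have lower: "?A r + ?F r * (ln (T - r) - ln (T - t)) \<le> ?A t" if t: "r \<le> t" "t < T" for t
  proof -
    \<comment> \<open>The comparison is phrased as monotonicity of A + F(r) ln (T - t), whose
      derivative is (F(x) - F(r)) / (T - x).\<close>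
    have "?A r + ?F r * ln (T - r) \<le> ?A t + ?F r * ln (T - t)"
    proof (rule DERIV_nonneg_imp_nondecreasing[OF t(1)])
      fix x assume x: "r \<le> x" "x \<le> t"
      then have xT: "x < T" using t by simp
      have "((\<lambda>t. ?A t + ?F r * ln (T - t)) has_real_derivative (exp (- q_bar b x))\<^sup>2 - ?F r / (T - x)) (at x)"
        using xT by (auto intro!: derivative_eq_intros A'[OF x(1) xT])
      moreover have "0 \<le> (exp (- q_bar b x))\<^sup>2 - ?F r / (T - x)"
        using F_mono[OF x(1) xT] xT by (simp add: field_simps)
      ultimately show "\<exists>y. ((\<lambda>t. ?A t + ?F r * ln (T - t)) has_real_derivative y) (at x) \<and> 0 \<le> y" by blast
    qed
    then show ?thesis by (simp add: algebra_simps)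
  qed
  have Fr: "0 < ?F r" using r by simp
  have "filterlim (\<lambda>t. T - t) (at_right 0) (at_left T)"
    by (auto intro!: tendsto_eq_intros simp: filterlim_at eventually_at_left[OF T] intro: lt_ex)
  then have "filterlim (\<lambda>t. ln (T - t)) at_bot (at_left T)"
    by (rule filterlim_compose[OF ln_at_0])
  then have "filterlim (\<lambda>t. - ln (T - t)) at_top (at_left T)"
    by (simp add: filterlim_uminus_at_top)
  then have "filterlim (\<lambda>t. ln (T - r) + - ln (T - t)) at_top (at_left T)"
    by (rule filterlim_tendsto_add_at_top[OF tendsto_const])
  then have "filterlim (\<lambda>t. ?F r * (ln (T - r) + - ln (T - t))) at_top (at_left T)"
    by (rule filterlim_tendsto_pos_mult_at_top[OF tendsto_const Fr])
  then have "filterlim (\<lambda>t. ?A r + ?F r * (ln (T - r) + - ln (T - t))) at_top (at_left T)"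
    by (rule filterlim_tendsto_add_at_top[OF tendsto_const])
  then show ?thesis
  proof (rule filterlim_at_top_mono)
    show "\<forall>\<^sub>F t in at_left T. ?A r + ?F r * (ln (T - r) + - ln (T - t)) \<le> ?A t"
      unfolding eventually_at_left[OF T] using lower r by (intro exI[of _ r]) auto
  qed
qed

section \<open>The bridges\<close>

text \<open>The function is pasted from the closed pieces up to T and from T on; the left limit at T
  is the only point of contact to be checked.\<close>

lemma extend_limit_continuous_on:
  fixes f :: "real \<Rightarrow> real"
  assumes T: "a < T" and f: "continuous_on {a..<T} f" and L: "(f \<longlongrightarrow> L) (at_left T)"
  shows "continuous_on {a..} (\<lambda>t. if t < T then f t else L)"
proof -
  let ?g = "\<lambda>t. if t < T then f t else L"
  have "continuous_on {a..T} ?g"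
    unfolding continuous_on_eq_continuous_within
  proof
    fix x assume x: "x \<in> {a..T}"
    show "continuous (at x within {a..T}) ?g"
    proof (cases "x < T")
      case True
      have "continuous_on {a..<T} ?g"
        using f by (rule continuous_on_cong[THEN iffD1, rotated -1]) auto
      moreover have "at x within {a..T} = at x within {a..<T}"
        using True x by (intro at_within_nhd[of x "{..<T}"]) auto
      ultimately show ?thesis
        using True x by (simp add: continuous_on_eq_continuous_within continuous_within)
    next
      case False
      then have "x = T" using x by simp
      have "\<forall>\<^sub>F t in at_left T. f t = ?g t"
        by (auto simp: eventually_at_left[OF T] intro: exI[of _ a] T)
      with L have "(?g \<longlongrightarrow> L) (at_left T)"
        by (rule Lim_transform_eventually)
      then show ?thesis
        using T \<open>x = T\<close> by (simp add: continuous_within at_within_Icc_at_left)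
    qed
  qed
  moreover have "continuous_on {T..} ?g"
    by (rule continuous_on_cong[THEN iffD1, OF refl _ continuous_on_const[of _ L]]) auto
  ultimately have "continuous_on ({a..T} \<union> {T..}) ?g"
    by (intro continuous_on_closed_Un) auto
  moreover have "{a..T} \<union> {T..} = {a..}" using T by auto
  ultimately show ?thesis by simp
qed

lemma continuously_differentiable_on_imp_continuous_on:
  "continuously_differentiable_on f S \<Longrightarrow> continuous_on S f"
  unfolding continuously_differentiable_on_def by (auto intro: DERIV_continuous_on)

text \<open>A continuous function with finitely many values on a connected set is constant, so the
  sign cannot change.\<close>

lemma square_eq_1_constant_sign:
  fixes \<sigma> :: "real \<Rightarrow> real"
  assumes "continuous_on {0..<T} \<sigma>" "\<And>t. t \<in> {0..<T} \<Longrightarrow> (\<sigma> t)\<^sup>2 = 1"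
  shows "(\<forall>t\<in>{0..<T}. \<sigma> t = 1) \<or> (\<forall>t\<in>{0..<T}. \<sigma> t = - 1)"
proof -
  have sign: "\<sigma> t = 1 \<or> \<sigma> t = - 1" if "t \<in> {0..<T}" for t
    using assms(2)[OF that] by (simp add: power2_eq_1_iff)
  then have "\<sigma> ` {0..<T} \<subseteq> {1, - 1}"
    by blast
  then have "finite (\<sigma> ` {0..<T})"
    by (rule finite_subset) simp
  then have "\<sigma> constant_on {0..<T}"
    using assms(1) by (intro continuous_finite_range_constant) auto
  then obtain c where "\<And>t. t \<in> {0..<T} \<Longrightarrow> \<sigma> t = c"
    by (auto simp: constant_on_def)
  with sign show ?thesis
    by metis
qed

context
  fixes T :: real and \<alpha> :: "real \<Rightarrow> real"
  assumes T: "0 < T" and \<alpha>: "continuous_on {0..<T} \<alpha>"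
begin

abbreviation (input) alpha_drift :: "real \<Rightarrow> real" where
  "alpha_drift \<equiv> \<lambda>t. - (\<alpha> t / (T - t))"

lemma continuous_on_alpha_drift: "continuous_on {0..<T} alpha_drift"
  by (intro continuous_intros \<alpha>) auto

lemma alpha_wiener_bridge_fddE:
  assumes "alpha_wiener_bridge M W \<alpha> T N X"
  obtains Y where "wiener_process M W" "same_fdd {0..<T} N X M Y"
    "\<And>t. t \<in> {0..<T} \<Longrightarrow> is_wiener_integral M W 0 t (\<lambda>s. exp (q_bar alpha_drift t) * exp (- q_bar alpha_drift s)) (Y t)"
proof -
  from assms obtain Y where W: "wiener_process M W" and
    Y: "strong_solution M W {0..<T} alpha_drift (\<lambda>_. 1) Y" "AE \<omega> in M. Y 0 \<omega> = 0" "same_fdd {0..<T} N X M Y"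
    unfolding alpha_wiener_bridge_def by blast
  show ?thesis
  proof (rule that[OF W Y(3)])
    fix t assume "t \<in> {0..<T}"
    from wiener_process.strong_solution_is_wiener_integral[OF W continuous_on_alpha_drift Y(1,2) this]
    show "is_wiener_integral M W 0 t (\<lambda>s. exp (q_bar alpha_drift t) * exp (- q_bar alpha_drift s)) (Y t)"
      by (simp add: exp_diff exp_minus divide_inverse)
  qed
qed

lemma ou_bridge_fddE:
  assumes "ou_bridge M B q \<sigma> Z T N U"
  obtains V where "wiener_process M B" "same_fdd {0..<T} N U M V" "\<And>t. 0 \<le> t \<Longrightarrow> \<sigma> t \<noteq> 0"
    "\<And>t. t \<in> {0..<T} \<Longrightarrow> is_wiener_integral M B 0 t
       (\<lambda>s. ou_gamma q \<sigma> t T / ou_gamma q \<sigma> s T * exp (q_bar q t - q_bar q s) * \<sigma> s) (V t)"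
proof -
  from assms obtain V where "wiener_process M B" "same_fdd {0..T} N U M V" "\<And>t. 0 \<le> t \<Longrightarrow> \<sigma> t \<noteq> 0"
    "\<And>t. t \<in> {0..<T} \<Longrightarrow> is_wiener_integral M B 0 t
       (\<lambda>s. ou_gamma q \<sigma> t T / ou_gamma q \<sigma> s T * exp (q_bar q t - q_bar q s) * \<sigma> s) (V t)"
    unfolding ou_bridge_def ou_process_def by blast
  moreover have "same_fdd {0..<T} N U M V"
    by (rule same_fdd_subset) (fact, auto)
  ultimately show ?thesis
    using that by blast
qed

text \<open>Equality of laws is passed from U and X to the Wiener integrals V and Y, whose second
  moments are explicit. Splitting e^(Q(t) - Q(u)) brings the kernel of V into product form, so that
  equal second moments become the identity from which the drift is determined.\<close>

lemma ou_bridge_eq_alpha_bridge_imp: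
  assumes q: "continuous_on {0..} q" and \<sigma>: "continuous_on {0..} \<sigma>"
    and U: "ou_bridge M B q \<sigma> Z T N U" and X: "alpha_wiener_bridge M' W \<alpha> T N' X"
    and eq: "same_fdd {0..<T} N U N' X"
  shows "(\<exists>C>0. \<forall>t\<in>{0..<T}. q t = q_C T \<alpha> C t) \<and>
    ((\<forall>t\<in>{0..<T}. \<sigma> t = 1) \<or> (\<forall>t\<in>{0..<T}. \<sigma> t = - 1))"
proof -
  obtain V where B: "wiener_process M B" and V: "same_fdd {0..<T} N U M V" "\<And>t. 0 \<le> t \<Longrightarrow> \<sigma> t \<noteq> 0"
    "\<And>t. t \<in> {0..<T} \<Longrightarrow> is_wiener_integral M B 0 t
       (\<lambda>s. ou_gamma q \<sigma> t T / ou_gamma q \<sigma> s T * exp (q_bar q t - q_bar q s) * \<sigma> s) (V t)"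
    by (rule ou_bridge_fddE[OF U]) (rule that)
  obtain Y where W: "wiener_process M' W" and Y: "same_fdd {0..<T} N' X M' Y"
    "\<And>t. t \<in> {0..<T} \<Longrightarrow> is_wiener_integral M' W 0 t (\<lambda>s. exp (q_bar alpha_drift t) * exp (- q_bar alpha_drift s)) (Y t)"
    by (rule alpha_wiener_bridge_fddE[OF X]) (rule that)
  have VY: "same_fdd {0..<T} M V M' Y"
    using same_fdd_trans[OF same_fdd_trans[OF same_fdd_sym[OF V(1)] eq] Y(1)] .
  let ?G = "\<lambda>t. ou_gamma q \<sigma> t T * exp (q_bar q t)"
  let ?h = "\<lambda>u. \<sigma> u * exp (- q_bar q u) / ou_gamma q \<sigma> u T"
  have V': "is_wiener_integral M B 0 t (\<lambda>u. ?G t * ?h u) (V t)" if "t \<in> {0..<T}" for t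
    using V(3)[OF that] by (simp add: exp_diff exp_minus divide_inverse mult_ac)
  have cont_h: "continuous_on {0..s} ?h" if "s < T" for s
  proof -
    have "ou_gamma q \<sigma> u T \<noteq> 0" if "u \<in> {0..s}" for u
      using ou_gamma_pos[OF T q \<sigma>, of u] that \<open>s < T\<close> V(2) by auto
    moreover have "continuous_on {0..s} (\<lambda>u. ou_gamma q \<sigma> u T)"
      using that by (intro continuous_on_subset[OF continuous_on_ou_gamma[OF T q \<sigma>]]) auto
    ultimately show ?thesis
      by (intro continuous_intros continuous_on_q_bar continuous_on_subset[OF q] continuous_on_subset[OF \<sigma>]) auto
  qed
  have cont_g: "continuous_on {0..s} (\<lambda>u. exp (- q_bar alpha_drift u))" if "s < T" for s
    using that by (intro continuous_intros continuous_on_q_bar continuous_on_subset[OF continuous_on_alpha_drift]) auto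
  have "?G s * ?G t * integral {0..s} (\<lambda>u. (?h u)\<^sup>2)
      = exp (q_bar alpha_drift s) * exp (q_bar alpha_drift t) * integral {0..s} (\<lambda>u. (exp (- q_bar alpha_drift u))\<^sup>2)"
    if st: "0 \<le> s" "s \<le> t" "t < T" for s t
  proof -
    have s: "s \<in> {0..<T}" and t: "t \<in> {0..<T}" using st by auto
    have "?G s * ?G t * integral {0..s} (\<lambda>u. (?h u)\<^sup>2) = (\<integral>\<omega>. V s \<omega> * V t \<omega> \<partial>M)"
      using st by (intro wiener_process.expectation_mult_product_kernel[OF B, symmetric] cont_h V' s t) auto
    also have "\<dots> = (\<integral>\<omega>. Y s \<omega> * Y t \<omega> \<partial>M')"
      using V' Y(2) by (intro same_fdd_integral_mult_eq[OF VY s t]) (auto simp: is_wiener_integral_def)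
    also have "\<dots> = exp (q_bar alpha_drift s) * exp (q_bar alpha_drift t)
        * integral {0..s} (\<lambda>u. (exp (- q_bar alpha_drift u))\<^sup>2)"
      using st by (intro wiener_process.expectation_mult_product_kernel[OF W] cont_g Y s t) auto
    finally show ?thesis .
  qed
  note drift = ou_drift_from_covariance[OF T q \<sigma> continuous_on_alpha_drift _ this]
  have "continuous_on {0..<T} \<sigma>"
    using \<sigma> by (rule continuous_on_subset) auto
  then have "(\<forall>t\<in>{0..<T}. \<sigma> t = 1) \<or> (\<forall>t\<in>{0..<T}. \<sigma> t = - 1)"
    using drift(1) V(2) by (intro square_eq_1_constant_sign) auto
  moreover have "\<exists>C>0. \<forall>t\<in>{0..<T}. q t = q_C T \<alpha> C t"
    using drift(2) V(2) q_C_altdef[OF \<alpha>] by auto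
  ultimately show ?thesis by blast
qed

text \<open>The primitives are continuous on each compact part of [0, T), and C > 0 with a
  nonnegative integral keeps the denominator positive. Together with the left limit at T this yields
  a continuous extension of the drift to the whole half-line.\<close>

lemma continuous_on_q_C:
  assumes "0 < C"
  shows "continuous_on {0..<T} (q_C T \<alpha> C)"
proof -
  let ?b = alpha_drift
  let ?A = "\<lambda>t. integral {0..t} (\<lambda>s. (exp (- q_bar ?b s))\<^sup>2)"
  have q_bar: "continuous_on {0..r} (q_bar ?b)" if "r < T" for r
    using that by (intro continuous_on_q_bar continuous_on_subset[OF continuous_on_alpha_drift]) auto
  have A: "continuous_on {0..<T} ?A"
  proof (rule continuous_on_Ico_if_Icc)
    fix r assume "r < T"
    then show "continuous_on {0..r} ?A"
      by (intro indefinite_integral_continuous_1 integrable_continuous_interval continuous_intros q_bar)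
  qed
  have "0 \<le> ?A t" if "t < T" for t
    using that by (intro integral_nonneg integrable_continuous_interval continuous_intros q_bar) auto
  then have "0 < C + ?A t" if "t < T" for t
    using \<open>0 < C\<close> that by (auto intro: add_pos_nonneg)
  then have "continuous_on {0..<T} (\<lambda>t. ?b t + 1 / ((exp (q_bar ?b t))\<^sup>2 * (C + ?A t)))"
    by (intro continuous_intros continuous_on_alpha_drift A continuous_on_Ico_if_Icc q_bar \<alpha>)
      (auto simp: less_imp_neq[THEN not_sym])
  then show ?thesis
    by (rule continuous_on_cong[THEN iffD1, rotated -1]) (simp_all add: q_C_altdef[OF \<alpha>])
qed

text \<open>By the kernel identity the bridge integrates a(t)/a(s) times the constant sign of
  \<sigma>. For the sign -1 the minus is moved from the integrand to the driving process, since -B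
  is again a Wiener process; in both cases the kernels agree with that of the \<alpha>-Wiener
  bridge.\<close>

lemma ou_bridge_q_C_eq_alpha_bridge:
  assumes lim: "(\<alpha> \<longlongrightarrow> 1) (at_left T)" and C: "0 < C"
    and q: "continuous_on {0..} q" "\<And>t. t \<in> {0..<T} \<Longrightarrow> q t = q_C T \<alpha> C t"
    and \<sigma>: "continuous_on {0..} \<sigma>" "(\<forall>t\<in>{0..<T}. \<sigma> t = 1) \<or> (\<forall>t\<in>{0..<T}. \<sigma> t = - 1)"
    and U: "ou_bridge M B q \<sigma> Z T N U" and X: "alpha_wiener_bridge M' W \<alpha> T N' X"
  shows "same_fdd {0..<T} N U N' X"
proof -
  obtain V where B: "wiener_process M B" and V: "same_fdd {0..<T} N U M V" "\<And>t. 0 \<le> t \<Longrightarrow> \<sigma> t \<noteq> 0"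
    "\<And>t. t \<in> {0..<T} \<Longrightarrow> is_wiener_integral M B 0 t
       (\<lambda>s. ou_gamma q \<sigma> t T / ou_gamma q \<sigma> s T * exp (q_bar q t - q_bar q s) * \<sigma> s) (V t)"
    by (rule ou_bridge_fddE[OF U]) (rule that)
  obtain Y where W: "wiener_process M' W" and Y: "same_fdd {0..<T} N' X M' Y"
    "\<And>t. t \<in> {0..<T} \<Longrightarrow> is_wiener_integral M' W 0 t (\<lambda>s. exp (q_bar alpha_drift t) * exp (- q_bar alpha_drift s)) (Y t)"
    by (rule alpha_wiener_bridge_fddE[OF X]) (rule that)
  let ?k = "\<lambda>t s. exp (q_bar alpha_drift t) * exp (- q_bar alpha_drift s)"
  have \<sigma>1: "(\<sigma> t)\<^sup>2 = 1" if "t \<in> {0..<T}" for t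
    using \<sigma>(2) that by auto
  have kernel: "ou_gamma q \<sigma> t T / ou_gamma q \<sigma> s T * exp (q_bar q t - q_bar q s) = ?k t s"
    if "s \<in> {0..t}" "t \<in> {0..<T}" for s t
    using ou_kernel_eq[OF T q(1) \<sigma>(1) continuous_on_alpha_drift C _ \<sigma>1 integral_exp_q_bar_at_top[OF T \<alpha> lim], of s t]
      that q(2) q_C_altdef[OF \<alpha>] by (auto simp: exp_diff exp_minus divide_inverse)
  have V': "is_wiener_integral M B 0 t (\<lambda>s. ?k t s * \<sigma> s) (V t)" if "t \<in> {0..<T}" for t
    using V(3)[OF that] by (rule is_wiener_integral_cong[THEN iffD1, rotated]) (simp only: kernel[OF _ that])
  have "same_fdd {0..<T} M V M' Y"
    using \<sigma>(2)
  proof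
    assume "\<forall>t\<in>{0..<T}. \<sigma> t = 1"
    then have 1: "\<sigma> s = 1" if "s \<in> {0..t}" "t \<in> {0..<T}" for s t
      using that by auto
    have "is_wiener_integral M B 0 t (?k t) (V t)" if "t \<in> {0..<T}" for t
      using V'[OF that] by (rule is_wiener_integral_cong[THEN iffD1, rotated]) (simp add: 1[OF _ that])
    from same_fdd_wiener_integrals[where f = ?k, OF B W this Y(2)] show ?thesis .
  next
    assume "\<forall>t\<in>{0..<T}. \<sigma> t = - 1"
    then have 1: "\<sigma> s = - 1" if "s \<in> {0..t}" "t \<in> {0..<T}" for s t
      using that by auto
    have "is_wiener_integral M B 0 t (\<lambda>s. - ?k t s) (V t)" if "t \<in> {0..<T}" for t
      using V'[OF that] by (rule is_wiener_integral_cong[THEN iffD1, rotated]) (simp add: 1[OF _ that])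
    then have "is_wiener_integral M (\<lambda>t \<omega>. - B t \<omega>) 0 t (?k t) (V t)" if "t \<in> {0..<T}" for t
      by (rule is_wiener_integral_uminus) (rule that)
    from same_fdd_wiener_integrals[where f = ?k, OF wiener_process.wiener_process_uminus[OF B] W this Y(2)]
    show ?thesis .
  qed
  from same_fdd_trans[OF same_fdd_trans[OF V(1) this] same_fdd_sym[OF Y(1)]] show ?thesis .
qed

end

theorem theorem3p10:
  fixes T :: real and \<alpha> :: "real \<Rightarrow> real"
  assumes "0 < T"
    and "continuously_differentiable_on \<alpha> {0..<T}"
    and "(\<alpha> \<longlongrightarrow> 1) (at_left T)"
  shows
    "(\<forall>q \<sigma> (M :: 'a measure) B Z (N :: 'b measure) U (M' :: 'c measure) W (N' :: 'd measure) X.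
        continuous_on {0..} q \<and> continuous_on {0..} \<sigma> \<and>
        continuously_differentiable_on q {0..<T} \<and>
        ou_bridge M B q \<sigma> Z T N U \<and> alpha_wiener_bridge M' W \<alpha> T N' X \<and>
        same_fdd {0..<T} N U N' X \<longrightarrow>
        (\<exists>C>0. \<forall>t\<in>{0..<T}. q t = q_C T \<alpha> C t) \<and>
        ((\<forall>t\<in>{0..<T}. \<sigma> t = 1) \<or> (\<forall>t\<in>{0..<T}. \<sigma> t = - 1)))
     \<and>
     (\<forall>C>0. (\<exists>L. (q_C T \<alpha> C \<longlongrightarrow> L) (at_left T)) \<longrightarrow>
        (\<exists>q. continuous_on {0..} q \<and> (\<forall>t\<in>{0..<T}. q t = q_C T \<alpha> C t)) \<and>
        (\<forall>q \<sigma> (M :: 'a measure) B Z (N :: 'b measure) U (M' :: 'c measure) W (N' :: 'd measure) X.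
           continuous_on {0..} q \<and> (\<forall>t\<in>{0..<T}. q t = q_C T \<alpha> C t) \<and>
           continuous_on {0..} \<sigma> \<and>
           ((\<forall>t\<in>{0..<T}. \<sigma> t = 1) \<or> (\<forall>t\<in>{0..<T}. \<sigma> t = - 1)) \<and>
           ou_bridge M B q \<sigma> Z T N U \<and> alpha_wiener_bridge M' W \<alpha> T N' X \<longrightarrow>
           same_fdd {0..<T} N U N' X))"
proof (intro conjI allI impI)
  have \<alpha>: "continuous_on {0..<T} \<alpha>"
    using assms(2) by (rule continuously_differentiable_on_imp_continuous_on)
  {
    fix q \<sigma> and M :: "'a measure" and B Z and N :: "'b measure" and U and M' :: "'c measure" and W
      and N' :: "'d measure" and X
    assume *: "continuous_on {0..} q \<and> continuous_on {0..} \<sigma> \<and>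
        continuously_differentiable_on q {0..<T} \<and>
        ou_bridge M B q \<sigma> Z T N U \<and> alpha_wiener_bridge M' W \<alpha> T N' X \<and>
        same_fdd {0..<T} N U N' X"
    then have "(\<exists>C>0. \<forall>t\<in>{0..<T}. q t = q_C T \<alpha> C t) \<and>
        ((\<forall>t\<in>{0..<T}. \<sigma> t = 1) \<or> (\<forall>t\<in>{0..<T}. \<sigma> t = - 1))"
      by (elim conjE) (rule ou_bridge_eq_alpha_bridge_imp[OF assms(1) \<alpha>])
    then show "\<exists>C>0. \<forall>t\<in>{0..<T}. q t = q_C T \<alpha> C t"
      and "(\<forall>t\<in>{0..<T}. \<sigma> t = 1) \<or> (\<forall>t\<in>{0..<T}. \<sigma> t = - 1)"
      by blast+
  }
  fix C :: real assume C: "0 < C" and "\<exists>L. (q_C T \<alpha> C \<longlongrightarrow> L) (at_left T)"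
  then obtain L where L: "(q_C T \<alpha> C \<longlongrightarrow> L) (at_left T)" by blast
  show "\<exists>q. continuous_on {0..} q \<and> (\<forall>t\<in>{0..<T}. q t = q_C T \<alpha> C t)"
    using extend_limit_continuous_on[OF assms(1) continuous_on_q_C[OF assms(1) \<alpha> C] L]
    by (intro exI[of _ "\<lambda>t. if t < T then q_C T \<alpha> C t else L"]) simp
  fix q \<sigma> and M :: "'a measure" and B Z and N :: "'b measure" and U and M' :: "'c measure" and W
    and N' :: "'d measure" and X
  assume "continuous_on {0..} q \<and> (\<forall>t\<in>{0..<T}. q t = q_C T \<alpha> C t) \<and>
           continuous_on {0..} \<sigma> \<and>
           ((\<forall>t\<in>{0..<T}. \<sigma> t = 1) \<or> (\<forall>t\<in>{0..<T}. \<sigma> t = - 1)) \<and>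
           ou_bridge M B q \<sigma> Z T N U \<and> alpha_wiener_bridge M' W \<alpha> T N' X"
  then show "same_fdd {0..<T} N U N' X"
    by (elim conjE) (rule ou_bridge_q_C_eq_alpha_bridge[OF assms(1) \<alpha> assms(3) C], auto)
qed

end
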